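(* Let $m,n$ be nonnegative integers, not both zero (the case $m=n$ is allowed), and write $z^+(u)=1-\sum_{r\geqslant1}z^{(-r)}u^{r-1}$. The coefficients $z^{(-r)}$, $r=1,2,\ldots$, of the series $z^+(u)$ are algebraically independent.
   Context: Everything is over $\mathbb{C}$; $m,n$ are nonnegative integers, not both zero, and both $m\neq n$ and $m=n$ are allowed. Put $\bar i=0$ for $i=1,\ldots,m$ and $\bar i=1$ for $i=m+1,\ldots,m+n$. The matrix units $e_{ij}\in\mathrm{End}\,\mathbb{C}^{m|n}$ have parity $\bar i+\bar j$. Tensor products of superalgebras have multiplication $(a\otimes b)(c\otimes d)=(-1)^{|b||c|}ac\otimes bd$. $R(u)=1-Pu^{-1}$ with $P=\sum_{i,j=1}^{m+n}e_{ij}\otimes e_{ji}(-1)^{\bar j}$. The dual Yangian $\mathrm{Y}^+(\mathfrak{gl}_{m|n})$ is the $\mathbb{Z}_2$-graded unital associative algebra generated by $t_{ij}^{(-r)}$ ($i,j=1,\ldots,m+n$, $r=1,2,\ldots$) of parity $\bar i+\bar j$ with defining relation $R(u-v)T_1^+(u)T_2^+(v)=T_2^+(v)T_1^+(u)R(u-v)$, where $T^+(u)=\sum_{i,j}(-1)^{\bar i\bar j+\bar j}e_{ij}\otimes t_{ij}^+(u)$, $t^+_{ij}(u)=\delta_{ij}-\sum_{r\geqslant1}t_{ij}^{(-r)}u^{r-1}$, and subscripts $1,2$ indicate the copy of $\mathrm{End}\,\mathbb{C}^{m|n}$ on which the matrix acts. The extended dual Yangian $\widetilde{\mathrm{Y}}^+(\mathfrak{gl}_{m|n})$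 is the completion of $\mathrm{Y}^+(\mathfrak{gl}_{m|n})$ with respect to the descending filtration defined by giving $t_{ij}^{(-r)}$ degree $r$. Let $\tau\colon e_{ij}\mapsto(-1)^{\bar i\bar j+\bar i}e_{ji}$ on $\mathrm{End}\,\mathbb{C}^{m|n}$; $\tau_2$ means that $\tau$ is applied to the second tensor factor, and $(X_2)^\tau$ means that $\tau$ is applied to the copy of $\mathrm{End}\,\mathbb{C}^{m|n}$ on which $X_2$ acts. The series $z^+(u)\in\widetilde{\mathrm{Y}}^+(\mathfrak{gl}_{m|n})[[u]]$ is the unique power series with $$P^{\tau_2}\,T^+_1(u+m-n)\big(T^+_2(u)^{-1}\big)^\tau=P^{\tau_2}\otimes z^+(u).$$ Its coefficients are central in $\widetilde{\mathrm{Y}}^+(\mathfrak{gl}_{m|n})$; existence, uniqueness and centrality hold for $m=n$ as well. Algebraic independence means that no nonzero polynomial over $\mathbb{C}$ in finitely many commuting variables vanishes when evaluated at these elements. *)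

theory Defs
  imports Complex_Main "HOL-Algebra.QuotRing" "HOL-Library.Poly_Mapping"
begin

section \<open>Complex superalgebras\<close>

text \<open>
  A superalgebra over the complex numbers is a ring together with its structure map
  \<open>scalar\<close> from the complex numbers and its grading. The \<open>\<int>\<^sub>2\<close>-grading is recorded by the
  involution \<open>invol\<close> that sends a homogeneous element \<open>a\<close> to \<open>(-1)^|a| a\<close>.
\<close>

record 'a superalgebra = "'a ring" +
  invol :: "'a \<Rightarrow> 'a"
  scalar :: "complex \<Rightarrow> 'a"

definition signed :: "('a, 'b) ring_scheme \<Rightarrow> nat \<Rightarrow> 'a \<Rightarrow> 'a" where
  "signed A k a = (if even k then a else \<ominus>\<^bsub>A\<^esub> a)"

definition super_quot :: "'a superalgebra \<Rightarrow> 'a set \<Rightarrow> 'a set superalgebra" where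
  "super_quot A I = ring.extend (A Quot I)
     (superalgebra.fields (\<lambda>X. invol A ` X) (\<lambda>c. I +>\<^bsub>A\<^esub> scalar A c))"


subsection \<open>Formal power series in an even variable\<close>

definition power_series :: "'a superalgebra \<Rightarrow> (nat \<Rightarrow> 'a) superalgebra" where
  "power_series A = \<lparr>
     carrier = {f. \<forall>k. f k \<in> carrier A},
     monoid.mult = (\<lambda>f g k. \<Oplus>\<^bsub>A\<^esub>i\<in>{..k}. f i \<otimes>\<^bsub>A\<^esub> g (k - i)),
     one = (\<lambda>k. if k = 0 then \<one>\<^bsub>A\<^esub> else \<zero>\<^bsub>A\<^esub>),
     zero = (\<lambda>k. \<zero>\<^bsub>A\<^esub>),
     add = (\<lambda>f g k. f k \<oplus>\<^bsub>A\<^esub> g k),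
     invol = (\<lambda>f k. invol A (f k)),
     scalar = (\<lambda>c k. if k = 0 then scalar A c else \<zero>\<^bsub>A\<^esub>)\<rparr>"

definition ps_const :: "('a, 'b) ring_scheme \<Rightarrow> 'a \<Rightarrow> nat \<Rightarrow> 'a" where
  "ps_const A a = (\<lambda>k. if k = 0 then a else \<zero>\<^bsub>A\<^esub>)"

definition ps_var :: "('a, 'b) ring_scheme \<Rightarrow> nat \<Rightarrow> 'a" where
  "ps_var A = (\<lambda>k. if k = 1 then \<one>\<^bsub>A\<^esub> else \<zero>\<^bsub>A\<^esub>)"

text \<open>The series \<open>a - (\<Sum>r\<ge>1. x r * u ^ (r - 1))\<close>.\<close>

definition minus_series :: "('a, 'b) ring_scheme \<Rightarrow> 'a \<Rightarrow> (nat \<Rightarrow> 'a) \<Rightarrow> nat \<Rightarrow> 'a" where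
  "minus_series A a x = (\<lambda>k. ps_const A a k \<ominus>\<^bsub>A\<^esub> x (Suc k))"


subsection \<open>Tensoring with the endomorphisms of the superspace of dimension m|n\<close>

definition idx :: "nat \<Rightarrow> nat \<Rightarrow> nat set" where
  "idx m n = {1..m + n}"

definition par :: "nat \<Rightarrow> nat \<Rightarrow> nat" where
  "par m i = (if i \<le> m then 0 else 1)"

text \<open>
  \<open>End_tensor m n A\<close> is the superalgebra tensor product of \<open>End (\<complex>\<^bsup>m|n\<^esup>)\<close> with \<open>A\<close>; the
  function \<open>X\<close> stands for \<open>\<Sum>i j. e\<^sub>i\<^sub>j \<otimes> X i j\<close>. The multiplication is determined by
  \<open>(e\<^sub>i\<^sub>j \<otimes> a) (e\<^sub>k\<^sub>l \<otimes> b) = (-1)^(|a| |e\<^sub>k\<^sub>l|) e\<^sub>i\<^sub>j e\<^sub>k\<^sub>l \<otimes> a b\<close>, so that \<open>invol A\<close> is applied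
  to \<open>a\<close> whenever \<open>e\<^sub>k\<^sub>l\<close> is odd. Applied twice, it yields \<open>End \<otimes> End \<otimes> A\<close>, where
  \<open>X i j k l\<close> is the coefficient of \<open>e\<^sub>i\<^sub>j \<otimes> e\<^sub>k\<^sub>l\<close>.
\<close>

definition End_tensor ::
    "nat \<Rightarrow> nat \<Rightarrow> 'a superalgebra \<Rightarrow> (nat \<Rightarrow> nat \<Rightarrow> 'a) superalgebra" where
  "End_tensor m n A = \<lparr>
     carrier = {X. \<forall>i j. if i \<in> idx m n \<and> j \<in> idx m n then X i j \<in> carrier A
                         else X i j = \<zero>\<^bsub>A\<^esub>},
     monoid.mult = (\<lambda>X Y i l. if i \<in> idx m n \<and> l \<in> idx m n
        then \<Oplus>\<^bsub>A\<^esub>j\<in>idx m n.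
               (if even (par m j + par m l) then X i j else invol A (X i j)) \<otimes>\<^bsub>A\<^esub> Y j l
        else \<zero>\<^bsub>A\<^esub>),
     one = (\<lambda>i j. if i \<in> idx m n \<and> i = j then \<one>\<^bsub>A\<^esub> else \<zero>\<^bsub>A\<^esub>),
     zero = (\<lambda>i j. \<zero>\<^bsub>A\<^esub>),
     add = (\<lambda>X Y i j. X i j \<oplus>\<^bsub>A\<^esub> Y i j),
     invol = (\<lambda>X i j. signed A (par m i + par m j) (invol A (X i j))),
     scalar = (\<lambda>c i j. if i \<in> idx m n \<and> i = j then scalar A c else \<zero>\<^bsub>A\<^esub>)\<rparr>"

abbreviation End2_tensor ::
    "nat \<Rightarrow> nat \<Rightarrow> 'a superalgebra \<Rightarrow> (nat \<Rightarrow> nat \<Rightarrow> nat \<Rightarrow> nat \<Rightarrow> 'a) superalgebra" where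
  "End2_tensor m n A \<equiv> End_tensor m n (End_tensor m n A)"

text \<open>The embedding \<open>a \<mapsto> 1 \<otimes> a\<close> of \<open>A\<close> into \<open>End \<otimes> A\<close>.\<close>

definition one_tensor ::
    "nat \<Rightarrow> nat \<Rightarrow> ('a, 'b) ring_scheme \<Rightarrow> 'a \<Rightarrow> nat \<Rightarrow> nat \<Rightarrow> 'a" where
  "one_tensor m n A a = (\<lambda>i j. if i \<in> idx m n \<and> i = j then a else \<zero>\<^bsub>A\<^esub>)"

text \<open>For \<open>X\<close> in \<open>End \<otimes> A\<close>, the elements \<open>X\<^sub>1\<close> and \<open>X\<^sub>2\<close> of \<open>End \<otimes> End \<otimes> A\<close>.\<close>

definition copy1 ::
    "nat \<Rightarrow> nat \<Rightarrow> 'a superalgebra \<Rightarrow> (nat \<Rightarrow> nat \<Rightarrow> 'a) \<Rightarrow> nat \<Rightarrow> nat \<Rightarrow> nat \<Rightarrow> nat \<Rightarrow> 'a" where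
  "copy1 m n A X = (\<lambda>i j. one_tensor m n A (X i j))"

definition copy2 ::
    "nat \<Rightarrow> nat \<Rightarrow> 'a superalgebra \<Rightarrow> (nat \<Rightarrow> nat \<Rightarrow> 'a) \<Rightarrow> nat \<Rightarrow> nat \<Rightarrow> nat \<Rightarrow> nat \<Rightarrow> 'a" where
  "copy2 m n A X = one_tensor m n (End_tensor m n A) X"

text \<open>The permutation element \<open>P = (\<Sum>i j. (-1)^(par j) e\<^sub>i\<^sub>j \<otimes> e\<^sub>j\<^sub>i)\<close>.\<close>

definition perm_elt ::
    "nat \<Rightarrow> nat \<Rightarrow> 'a superalgebra \<Rightarrow> nat \<Rightarrow> nat \<Rightarrow> nat \<Rightarrow> nat \<Rightarrow> 'a" where
  "perm_elt m n A = (\<lambda>i j k l.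
     if i \<in> idx m n \<and> j \<in> idx m n \<and> k = j \<and> l = i then signed A (par m j) \<one>\<^bsub>A\<^esub> else \<zero>\<^bsub>A\<^esub>)"

text \<open>The supertransposition \<open>\<tau> : e\<^sub>i\<^sub>j \<mapsto> (-1)^(par i * par j + par i) e\<^sub>j\<^sub>i\<close>.\<close>

definition supertranspose ::
    "nat \<Rightarrow> 'a superalgebra \<Rightarrow> (nat \<Rightarrow> nat \<Rightarrow> 'a) \<Rightarrow> nat \<Rightarrow> nat \<Rightarrow> 'a" where
  "supertranspose m A X = (\<lambda>j i. signed A (par m i * par m j + par m i) (X i j))"

definition supertranspose2 ::
    "nat \<Rightarrow> 'a superalgebra \<Rightarrow> (nat \<Rightarrow> nat \<Rightarrow> nat \<Rightarrow> nat \<Rightarrow> 'a) \<Rightarrow> nat \<Rightarrow> nat \<Rightarrow> nat \<Rightarrow> nat \<Rightarrow> 'a"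
  where
  "supertranspose2 m A X = (\<lambda>i j. supertranspose m A (X i j))"

text \<open>
  The matrix \<open>T\<^sup>+(u)\<close> in \<open>End \<otimes> A[[u]]\<close> whose \<open>t\<^sub>i\<^sub>j\<^sup>+(u)\<close> has coefficients taken from a
  family \<open>t\<close> in \<open>A\<close>, where \<open>t i j r\<close> stands for \<open>t\<^sub>i\<^sub>j\<^bsup>(-r)\<^esup>\<close>.
\<close>

definition T_plus ::
    "nat \<Rightarrow> nat \<Rightarrow> 'a superalgebra \<Rightarrow> (nat \<Rightarrow> nat \<Rightarrow> nat \<Rightarrow> 'a) \<Rightarrow> nat \<Rightarrow> nat \<Rightarrow> nat \<Rightarrow> 'a" where
  "T_plus m n A t = (\<lambda>i j. if i \<in> idx m n \<and> j \<in> idx m n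
     then signed (power_series A) (par m i * par m j + par m j)
            (minus_series A (if i = j then \<one>\<^bsub>A\<^esub> else \<zero>\<^bsub>A\<^esub>) (t i j))
     else \<zero>\<^bsub>power_series A\<^esub>)"


section \<open>The dual Yangian\<close>

subsection \<open>The free superalgebra on the generators\<close>

datatype 'a word = Word (letters: "'a list")

instantiation word :: (type) monoid_add
begin

definition zero_word :: "'a word" where
  "zero_word = Word []"

definition plus_word :: "'a word \<Rightarrow> 'a word \<Rightarrow> 'a word" where
  "plus_word v w = Word (letters v @ letters w)"

instance
  by standard (simp_all add: zero_word_def plus_word_def)

end

text \<open>The triple \<open>(i, j, r)\<close> labels the generator \<open>t\<^sub>i\<^sub>j\<^bsup>(-r)\<^esup>\<close>.\<close>

type_synonym gen = "nat \<times> nat \<times> nat"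

type_synonym free_alg = "gen word \<Rightarrow>\<^sub>0 complex"

definition gens :: "nat \<Rightarrow> nat \<Rightarrow> gen set" where
  "gens m n = {(i, j, r). i \<in> idx m n \<and> j \<in> idx m n \<and> 1 \<le> r}"

definition word_parity :: "nat \<Rightarrow> gen word \<Rightarrow> nat" where
  "word_parity m w = (\<Sum>(i, j, r)\<leftarrow>letters w. par m i + par m j)"

definition word_degree :: "gen word \<Rightarrow> nat" where
  "word_degree w = (\<Sum>(i, j, r)\<leftarrow>letters w. r)"

definition free_superalgebra :: "nat \<Rightarrow> nat \<Rightarrow> free_alg superalgebra" where
  "free_superalgebra m n = \<lparr>
     carrier = {f. \<forall>w\<in>Poly_Mapping.keys f. set (letters w) \<subseteq> gens m n},
     monoid.mult = (*),
     one = 1,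
     zero = 0,
     add = (+),
     invol = Poly_Mapping.mapp (\<lambda>w c. (- 1) ^ word_parity m w * c),
     scalar = Poly_Mapping.single 0\<rparr>"

definition free_gen :: "nat \<Rightarrow> nat \<Rightarrow> nat \<Rightarrow> free_alg" where
  "free_gen i j r = Poly_Mapping.single (Word [(i, j, r)]) 1"


subsection \<open>The defining relation\<close>

text \<open>
  The relation \<open>R(u-v) T\<^sub>1\<^sup>+(u) T\<^sub>2\<^sup>+(v) = T\<^sub>2\<^sup>+(v) T\<^sub>1\<^sup>+(u) R(u-v)\<close> involves the pole
  \<open>(u-v)\<^sup>-\<^sup>1\<close>. It is read, as usual, as an identity of formal power series in \<open>u\<close> and \<open>v\<close> after
  multiplication by the central non-zero-divisor \<open>u-v\<close>, that is, with \<open>R(u-v)\<close> replaced by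
  \<open>(u-v) R(u-v) = (u-v) - P\<close>. Series in \<open>u\<close> and \<open>v\<close> are elements of \<open>A[[u]][[v]]\<close>, so
  \<open>f q p\<close> is the coefficient of \<open>v^q u^p\<close>.
\<close>

abbreviation power_series2 :: "'a superalgebra \<Rightarrow> (nat \<Rightarrow> nat \<Rightarrow> 'a) superalgebra" where
  "power_series2 A \<equiv> power_series (power_series A)"

definition in_u :: "'a superalgebra \<Rightarrow> (nat \<Rightarrow> 'a) \<Rightarrow> nat \<Rightarrow> nat \<Rightarrow> 'a" where
  "in_u A f = ps_const (power_series A) f"

definition in_v :: "'a superalgebra \<Rightarrow> (nat \<Rightarrow> 'a) \<Rightarrow> nat \<Rightarrow> nat \<Rightarrow> 'a" where
  "in_v A f = (\<lambda>q. ps_const A (f q))"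

definition cleared_R ::
    "nat \<Rightarrow> nat \<Rightarrow> 'a superalgebra \<Rightarrow> nat \<Rightarrow> nat \<Rightarrow> nat \<Rightarrow> nat \<Rightarrow> nat \<Rightarrow> nat \<Rightarrow> 'a" where
  "cleared_R m n A =
     (let B = power_series2 A
      in one_tensor m n (End_tensor m n B) (one_tensor m n B
           (in_u A (ps_var A) \<ominus>\<^bsub>B\<^esub> in_v A (ps_var A)))
         \<ominus>\<^bsub>End2_tensor m n B\<^esub> perm_elt m n B)"

definition RTT_lhs ::
    "nat \<Rightarrow> nat \<Rightarrow> 'a superalgebra \<Rightarrow> (nat \<Rightarrow> nat \<Rightarrow> nat \<Rightarrow> 'a)
      \<Rightarrow> nat \<Rightarrow> nat \<Rightarrow> nat \<Rightarrow> nat \<Rightarrow> nat \<Rightarrow> nat \<Rightarrow> 'a" where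
  "RTT_lhs m n A t =
     (let B = power_series2 A; E = End2_tensor m n B; T = T_plus m n A t
      in cleared_R m n A \<otimes>\<^bsub>E\<^esub> copy1 m n B (\<lambda>i j. in_u A (T i j))
                         \<otimes>\<^bsub>E\<^esub> copy2 m n B (\<lambda>i j. in_v A (T i j)))"

definition RTT_rhs ::
    "nat \<Rightarrow> nat \<Rightarrow> 'a superalgebra \<Rightarrow> (nat \<Rightarrow> nat \<Rightarrow> nat \<Rightarrow> 'a)
      \<Rightarrow> nat \<Rightarrow> nat \<Rightarrow> nat \<Rightarrow> nat \<Rightarrow> nat \<Rightarrow> nat \<Rightarrow> 'a" where
  "RTT_rhs m n A t =
     (let B = power_series2 A; E = End2_tensor m n B; T = T_plus m n A t
      in copy2 m n B (\<lambda>i j. in_v A (T i j)) \<otimes>\<^bsub>E\<^esub> copy1 m n B (\<lambda>i j. in_u A (T i j))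
           \<otimes>\<^bsub>E\<^esub> cleared_R m n A)"

definition RTT_ideal :: "nat \<Rightarrow> nat \<Rightarrow> free_alg set" where
  "RTT_ideal m n =
     (let A = free_superalgebra m n
      in Idl\<^bsub>A\<^esub> {RTT_lhs m n A free_gen i j k l q p \<ominus>\<^bsub>A\<^esub> RTT_rhs m n A free_gen i j k l q p
               | i j k l q p. True})"

definition dual_yangian :: "nat \<Rightarrow> nat \<Rightarrow> free_alg set superalgebra" where
  "dual_yangian m n = super_quot (free_superalgebra m n) (RTT_ideal m n)"

definition dual_yangian_gen :: "nat \<Rightarrow> nat \<Rightarrow> nat \<Rightarrow> nat \<Rightarrow> nat \<Rightarrow> free_alg set" where
  "dual_yangian_gen m n i j r = RTT_ideal m n +>\<^bsub>free_superalgebra m n\<^esub> free_gen i j r"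


section \<open>The extended dual Yangian\<close>

text \<open>
  The completion of \<open>A\<close> with respect to a descending filtration \<open>F\<close> by ideals is the inverse
  limit of the quotients \<open>A/F p\<close>. The condition \<open>x q \<subseteq> x p\<close> says that the coset \<open>x q\<close> is mapped
  to the coset \<open>x p\<close> by the projection from \<open>A/F q\<close> to \<open>A/F p\<close>.
\<close>

definition completion ::
    "'a superalgebra \<Rightarrow> (nat \<Rightarrow> 'a set) \<Rightarrow> (nat \<Rightarrow> 'a set) superalgebra" where
  "completion A F = \<lparr>
     carrier = {x. (\<forall>p. x p \<in> carrier (super_quot A (F p))) \<and> (\<forall>p q. p \<le> q \<longrightarrow> x q \<subseteq> x p)},
     monoid.mult = (\<lambda>x y p. x p \<otimes>\<^bsub>super_quot A (F p)\<^esub> y p),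
     one = (\<lambda>p. \<one>\<^bsub>super_quot A (F p)\<^esub>),
     zero = (\<lambda>p. \<zero>\<^bsub>super_quot A (F p)\<^esub>),
     add = (\<lambda>x y p. x p \<oplus>\<^bsub>super_quot A (F p)\<^esub> y p),
     invol = (\<lambda>x p. invol (super_quot A (F p)) (x p)),
     scalar = (\<lambda>c p. scalar (super_quot A (F p)) c)\<rparr>"

definition to_completion :: "'a superalgebra \<Rightarrow> (nat \<Rightarrow> 'a set) \<Rightarrow> 'a \<Rightarrow> nat \<Rightarrow> 'a set" where
  "to_completion A F a = (\<lambda>p. F p +>\<^bsub>A\<^esub> a)"

text \<open>
  The sum of a series in a completion: the limit of its partial sums for the inverse limit
  topology (each quotient being discrete), so each component is the eventual value.
\<close>

definition completed_sum ::
    "(nat \<Rightarrow> 'b, 'c) ring_scheme \<Rightarrow> (nat \<Rightarrow> nat \<Rightarrow> 'b) \<Rightarrow> nat \<Rightarrow> 'b" where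
  "completed_sum C x = (\<lambda>p. THE a. \<exists>N0. \<forall>N\<ge>N0. (\<Oplus>\<^bsub>C\<^esub>s\<in>{..<N}. x s) p = a)"

text \<open>
  The substitution \<open>u \<mapsto> u + c\<close>. The coefficient of \<open>u^k\<close> in \<open>\<Sum>s. f s * (u + c)^s\<close> is the
  sum over all \<open>s\<close> of \<open>(s choose k) * c^(s - k) * f s\<close> (the terms with \<open>s < k\<close> vanish).
\<close>

definition shift_series ::
    "(nat \<Rightarrow> 'b) superalgebra \<Rightarrow> complex \<Rightarrow> (nat \<Rightarrow> nat \<Rightarrow> 'b) \<Rightarrow> nat \<Rightarrow> nat \<Rightarrow> 'b" where
  "shift_series C c f = (\<lambda>k. completed_sum C
     (\<lambda>s. scalar C (of_nat (s choose k) * c ^ (s - k)) \<otimes>\<^bsub>C\<^esub> f s))"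

text \<open>
  The filtration of the dual Yangian in which \<open>t\<^sub>i\<^sub>j\<^bsup>(-r)\<^esup>\<close> has degree \<open>r\<close>: the \<open>p\<close>-th term is
  spanned by the monomials in the generators of total degree at least \<open>p\<close>.
\<close>

definition dual_yangian_filtration :: "nat \<Rightarrow> nat \<Rightarrow> nat \<Rightarrow> free_alg set set" where
  "dual_yangian_filtration m n p =
     {RTT_ideal m n +>\<^bsub>free_superalgebra m n\<^esub> f | f.
        f \<in> carrier (free_superalgebra m n) \<and> (\<forall>w\<in>Poly_Mapping.keys f. p \<le> word_degree w)}"

type_synonym ext_yangian = "nat \<Rightarrow> free_alg set set"

definition ext_dual_yangian :: "nat \<Rightarrow> nat \<Rightarrow> ext_yangian superalgebra" where
  "ext_dual_yangian m n = completion (dual_yangian m n) (dual_yangian_filtration m n)"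

definition ext_dual_yangian_gen :: "nat \<Rightarrow> nat \<Rightarrow> nat \<Rightarrow> nat \<Rightarrow> nat \<Rightarrow> ext_yangian" where
  "ext_dual_yangian_gen m n i j r =
     to_completion (dual_yangian m n) (dual_yangian_filtration m n) (dual_yangian_gen m n i j r)"


section \<open>The series \<open>z\<^sup>+(u)\<close>\<close>

text \<open>
  The defining property of \<open>z\<^sup>+(u)\<close>. Since \<open>P\<^bsup>\<tau>\<^esup> \<otimes> z = (P\<^bsup>\<tau>\<^esup> \<otimes> 1) (1 \<otimes> 1 \<otimes> z)\<close> without
  sign, the right-hand side is written as such a product.
\<close>

definition is_z_plus :: "nat \<Rightarrow> nat \<Rightarrow> (nat \<Rightarrow> ext_yangian) \<Rightarrow> bool" where
  "is_z_plus m n Z \<longleftrightarrow>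
     (let Y = ext_dual_yangian m n;
          B = power_series Y;
          E = End2_tensor m n B;
          T = T_plus m n Y (ext_dual_yangian_gen m n);
          T_shifted = (\<lambda>i j. shift_series Y (of_nat m - of_nat n) (T i j));
          Q = supertranspose2 m B (perm_elt m n B)
      in Z \<in> carrier B \<and>
         Q \<otimes>\<^bsub>E\<^esub> copy1 m n B T_shifted
           \<otimes>\<^bsub>E\<^esub> supertranspose2 m B (inv\<^bsub>E\<^esub> (copy2 m n B T))
         = Q \<otimes>\<^bsub>E\<^esub> one_tensor m n (End_tensor m n B) (one_tensor m n B Z))"


section \<open>Algebraic independence\<close>

text \<open>
  Polynomials in commuting variables indexed by natural numbers are finitely supported maps from
  exponent vectors to complex coefficients; every such polynomial involves finitely many
  variables. They are evaluated at families of pairwise commuting elements only, so the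
  increasing order of the factors of a monomial is immaterial.
\<close>

definition eval_monomial :: "('a, 'b) ring_scheme \<Rightarrow> (nat \<Rightarrow> 'a) \<Rightarrow> (nat \<Rightarrow>\<^sub>0 nat) \<Rightarrow> 'a" where
  "eval_monomial A x e =
     foldr (\<lambda>r y. x r [^]\<^bsub>A\<^esub> Poly_Mapping.lookup e r \<otimes>\<^bsub>A\<^esub> y)
       (sorted_list_of_set (Poly_Mapping.keys e)) \<one>\<^bsub>A\<^esub>"

definition eval_polynomial ::
    "'a superalgebra \<Rightarrow> (nat \<Rightarrow> 'a) \<Rightarrow> ((nat \<Rightarrow>\<^sub>0 nat) \<Rightarrow>\<^sub>0 complex) \<Rightarrow> 'a" where
  "eval_polynomial A x f =
     (\<Oplus>\<^bsub>A\<^esub>e\<in>Poly_Mapping.keys f.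
        scalar A (Poly_Mapping.lookup f e) \<otimes>\<^bsub>A\<^esub> eval_monomial A x e)"

definition algebraically_independent :: "'a superalgebra \<Rightarrow> nat set \<Rightarrow> (nat \<Rightarrow> 'a) \<Rightarrow> bool" where
  "algebraically_independent A S x \<longleftrightarrow>
     (\<forall>f :: (nat \<Rightarrow>\<^sub>0 nat) \<Rightarrow>\<^sub>0 complex.
        (\<forall>e\<in>Poly_Mapping.keys f. Poly_Mapping.keys e \<subseteq> S) \<longrightarrow> f \<noteq> 0 \<longrightarrow>
        eval_polynomial A x f \<noteq> \<zero>\<^bsub>A\<^esub>)"

end

theory Submission
  imports Defs "HOL-Computational_Algebra.Formal_Power_Series" "HOL-Computational_Algebra.Polynomial"
begin

text \<open>
  For numbers \<open>\<beta>\<^sub>1, \<dots>, \<beta>\<^sub>N\<close> the extended dual Yangian acts on the \<open>N\<close>-th tensor power of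
  \<open>\<complex>\<^bsup>m|n\<^esup>\<close>, with scalars extended to the power series in \<open>\<epsilon>\<close>, by
  \<open>T\<^sup>+(u) \<mapsto> R\<^sub>0\<^sub>1(u - a\<^sub>1) \<dots> R\<^sub>0\<^sub>N(u - a\<^sub>N)\<close> where \<open>a\<^sub>i = 1 / (\<beta>\<^sub>i \<epsilon>)\<close>: the image of
  \<open>t\<^sub>i\<^sub>j\<^bsup>(-r)\<^esup>\<close> is divisible by \<open>\<epsilon>\<^sup>r\<close>, so the action extends to the completion. By the crossing
  symmetry of \<open>R(u)\<close>, the series \<open>z\<^sup>+(u)\<close> acts as the scalar
  \<open>\<Prod>\<^sub>i (1 - (u - a\<^sub>i)\<^bsup>-2\<^esup>)\<^bsup>-1\<^esup>\<close>, for \<open>m = n\<close> as well. Hence \<open>z\<^bsup>(-r)\<^esup>\<close> acts as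
  \<open>- r p\<^sub>r\<^sub>+\<^sub>1(\<beta>) \<epsilon>\<^bsup>r + 1\<^esup>\<close> plus higher terms, with the power sums \<open>p\<^sub>k\<close>. These take
  arbitrary values, so the part of lowest \<open>\<epsilon>\<close>-degree of a polynomial relation between the
  \<open>z\<^bsup>(-r)\<^esup>\<close> vanishes identically.
\<close>

text \<open>Independence has to be detected by modules on which the \<open>z r\<close> act by
  sufficiently general scalars. The obstacle is the completion: the shift by m - n produces infinite
  sums of generators, which have no value at a numerical evaluation point a. Taking 1/a proportional
  to a formal variable \<epsilon> turns degree in the filtration into order in \<epsilon>, and these
  sums converge. The scalar is uniform in m and n because two symmetries of R(u) share the work.
  Crossing absorbs the superdimension m - n exactly into the shift of u and contributes no scalar;
  what remains is the factor from unitarity, R(u) R(-u) = 1 - u^-2, by which the inverse of the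
  generator matrix is normalised. One tensor factor supplies a single parameter. Tensoring
  multiplies the scalars, which in leading order adds the powers \<beta>^(r+1), and with arbitrarily
  many factors any finite list of power sums can be prescribed. The r-th variable has weight r + 1,
  the order in \<epsilon> of its leading term, so the part of lowest weight of a relation is tested
  at arbitrary points.\<close>

unbundle fps_syntax

section \<open>Superalgebras and their power series and matrices\<close>

lemma (in abelian_monoid) finsum_swap:
  assumes "finite A" "finite B" "\<And>i j. i \<in> A \<Longrightarrow> j \<in> B \<Longrightarrow> f i j \<in> carrier G"
  shows "(\<Oplus>i\<in>A. \<Oplus>j\<in>B. f i j) = (\<Oplus>j\<in>B. \<Oplus>i\<in>A. f i j)"
  using assms(1,3)
proof (induction A rule: finite_induct)
  case (insert a A)
  then have f: "(\<lambda>i. f i j) \<in> A \<rightarrow> carrier G" "f a j \<in> carrier G" if "j \<in> B" for j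
    using that by auto
  have "(\<Oplus>j\<in>B. \<Oplus>i\<in>insert a A. f i j) = (\<Oplus>j\<in>B. f a j \<oplus> (\<Oplus>i\<in>A. f i j))"
    by (rule finsum_cong') (use insert f in \<open>auto intro!: finsum_insert\<close>)
  also have "\<dots> = (\<Oplus>j\<in>B. f a j) \<oplus> (\<Oplus>j\<in>B. \<Oplus>i\<in>A. f i j)"
    by (rule finsum_addf) (use f in auto)
  finally show ?case
    using insert by (subst finsum_insert) auto
qed simp

lemma finsum_hom:
  assumes "abelian_monoid A" "abelian_monoid B" "finite S" "f \<in> S \<rightarrow> carrier A"
    and "\<And>x. x \<in> carrier A \<Longrightarrow> h x \<in> carrier B"
    and "h \<zero>\<^bsub>A\<^esub> = \<zero>\<^bsub>B\<^esub>"
    and "\<And>x y. x \<in> carrier A \<Longrightarrow> y \<in> carrier A \<Longrightarrow> h (x \<oplus>\<^bsub>A\<^esub> y) = h x \<oplus>\<^bsub>B\<^esub> h y"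
  shows "h (\<Oplus>\<^bsub>A\<^esub>i\<in>S. f i) = (\<Oplus>\<^bsub>B\<^esub>i\<in>S. h (f i))"
  using assms(3,4)
proof (induction S rule: finite_induct)
  case empty
  then show ?case using assms by (simp add: abelian_monoid.finsum_empty)
next
  case (insert a S)
  then have "f \<in> S \<rightarrow> carrier A" "f a \<in> carrier A" by auto
  with insert show ?case
    using assms by (simp add: abelian_monoid.finsum_insert abelian_monoid.finsum_closed Pi_def)
qed

lemma finsum_hom_type:
  fixes h :: "'a \<Rightarrow> 'b::comm_monoid_add"
  assumes "abelian_monoid A" "finite S" "\<And>i. i \<in> S \<Longrightarrow> f i \<in> carrier A"
    and "h \<zero>\<^bsub>A\<^esub> = 0"
    and "\<And>x y. x \<in> carrier A \<Longrightarrow> y \<in> carrier A \<Longrightarrow> h (x \<oplus>\<^bsub>A\<^esub> y) = h x + h y"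
  shows "h (\<Oplus>\<^bsub>A\<^esub>i\<in>S. f i) = (\<Sum>i\<in>S. h (f i))"
  using assms(2,3)
proof (induction S rule: finite_induct)
  case empty
  then show ?case using assms by (simp add: abelian_monoid.finsum_empty)
next
  case (insert a S)
  then show ?case
    using assms by (simp add: abelian_monoid.finsum_insert abelian_monoid.finsum_closed Pi_def)
qed

locale superalg = ring A for A :: "'a superalgebra" (structure) +
  assumes invol_closed [simp]: "a \<in> carrier A \<Longrightarrow> invol A a \<in> carrier A"
    and invol_invol [simp]: "a \<in> carrier A \<Longrightarrow> invol A (invol A a) = a"
    and invol_add: "a \<in> carrier A \<Longrightarrow> b \<in> carrier A \<Longrightarrow> invol A (a \<oplus> b) = invol A a \<oplus> invol A b"
    and invol_mult: "a \<in> carrier A \<Longrightarrow> b \<in> carrier A \<Longrightarrow> invol A (a \<otimes> b) = invol A a \<otimes> invol A b"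
begin

lemma signed_closed [simp]: "a \<in> carrier A \<Longrightarrow> signed A k a \<in> carrier A"
  by (simp add: signed_def)

lemma signed_signed: "a \<in> carrier A \<Longrightarrow> signed A k (signed A l a) = signed A (k + l) a"
  by (auto simp: signed_def)

lemma signed_zero [simp]: "signed A k \<zero> = \<zero>"
  by (simp add: signed_def)

lemma signed_add:
  "a \<in> carrier A \<Longrightarrow> b \<in> carrier A \<Longrightarrow> signed A k (a \<oplus> b) = signed A k a \<oplus> signed A k b"
  by (simp add: signed_def minus_add)

lemma signed_mult_left:
  "a \<in> carrier A \<Longrightarrow> b \<in> carrier A \<Longrightarrow> signed A k a \<otimes> b = signed A k (a \<otimes> b)"
  by (simp add: signed_def l_minus)

lemma signed_mult_right:
  "a \<in> carrier A \<Longrightarrow> b \<in> carrier A \<Longrightarrow> a \<otimes> signed A k b = signed A k (a \<otimes> b)"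
  by (simp add: signed_def r_minus)

lemma signed_cong: "even k \<longleftrightarrow> even l \<Longrightarrow> signed A k a = signed A l a"
  by (simp add: signed_def)

lemma invol_zero [simp]: "invol A \<zero> = \<zero>"
proof -
  have "invol A \<zero> \<oplus> invol A \<zero> = invol A \<zero> \<oplus> \<zero>"
    using invol_add[of \<zero> \<zero>] by simp
  then show ?thesis by (metis add.l_cancel_one invol_closed r_zero zero_closed)
qed

lemma invol_one [simp]: "invol A \<one> = \<one>"
proof -
  have "\<one> = invol A (invol A \<one>)" by simp
  also have "\<dots> = invol A (\<one> \<otimes> invol A \<one>)" by simp
  also have "\<dots> = invol A \<one> \<otimes> \<one>" by (subst invol_mult) auto
  finally show ?thesis by simp
qed

lemma invol_uminus: "a \<in> carrier A \<Longrightarrow> invol A (\<ominus> a) = \<ominus> invol A a"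
  by (metis a_inv_closed invol_add invol_closed invol_zero minus_equality r_neg add.m_comm)

lemma invol_signed: "a \<in> carrier A \<Longrightarrow> invol A (signed A k a) = signed A k (invol A a)"
  by (simp add: signed_def invol_uminus)

lemma invol_minus:
  "a \<in> carrier A \<Longrightarrow> b \<in> carrier A \<Longrightarrow> invol A (a \<ominus> b) = invol A a \<ominus> invol A b"
  by (simp add: minus_eq invol_add invol_uminus)

lemma invol_finsum:
  assumes "finite S" "f \<in> S \<rightarrow> carrier A"
  shows "invol A (\<Oplus>i\<in>S. f i) = (\<Oplus>i\<in>S. invol A (f i))"
  by (rule finsum_hom) (use assms abelian_monoid_axioms in \<open>auto simp: invol_add\<close>)

lemma signed_finsum:
  assumes "finite S" "f \<in> S \<rightarrow> carrier A"
  shows "signed A k (\<Oplus>i\<in>S. f i) = (\<Oplus>i\<in>S. signed A k (f i))"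
  by (rule finsum_hom) (use assms abelian_monoid_axioms in \<open>auto simp: signed_add\<close>)

text \<open>The Koszul sign of moving \<open>a\<close> past a matrix unit of parity
  \<open>k\<close>: multiplication by (-1)^(k |a|) when \<open>a\<close> is homogeneous. Exponents
  add under composition and matter modulo 2 only, so signs can be collected as natural
  numbers.\<close>

definition tw :: "nat \<Rightarrow> 'a \<Rightarrow> 'a" where
  "tw k a = (if even k then a else invol A a)"

lemma tw_closed [simp]: "a \<in> carrier A \<Longrightarrow> tw k a \<in> carrier A"
  by (simp add: tw_def)

lemma tw_tw: "a \<in> carrier A \<Longrightarrow> tw k (tw l a) = tw (k + l) a"
  by (auto simp: tw_def)

lemma tw_add: "a \<in> carrier A \<Longrightarrow> b \<in> carrier A \<Longrightarrow> tw k (a \<oplus> b) = tw k a \<oplus> tw k b"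
  by (simp add: tw_def invol_add)

lemma tw_mult: "a \<in> carrier A \<Longrightarrow> b \<in> carrier A \<Longrightarrow> tw k (a \<otimes> b) = tw k a \<otimes> tw k b"
  by (simp add: tw_def invol_mult)

lemma tw_zero [simp]: "tw k \<zero> = \<zero>"
  by (simp add: tw_def)

lemma tw_one [simp]: "tw k \<one> = \<one>"
  by (simp add: tw_def)

lemma tw_cong: "even k \<longleftrightarrow> even l \<Longrightarrow> tw k a = tw l a"
  by (simp add: tw_def)

lemma tw_finsum:
  assumes "finite S" "f \<in> S \<rightarrow> carrier A"
  shows "tw k (\<Oplus>i\<in>S. f i) = (\<Oplus>i\<in>S. tw k (f i))"
  using assms by (simp add: tw_def invol_finsum)

lemma invol_tw: "a \<in> carrier A \<Longrightarrow> invol A (tw k a) = tw k (invol A a)"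
  by (simp add: tw_def)

lemma tw_signed: "a \<in> carrier A \<Longrightarrow> tw k (signed A l a) = signed A l (tw k a)"
  by (simp add: tw_def invol_signed)

lemma convolution_assoc:
  assumes "\<And>i. a i \<in> carrier A" "\<And>i. b i \<in> carrier A" "\<And>i. c i \<in> carrier A"
  shows "(\<Oplus>j\<in>{..n::nat}. (\<Oplus>i\<in>{..j}. a i \<otimes> b (j - i)) \<otimes> c (n - j)) =
         (\<Oplus>j\<in>{..n}. a j \<otimes> (\<Oplus>i\<in>{..n-j}. b i \<otimes> c (n - j - i)))"
proof -
  \<comment> \<open>The outer bound is decoupled from the total degree \<open>n\<close>, which stays
    fixed in the index of \<open>c\<close>. Both sides then run over the pairs of indices of
    \<open>a\<close> and \<open>b\<close> with sum at most \<open>k\<close>, and each step of the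
    induction adds one antidiagonal.\<close>
  have "k \<le> n \<Longrightarrow> (\<Oplus>j\<in>{..k}. (\<Oplus>i\<in>{..j}. a i \<otimes> b (j - i)) \<otimes> c (n - j)) =
         (\<Oplus>j\<in>{..k}. a j \<otimes> (\<Oplus>i\<in>{..k-j}. b i \<otimes> c (n - j - i)))" (is "_ \<Longrightarrow> ?eq k") for k
  proof (induct k)
    case 0
    then show ?case using assms by (simp add: Pi_def m_assoc)
  next
    case (Suc k)
    then have "k \<le> n" by arith
    then have "?eq k" by (rule Suc)
    with assms show ?case
      by (simp cong: finsum_cong add: Suc_diff_le Pi_def l_distr r_distr m_assoc)
        (simp cong: finsum_cong add: Pi_def a_ac finsum_ldistr m_assoc)
  qed
  then show ?thesis by simp
qed

end

lemma superalgI: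
  fixes A :: "'a superalgebra" (structure)
  assumes "\<zero> \<in> carrier A" "\<one> \<in> carrier A"
    and "\<And>a b. a \<in> carrier A \<Longrightarrow> b \<in> carrier A \<Longrightarrow> a \<oplus> b \<in> carrier A"
    and "\<And>a b. a \<in> carrier A \<Longrightarrow> b \<in> carrier A \<Longrightarrow> a \<otimes> b \<in> carrier A"
    and "\<And>a b. a \<in> carrier A \<Longrightarrow> b \<in> carrier A \<Longrightarrow> a \<oplus> b = b \<oplus> a"
    and "\<And>a b c. a \<in> carrier A \<Longrightarrow> b \<in> carrier A \<Longrightarrow> c \<in> carrier A \<Longrightarrow> (a \<oplus> b) \<oplus> c = a \<oplus> (b \<oplus> c)"
    and "\<And>a b c. a \<in> carrier A \<Longrightarrow> b \<in> carrier A \<Longrightarrow> c \<in> carrier A \<Longrightarrow> (a \<otimes> b) \<otimes> c = a \<otimes> (b \<otimes> c)"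
    and "\<And>a. a \<in> carrier A \<Longrightarrow> \<zero> \<oplus> a = a"
    and "\<And>a. a \<in> carrier A \<Longrightarrow> \<exists>b\<in>carrier A. b \<oplus> a = \<zero>"
    and "\<And>a. a \<in> carrier A \<Longrightarrow> \<one> \<otimes> a = a"
    and "\<And>a. a \<in> carrier A \<Longrightarrow> a \<otimes> \<one> = a"
    and "\<And>a b c. a \<in> carrier A \<Longrightarrow> b \<in> carrier A \<Longrightarrow> c \<in> carrier A \<Longrightarrow> (a \<oplus> b) \<otimes> c = a \<otimes> c \<oplus> b \<otimes> c"
    and "\<And>a b c. a \<in> carrier A \<Longrightarrow> b \<in> carrier A \<Longrightarrow> c \<in> carrier A \<Longrightarrow> c \<otimes> (a \<oplus> b) = c \<otimes> a \<oplus> c \<otimes> b"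
    and "\<And>a. a \<in> carrier A \<Longrightarrow> invol A a \<in> carrier A"
    and "\<And>a. a \<in> carrier A \<Longrightarrow> invol A (invol A a) = a"
    and "\<And>a b. a \<in> carrier A \<Longrightarrow> b \<in> carrier A \<Longrightarrow> invol A (a \<oplus> b) = invol A a \<oplus> invol A b"
    and "\<And>a b. a \<in> carrier A \<Longrightarrow> b \<in> carrier A \<Longrightarrow> invol A (a \<otimes> b) = invol A a \<otimes> invol A b"
  shows "superalg A"
proof -
  have "ring A"
    by (intro ringI abelian_groupI monoidI) (use assms in auto)
  then show ?thesis
    unfolding superalg_def superalg_axioms_def using assms by auto
qed

section \<open>Formal power series over a superalgebra\<close>

lemma power_series_simps [simp]:
  "carrier (power_series A) = {f. \<forall>k. f k \<in> carrier A}"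
  "zero (power_series A) = (\<lambda>k. \<zero>\<^bsub>A\<^esub>)"
  "one (power_series A) = (\<lambda>k. if k = 0 then \<one>\<^bsub>A\<^esub> else \<zero>\<^bsub>A\<^esub>)"
  "f \<oplus>\<^bsub>power_series A\<^esub> g = (\<lambda>k. f k \<oplus>\<^bsub>A\<^esub> g k)"
  "f \<otimes>\<^bsub>power_series A\<^esub> g = (\<lambda>k. \<Oplus>\<^bsub>A\<^esub>i\<in>{..k}. f i \<otimes>\<^bsub>A\<^esub> g (k - i))"
  "invol (power_series A) f = (\<lambda>k. invol A (f k))"
  by (simp_all add: power_series_def)

context superalg begin

lemma superalg_power_series: "superalg (power_series A)"
proof (rule superalgI; (simp add: a_ac invol_add; fail)?)
  fix a b assume "a \<in> carrier (power_series A)" "b \<in> carrier (power_series A)"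
  then show "invol (power_series A) (a \<otimes>\<^bsub>power_series A\<^esub> b) =
     invol (power_series A) a \<otimes>\<^bsub>power_series A\<^esub> invol (power_series A) b"
    by (auto simp: invol_finsum invol_mult Pi_def fun_eq_iff cong: finsum_cong)
next
  fix a b c assume *: "a \<in> carrier (power_series A)" "b \<in> carrier (power_series A)" "c \<in> carrier (power_series A)"
  show "(a \<otimes>\<^bsub>power_series A\<^esub> b) \<otimes>\<^bsub>power_series A\<^esub> c = a \<otimes>\<^bsub>power_series A\<^esub> (b \<otimes>\<^bsub>power_series A\<^esub> c)"
    using * by (simp add: convolution_assoc)
  show "(a \<oplus>\<^bsub>power_series A\<^esub> b) \<otimes>\<^bsub>power_series A\<^esub> c = a \<otimes>\<^bsub>power_series A\<^esub> c \<oplus>\<^bsub>power_series A\<^esub> b \<otimes>\<^bsub>power_series A\<^esub> c"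
    using * by (simp add: l_distr finsum_addf fun_eq_iff Pi_def)
  show "c \<otimes>\<^bsub>power_series A\<^esub> (a \<oplus>\<^bsub>power_series A\<^esub> b) = c \<otimes>\<^bsub>power_series A\<^esub> a \<oplus>\<^bsub>power_series A\<^esub> c \<otimes>\<^bsub>power_series A\<^esub> b"
    using * by (simp add: r_distr finsum_addf fun_eq_iff Pi_def)
next
  fix a assume *: "a \<in> carrier (power_series A)"
  show "\<exists>b\<in>carrier (power_series A). b \<oplus>\<^bsub>power_series A\<^esub> a = \<zero>\<^bsub>power_series A\<^esub>"
    by (rule bexI[of _ "\<lambda>k. \<ominus> a k"]) (use * in \<open>auto simp: l_neg\<close>)
  show "\<one>\<^bsub>power_series A\<^esub> \<otimes>\<^bsub>power_series A\<^esub> a = a"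
  proof
    fix k
    have "(\<Oplus>i\<in>{..k}. (if i = 0 then \<one> else \<zero>) \<otimes> a (k - i)) = (\<Oplus>i\<in>{..k}. if 0 = i then a (k - i) else \<zero>)"
      by (rule finsum_cong') (use * in auto)
    also have "\<dots> = a k" using * by (subst finsum_singleton) auto
    finally show "(\<one>\<^bsub>power_series A\<^esub> \<otimes>\<^bsub>power_series A\<^esub> a) k = a k" by simp
  qed
  show "a \<otimes>\<^bsub>power_series A\<^esub> \<one>\<^bsub>power_series A\<^esub> = a"
  proof
    fix k
    have "(\<Oplus>i\<in>{..k}. a i \<otimes> (if k - i = 0 then \<one> else \<zero>)) = (\<Oplus>i\<in>{..k}. if k = i then a i else \<zero>)"
      by (rule finsum_cong') (use * in auto)
    also have "\<dots> = a k" using * by (subst finsum_singleton) auto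
    finally show "(a \<otimes>\<^bsub>power_series A\<^esub> \<one>\<^bsub>power_series A\<^esub>) k = a k" by simp
  qed
qed

end

section \<open>Matrices over a superalgebra\<close>

lemma End_tensor_simps [simp]:
  "carrier (End_tensor m n A) = {X. \<forall>i j. if i \<in> idx m n \<and> j \<in> idx m n then X i j \<in> carrier A
                         else X i j = \<zero>\<^bsub>A\<^esub>}"
  "zero (End_tensor m n A) = (\<lambda>i j. \<zero>\<^bsub>A\<^esub>)"
  "one (End_tensor m n A) = (\<lambda>i j. if i \<in> idx m n \<and> i = j then \<one>\<^bsub>A\<^esub> else \<zero>\<^bsub>A\<^esub>)"
  "X \<oplus>\<^bsub>End_tensor m n A\<^esub> Y = (\<lambda>i j. X i j \<oplus>\<^bsub>A\<^esub> Y i j)"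
  "invol (End_tensor m n A) X = (\<lambda>i j. signed A (par m i + par m j) (invol A (X i j)))"
  by (simp_all add: End_tensor_def)

lemma (in superalg) End_tensor_mult [simp]:
  "X \<otimes>\<^bsub>End_tensor m n A\<^esub> Y = (\<lambda>i l. if i \<in> idx m n \<and> l \<in> idx m n
        then \<Oplus>j\<in>idx m n. tw (par m j + par m l) (X i j) \<otimes> Y j l
        else \<zero>)"
  unfolding End_tensor_def tw_def by simp

lemma finite_idx [simp]: "finite (idx m n)"
  by (simp add: idx_def)

context superalg begin

lemma End_carrierD:
  assumes "X \<in> carrier (End_tensor m n A)"
  shows "X i j \<in> carrier A" "i \<notin> idx m n \<Longrightarrow> X i j = \<zero>" "j \<notin> idx m n \<Longrightarrow> X i j = \<zero>"
  using assms by (auto split: if_splits) (metis zero_closed)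

lemma End_carrierI:
  assumes "\<And>i j. i \<in> idx m n \<Longrightarrow> j \<in> idx m n \<Longrightarrow> X i j \<in> carrier A"
    and "\<And>i j. \<not> (i \<in> idx m n \<and> j \<in> idx m n) \<Longrightarrow> X i j = \<zero>"
  shows "X \<in> carrier (End_tensor m n A)"
  using assms by auto

text \<open>Associativity rests on the composition of twists: the twist by \<open>p j + p k\<close>
  followed by that by \<open>p k + p l\<close> is the one by \<open>p j + p l\<close>, because
  \<open>p k\<close> occurs twice. Iterating the construction gives End \<otimes> End \<otimes> A
  with no separate verification of its signs.\<close>

lemma superalg_End_tensor: "superalg (End_tensor m n A)"
proof (rule superalgI)
  let ?E = "End_tensor m n A"
  fix a b c assume "a \<in> carrier ?E" "b \<in> carrier ?E" "c \<in> carrier ?E"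
  note D = End_carrierD[OF this(1)] End_carrierD[OF this(2)] End_carrierD[OF this(3)]
  show "(a \<otimes>\<^bsub>?E\<^esub> b) \<otimes>\<^bsub>?E\<^esub> c = a \<otimes>\<^bsub>?E\<^esub> (b \<otimes>\<^bsub>?E\<^esub> c)"
  proof (intro ext)
    fix i l
    show "((a \<otimes>\<^bsub>?E\<^esub> b) \<otimes>\<^bsub>?E\<^esub> c) i l = (a \<otimes>\<^bsub>?E\<^esub> (b \<otimes>\<^bsub>?E\<^esub> c)) i l"
    proof (cases "i \<in> idx m n \<and> l \<in> idx m n")
      case True
      let ?p = "par m"
      have "((a \<otimes>\<^bsub>?E\<^esub> b) \<otimes>\<^bsub>?E\<^esub> c) i l =
        (\<Oplus>k\<in>idx m n. tw (?p k + ?p l) (\<Oplus>j\<in>idx m n. tw (?p j + ?p k) (a i j) \<otimes> b j k) \<otimes> c k l)"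
        using True by (auto intro!: finsum_cong' simp: D)
      also have "\<dots> = (\<Oplus>k\<in>idx m n. \<Oplus>j\<in>idx m n. tw (?p j + ?p l) (a i j) \<otimes> (tw (?p k + ?p l) (b j k) \<otimes> c k l))"
      proof (intro finsum_cong' refl)
        fix k
        have "tw (?p k + ?p l) (\<Oplus>j\<in>idx m n. tw (?p j + ?p k) (a i j) \<otimes> b j k) \<otimes> c k l =
          (\<Oplus>j\<in>idx m n. tw (?p k + ?p l) (tw (?p j + ?p k) (a i j) \<otimes> b j k) \<otimes> c k l)"
          by (subst tw_finsum) (auto simp: D finsum_ldistr)
        also have "\<dots> = (\<Oplus>j\<in>idx m n. tw (?p j + ?p l) (a i j) \<otimes> (tw (?p k + ?p l) (b j k) \<otimes> c k l))"
          by (intro finsum_cong' refl)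
            (auto simp: D tw_mult tw_tw m_assoc intro!: arg_cong2[where f="(\<otimes>)"] tw_cong)
        finally show "tw (?p k + ?p l) (\<Oplus>j\<in>idx m n. tw (?p j + ?p k) (a i j) \<otimes> b j k) \<otimes> c k l =
          (\<Oplus>j\<in>idx m n. tw (?p j + ?p l) (a i j) \<otimes> (tw (?p k + ?p l) (b j k) \<otimes> c k l))" .
      qed (auto simp: D)
      also have "\<dots> = (\<Oplus>j\<in>idx m n. \<Oplus>k\<in>idx m n. tw (?p j + ?p l) (a i j) \<otimes> (tw (?p k + ?p l) (b j k) \<otimes> c k l))"
        by (rule finsum_swap) (auto simp: D)
      also have "\<dots> = (\<Oplus>j\<in>idx m n. tw (?p j + ?p l) (a i j) \<otimes> (\<Oplus>k\<in>idx m n. tw (?p k + ?p l) (b j k) \<otimes> c k l))"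
        by (intro finsum_cong' refl) (auto simp: D finsum_rdistr)
      also have "\<dots> = (a \<otimes>\<^bsub>?E\<^esub> (b \<otimes>\<^bsub>?E\<^esub> c)) i l"
        using True by (auto intro!: finsum_cong' simp: D)
      finally show ?thesis .
    qed auto
  qed
  show "(a \<oplus>\<^bsub>?E\<^esub> b) \<otimes>\<^bsub>?E\<^esub> c = a \<otimes>\<^bsub>?E\<^esub> c \<oplus>\<^bsub>?E\<^esub> b \<otimes>\<^bsub>?E\<^esub> c"
    by (simp add: D fun_eq_iff tw_add l_distr finsum_addf Pi_def)
  show "c \<otimes>\<^bsub>?E\<^esub> (a \<oplus>\<^bsub>?E\<^esub> b) = c \<otimes>\<^bsub>?E\<^esub> a \<oplus>\<^bsub>?E\<^esub> c \<otimes>\<^bsub>?E\<^esub> b"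
    by (simp add: D fun_eq_iff tw_add r_distr finsum_addf Pi_def)
  show "(a \<oplus>\<^bsub>?E\<^esub> b) \<oplus>\<^bsub>?E\<^esub> c = a \<oplus>\<^bsub>?E\<^esub> (b \<oplus>\<^bsub>?E\<^esub> c)"
    by (auto simp: D fun_eq_iff a_ac)
next
  let ?E = "End_tensor m n A"
  fix a b assume "a \<in> carrier ?E" "b \<in> carrier ?E"
  note D = End_carrierD[OF this(1)] End_carrierD[OF this(2)]
  show "a \<oplus>\<^bsub>?E\<^esub> b \<in> carrier ?E" "a \<otimes>\<^bsub>?E\<^esub> b \<in> carrier ?E"
    by (rule End_carrierI; force simp: D intro!: finsum_closed)+
  show "a \<oplus>\<^bsub>?E\<^esub> b = b \<oplus>\<^bsub>?E\<^esub> a"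
    by (auto simp: D fun_eq_iff a_ac)
  show "invol ?E (a \<oplus>\<^bsub>?E\<^esub> b) = invol ?E a \<oplus>\<^bsub>?E\<^esub> invol ?E b"
    by (auto simp: D fun_eq_iff invol_add signed_add)
  show "invol ?E (a \<otimes>\<^bsub>?E\<^esub> b) = invol ?E a \<otimes>\<^bsub>?E\<^esub> invol ?E b"
  proof (intro ext)
    fix i l
    let ?p = "par m"
    show "invol ?E (a \<otimes>\<^bsub>?E\<^esub> b) i l = (invol ?E a \<otimes>\<^bsub>?E\<^esub> invol ?E b) i l"
    proof (cases "i \<in> idx m n \<and> l \<in> idx m n")
      case True
      have "signed A (?p i + ?p l) (invol A (\<Oplus>j\<in>idx m n. tw (?p j + ?p l) (a i j) \<otimes> b j l))
        = (\<Oplus>j\<in>idx m n. signed A (?p i + ?p l) (invol A (tw (?p j + ?p l) (a i j) \<otimes> b j l)))"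
        by (subst invol_finsum) (auto simp: D signed_finsum)
      also have "\<dots> = (\<Oplus>j\<in>idx m n. tw (?p j + ?p l) (signed A (?p i + ?p j) (invol A (a i j))) \<otimes>
            signed A (?p j + ?p l) (invol A (b j l)))"
        by (intro finsum_cong' refl)
          (auto simp: D invol_mult invol_tw tw_signed signed_mult_left signed_mult_right signed_signed
                intro!: signed_cong)
      finally show ?thesis using True by simp
    qed auto
  qed
next
  let ?E = "End_tensor m n A"
  fix a assume "a \<in> carrier ?E"
  note D = End_carrierD[OF this]
  show "\<zero>\<^bsub>?E\<^esub> \<oplus>\<^bsub>?E\<^esub> a = a" by (simp add: D)
  show "\<exists>b\<in>carrier ?E. b \<oplus>\<^bsub>?E\<^esub> a = \<zero>\<^bsub>?E\<^esub>"
    by (rule bexI[of _ "\<lambda>i j. \<ominus> a i j"]) (auto simp: D l_neg)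
  show "invol ?E a \<in> carrier ?E" by (auto simp: D)
  show "invol ?E (invol ?E a) = a" by (auto simp: D fun_eq_iff signed_def invol_uminus)
  show "\<one>\<^bsub>?E\<^esub> \<otimes>\<^bsub>?E\<^esub> a = a"
  proof (intro ext)
    fix i l
    have "(\<Oplus>j\<in>idx m n. tw (par m j + par m l) (if i \<in> idx m n \<and> i = j then \<one> else \<zero>) \<otimes> a j l) =
          (\<Oplus>j\<in>idx m n. if i = j then a j l else \<zero>)"
      by (intro finsum_cong' refl) (auto simp: D)
    then show "(\<one>\<^bsub>?E\<^esub> \<otimes>\<^bsub>?E\<^esub> a) i l = a i l"
      by (auto simp: D finsum_singleton)
  qed
  show "a \<otimes>\<^bsub>?E\<^esub> \<one>\<^bsub>?E\<^esub> = a"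
  proof (intro ext)
    fix i l
    have "(\<Oplus>j\<in>idx m n. tw (par m j + par m l) (a i j) \<otimes> (if j \<in> idx m n \<and> j = l then \<one> else \<zero>)) =
          (\<Oplus>j\<in>idx m n. if l = j then a i j else \<zero>)"
      by (intro finsum_cong' refl) (auto simp: D tw_def)
    then show "(a \<otimes>\<^bsub>?E\<^esub> \<one>\<^bsub>?E\<^esub>) i l = a i l"
      by (auto simp: D finsum_singleton)
  qed
qed (auto)

declare End_tensor_mult [simp del]

end

section \<open>Ring maps and products in the twofold matrix superalgebra\<close>

text \<open>The target is an ungraded ring type. Images of matrix identities are identities with
  explicit powers of -1; the involution has no counterpart there and has to be eliminated from the
  image.\<close>

definition ring_map :: "('a, 'b) ring_scheme \<Rightarrow> ('a \<Rightarrow> 'r::ring_1) \<Rightarrow> bool" where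
  "ring_map A \<phi> \<longleftrightarrow> \<phi> \<one>\<^bsub>A\<^esub> = 1 \<and> (\<forall>x\<in>carrier A. \<forall>y\<in>carrier A.
     \<phi> (x \<oplus>\<^bsub>A\<^esub> y) = \<phi> x + \<phi> y \<and> \<phi> (x \<otimes>\<^bsub>A\<^esub> y) = \<phi> x * \<phi> y)"

lemma ring_mapI:
  assumes "\<phi> \<one>\<^bsub>A\<^esub> = 1"
    and "\<And>x y. x \<in> carrier A \<Longrightarrow> y \<in> carrier A \<Longrightarrow> \<phi> (x \<oplus>\<^bsub>A\<^esub> y) = \<phi> x + \<phi> y"
    and "\<And>x y. x \<in> carrier A \<Longrightarrow> y \<in> carrier A \<Longrightarrow> \<phi> (x \<otimes>\<^bsub>A\<^esub> y) = \<phi> x * \<phi> y"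
  shows "ring_map A \<phi>"
  using assms by (simp add: ring_map_def)

lemma sum_sum_single:
  fixes f :: "'i \<Rightarrow> 'i \<Rightarrow> 'r::comm_monoid_add"
  assumes "finite S" "a \<in> S" "b \<in> S" "\<And>j l. j \<in> S \<Longrightarrow> l \<in> S \<Longrightarrow> j \<noteq> a \<or> l \<noteq> b \<Longrightarrow> f j l = 0"
  shows "(\<Sum>j\<in>S. \<Sum>l\<in>S. f j l) = f a b"
proof -
  have "(\<Sum>j\<in>S. \<Sum>l\<in>S. f j l) = (\<Sum>j\<in>S. if j = a then f a b else 0)"
  proof (rule sum.cong[OF refl])
    fix j assume j: "j \<in> S"
    have "(\<Sum>l\<in>S. f j l) = (\<Sum>l\<in>S. if l = b then (if j = a then f a b else 0) else 0)"
      using j assms(4) by (intro sum.cong) auto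
    then show "(\<Sum>l\<in>S. f j l) = (if j = a then f a b else 0)"
      using assms by simp
  qed
  also have "\<dots> = f a b" using assms by simp
  finally show ?thesis .
qed

context superalg begin

lemma ring_map_zero: "ring_map A \<phi> \<Longrightarrow> \<phi> \<zero> = (0::'r::ring_1)"
proof -
  assume "ring_map A \<phi>"
  then have "\<phi> (\<zero> \<oplus> \<zero>) = \<phi> \<zero> + \<phi> \<zero>" unfolding ring_map_def by blast
  then show ?thesis by simp
qed

lemma ring_map_uminus: "ring_map A \<phi> \<Longrightarrow> a \<in> carrier A \<Longrightarrow> \<phi> (\<ominus> a) = - (\<phi> a :: 'r::ring_1)"
proof -
  assume \<phi>: "ring_map A \<phi>" and a: "a \<in> carrier A"
  then have "\<phi> (\<ominus> a \<oplus> a) = \<phi> (\<ominus> a) + \<phi> a" unfolding ring_map_def by blast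
  with a ring_map_zero[OF \<phi>] show ?thesis by (simp add: l_neg eq_neg_iff_add_eq_0)
qed

lemma ring_map_minus:
  "ring_map A \<phi> \<Longrightarrow> a \<in> carrier A \<Longrightarrow> b \<in> carrier A \<Longrightarrow> \<phi> (a \<ominus> b) = \<phi> a - (\<phi> b :: 'r::ring_1)"
  using ring_map_uminus[of \<phi> b] unfolding ring_map_def by (simp add: minus_eq)

lemma ring_map_signed:
  "ring_map A \<phi> \<Longrightarrow> a \<in> carrier A \<Longrightarrow> \<phi> (signed A k a) = (-1) ^ k * (\<phi> a :: 'r::ring_1)"
  by (simp add: signed_def ring_map_uminus)

lemma ring_map_finsum:
  assumes "ring_map A \<phi>" "finite S" "\<And>i. i \<in> S \<Longrightarrow> f i \<in> carrier A"
  shows "\<phi> (\<Oplus>i\<in>S. f i) = (\<Sum>i\<in>S. (\<phi> (f i) :: 'r::ring_1))"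
  by (rule finsum_hom_type) 
    (use assms ring_map_zero[OF assms(1)] abelian_monoid_axioms in \<open>auto simp: ring_map_def\<close>)

lemma ring_map_power_series:
  fixes \<phi> :: "'a \<Rightarrow> 'r::ring_1"
  assumes "ring_map A \<phi>"
  shows "ring_map (power_series A) (\<lambda>f. Abs_fps (\<lambda>k. \<phi> (f k)))"
proof (rule ring_mapI)
  note z = ring_map_zero[OF assms]
  show "Abs_fps (\<lambda>k. \<phi> (\<one>\<^bsub>power_series A\<^esub> k)) = 1"
    using assms by (auto simp: fps_eq_iff ring_map_def z)
  fix f g assume "f \<in> carrier (power_series A)" "g \<in> carrier (power_series A)"
  then have c: "f k \<in> carrier A" "g k \<in> carrier A" for k by auto
  show "Abs_fps (\<lambda>k. \<phi> ((f \<oplus>\<^bsub>power_series A\<^esub> g) k)) = Abs_fps (\<lambda>k. \<phi> (f k)) + Abs_fps (\<lambda>k. \<phi> (g k))"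
    using assms c by (auto simp: fps_eq_iff ring_map_def)
  show "Abs_fps (\<lambda>k. \<phi> ((f \<otimes>\<^bsub>power_series A\<^esub> g) k)) = Abs_fps (\<lambda>k. \<phi> (f k)) * Abs_fps (\<lambda>k. \<phi> (g k))"
  proof (rule fps_ext)
    fix k
    have "\<phi> (\<Oplus>i\<in>{..k}. f i \<otimes> g (k - i)) = (\<Sum>i\<in>{..k}. \<phi> (f i \<otimes> g (k - i)))"
      by (rule ring_map_finsum[OF assms]) (auto simp: c)
    also have "\<dots> = (\<Sum>i\<le>k. \<phi> (f i) * \<phi> (g (k - i)))"
      using assms c by (auto simp: ring_map_def)
    finally show "Abs_fps (\<lambda>k. \<phi> ((f \<otimes>\<^bsub>power_series A\<^esub> g) k)) $ k =
        (Abs_fps (\<lambda>k. \<phi> (f k)) * Abs_fps (\<lambda>k. \<phi> (g k))) $ k"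
      by (simp add: fps_mult_nth atLeast0AtMost)
  qed
qed

lemma power_series_uminus:
  assumes "f \<in> carrier (power_series A)"
  shows "\<ominus>\<^bsub>power_series A\<^esub> f = (\<lambda>k. \<ominus> f k)"
proof -
  interpret B: superalg "power_series A" by (rule superalg_power_series)
  show ?thesis using assms by (intro B.minus_equality) (auto simp: l_neg)
qed

lemma power_series_minus:
  assumes "f \<in> carrier (power_series A)" "g \<in> carrier (power_series A)"
  shows "f \<ominus>\<^bsub>power_series A\<^esub> g = (\<lambda>k. f k \<ominus> g k)"
  using assms by (simp add: a_minus_def power_series_uminus)

lemma End_tensor_uminus:
  assumes "X \<in> carrier (End_tensor m n A)"
  shows "\<ominus>\<^bsub>End_tensor m n A\<^esub> X = (\<lambda>i j. \<ominus> X i j)"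
proof -
  interpret B: superalg "End_tensor m n A" by (rule superalg_End_tensor)
  note D = End_carrierD[OF assms]
  show ?thesis using assms by (intro B.minus_equality) (auto simp: l_neg D)
qed

lemma End_tensor_minus:
  assumes "X \<in> carrier (End_tensor m n A)" "Y \<in> carrier (End_tensor m n A)"
  shows "X \<ominus>\<^bsub>End_tensor m n A\<^esub> Y = (\<lambda>i j. X i j \<ominus> Y i j)"
  by (simp only: a_minus_def End_tensor_uminus[OF assms(2)] End_tensor_simps)

lemma End2_carrierD:
  assumes "X \<in> carrier (End2_tensor m n A)"
  shows "X i j k l \<in> carrier A"
    "\<not> (i \<in> idx m n \<and> j \<in> idx m n \<and> k \<in> idx m n \<and> l \<in> idx m n) \<Longrightarrow> X i j k l = \<zero>"
proof -
  interpret B: superalg "End_tensor m n A" by (rule superalg_End_tensor)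
  note D = B.End_carrierD[OF assms]
  show "X i j k l \<in> carrier A" using End_carrierD(1)[OF D(1)] .
  assume "\<not> (i \<in> idx m n \<and> j \<in> idx m n \<and> k \<in> idx m n \<and> l \<in> idx m n)"
  then consider "i \<notin> idx m n" | "j \<notin> idx m n" | "k \<notin> idx m n" | "l \<notin> idx m n" by blast
  then show "X i j k l = \<zero>"
    by cases (use D(2)[of i j] D(3)[of j i] End_carrierD(2,3)[OF D(1)] in auto)
qed

lemma End2_carrierI:
  assumes "\<And>i j k l. i \<in> idx m n \<Longrightarrow> j \<in> idx m n \<Longrightarrow> k \<in> idx m n \<Longrightarrow> l \<in> idx m n \<Longrightarrow> X i j k l \<in> carrier A"
    and "\<And>i j k l. \<not> (i \<in> idx m n \<and> j \<in> idx m n \<and> k \<in> idx m n \<and> l \<in> idx m n) \<Longrightarrow> X i j k l = \<zero>"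
  shows "X \<in> carrier (End2_tensor m n A)"
proof -
  interpret B: superalg "End_tensor m n A" by (rule superalg_End_tensor)
  show ?thesis
    by (rule B.End_carrierI, rule End_carrierI) (use assms in \<open>auto simp: fun_eq_iff\<close>)
qed

text \<open>The outer product twists by \<open>invol\<close> of the inner matrix superalgebra, which
  has two effects: the twist of the coefficient in \<open>A\<close>, and the sign of moving
  \<open>e j j'\<close> past \<open>e k l\<close>. The inner product adds its own twist by
  \<open>p l + p l'\<close>.\<close>

lemma End2_mult:
  fixes m n :: nat
  assumes X: "X \<in> carrier (End2_tensor m n A)" and Y: "Y \<in> carrier (End2_tensor m n A)"
    and ind: "i \<in> idx m n" "j' \<in> idx m n" "k \<in> idx m n" "l' \<in> idx m n"
  defines "p \<equiv> par m"
  shows "(X \<otimes>\<^bsub>End2_tensor m n A\<^esub> Y) i j' k l' = (\<Oplus>j\<in>idx m n. \<Oplus>l\<in>idx m n.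
     signed A ((p k + p l) * (p j + p j')) (tw (p j + p j' + p l + p l') (X i j k l)) \<otimes> Y j j' l l')"
proof -
  let ?E = "End_tensor m n A"
  interpret B: superalg ?E by (rule superalg_End_tensor)
  note DX = B.End_carrierD(1)[OF X] and DY = B.End_carrierD(1)[OF Y]
  note D = End_carrierD(1)[OF DX] End_carrierD(1)[OF DY]
  have Btw: "B.tw c Z u v = signed A ((p u + p v) * c) (tw c (Z u v))" if "Z \<in> carrier ?E" for c Z u v
    using End_carrierD(1)[OF that] unfolding B.tw_def tw_def p_def by (auto simp: signed_def)
  have c: "B.tw (p j + p j') (X i j) \<otimes>\<^bsub>?E\<^esub> Y j j' \<in> carrier ?E" for j
    using DX DY B.tw_closed B.m_closed by blast
  have "(X \<otimes>\<^bsub>End2_tensor m n A\<^esub> Y) i j' k l' =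
      (\<Oplus>\<^bsub>?E\<^esub>j\<in>idx m n. B.tw (p j + p j') (X i j) \<otimes>\<^bsub>?E\<^esub> Y j j') k l'"
    using ind unfolding B.End_tensor_mult p_def by simp
  also have "\<dots> = (\<Oplus>j\<in>idx m n. (B.tw (p j + p j') (X i j) \<otimes>\<^bsub>?E\<^esub> Y j j') k l')"
    by (rule finsum_hom[where h = "\<lambda>Z. Z k l'"])
      (use c abelian_monoid_axioms B.abelian_monoid_axioms End_carrierD(1) in
        \<open>auto simp del: End_tensor_simps(1)\<close>)
  also have "\<dots> = (\<Oplus>j\<in>idx m n. \<Oplus>l\<in>idx m n.
     signed A ((p k + p l) * (p j + p j')) (tw (p j + p j' + p l + p l') (X i j k l)) \<otimes> Y j j' l l')"
  proof (intro finsum_cong' refl)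
    fix j assume "j \<in> idx m n"
    have "tw (p l + p l') (signed A ((p k + p l) * (p j + p j')) (tw (p j + p j') (X i j k l))) =
        signed A ((p k + p l) * (p j + p j')) (tw (p j + p j' + p l + p l') (X i j k l))" for l
      by (auto simp: tw_signed tw_tw D intro!: arg_cong2[where f="signed A"] tw_cong)
    moreover have "B.tw (p j + p j') (X i j) k l = signed A ((p k + p l) * (p j + p j')) (tw (p j + p j') (X i j k l))" for l
      by (rule Btw[OF DX])
    ultimately show "(B.tw (p j + p j') (X i j) \<otimes>\<^bsub>?E\<^esub> Y j j') k l' = (\<Oplus>l\<in>idx m n.
     signed A ((p k + p l) * (p j + p j')) (tw (p j + p j' + p l + p l') (X i j k l)) \<otimes> Y j j' l l')"
      using ind by (simp add: End_tensor_mult flip: p_def)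
  qed (auto simp: D)
  finally show ?thesis .
qed

lemma End2_mult_map:
  fixes m n :: nat and \<phi> :: "'a \<Rightarrow> 'r::ring_1"
  assumes \<phi>: "ring_map A \<phi>"
    and X: "X \<in> carrier (End2_tensor m n A)" and Y: "Y \<in> carrier (End2_tensor m n A)"
    and ind: "i \<in> idx m n" "j' \<in> idx m n" "k \<in> idx m n" "l' \<in> idx m n"
  defines "p \<equiv> par m"
  shows "\<phi> ((X \<otimes>\<^bsub>End2_tensor m n A\<^esub> Y) i j' k l') = (\<Sum>j\<in>idx m n. \<Sum>l\<in>idx m n.
     (-1) ^ ((p k + p l) * (p j + p j')) * \<phi> (tw (p j + p j' + p l + p l') (X i j k l)) * \<phi> (Y j j' l l'))"
proof -
  note D = End2_carrierD(1)[OF X] End2_carrierD(1)[OF Y]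
  have m: "\<phi> (a \<otimes> b) = \<phi> a * \<phi> b" if "a \<in> carrier A" "b \<in> carrier A" for a b
    using that \<phi> unfolding ring_map_def by blast
  show ?thesis
    unfolding End2_mult[OF X Y ind] p_def
    by (subst ring_map_finsum[OF \<phi>] , simp, force simp: D intro!: finsum_closed,
        intro sum.cong refl, subst ring_map_finsum[OF \<phi>])
       (auto simp: D m ring_map_signed[OF \<phi>] intro!: sum.cong)
qed

lemma copy1_apply: "copy1 m n A X i j k l = (if k \<in> idx m n \<and> k = l then X i j else \<zero>)"
  by (simp add: copy1_def one_tensor_def)

lemma copy2_apply: "copy2 m n A X i j k l = (if i \<in> idx m n \<and> i = j then X k l else \<zero>)"
  by (auto simp: copy2_def one_tensor_def)

lemma copy1_closed:
  assumes "X \<in> carrier (End_tensor m n A)"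
  shows "copy1 m n A X \<in> carrier (End2_tensor m n A)"
  by (rule End2_carrierI) (use End_carrierD[OF assms] in \<open>auto simp: copy1_apply\<close>)

lemma copy2_closed:
  assumes "X \<in> carrier (End_tensor m n A)"
  shows "copy2 m n A X \<in> carrier (End2_tensor m n A)"
  by (rule End2_carrierI) (use End_carrierD[OF assms] in \<open>auto simp: copy2_apply\<close>)

definition scalar2 :: "nat \<Rightarrow> nat \<Rightarrow> 'a \<Rightarrow> nat \<Rightarrow> nat \<Rightarrow> nat \<Rightarrow> nat \<Rightarrow> 'a" where
  "scalar2 m n w = one_tensor m n (End_tensor m n A) (one_tensor m n A w)"

lemma scalar2_apply:
  "scalar2 m n w i j k l = (if i \<in> idx m n \<and> i = j \<and> k \<in> idx m n \<and> k = l then w else \<zero>)"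
  by (auto simp: scalar2_def one_tensor_def)

lemma scalar2_closed: "w \<in> carrier A \<Longrightarrow> scalar2 m n w \<in> carrier (End2_tensor m n A)"
  by (rule End2_carrierI) (auto simp: scalar2_apply)

lemma perm_elt_closed: "perm_elt m n A \<in> carrier (End2_tensor m n A)"
  by (rule End2_carrierI) (auto simp: perm_elt_def)

section \<open>Entries of products of the standard elements\<close>

context
  fixes \<phi> :: "'a \<Rightarrow> 'r::ring_1" and m n :: nat
  assumes \<phi>: "ring_map A \<phi>"
begin

lemma map_zero: "\<phi> \<zero> = 0"
  by (rule ring_map_zero[OF \<phi>])

lemma map_one: "\<phi> \<one> = 1"
  using \<phi> by (simp add: ring_map_def)

lemma map_copy1_copy2:
  assumes X: "X \<in> carrier (End_tensor m n A)" and Y: "Y \<in> carrier (End_tensor m n A)"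
    and ind: "i \<in> idx m n" "j \<in> idx m n" "k \<in> idx m n" "l \<in> idx m n"
  shows "\<phi> ((copy1 m n A X \<otimes>\<^bsub>End2_tensor m n A\<^esub> copy2 m n A Y) i j k l) = \<phi> (tw (par m k + par m l) (X i j)) * \<phi> (Y k l)"
  unfolding End2_mult_map[OF \<phi> copy1_closed[OF X] copy2_closed[OF Y] ind]
  by (subst sum_sum_single[of _ j k])
    (use ind in \<open>auto simp: copy1_apply copy2_apply map_zero tw_def\<close>)

lemma map_copy2_copy1:
  assumes X: "X \<in> carrier (End_tensor m n A)" and Y: "Y \<in> carrier (End_tensor m n A)"
    and ind: "i \<in> idx m n" "j \<in> idx m n" "k \<in> idx m n" "l \<in> idx m n"
  shows "\<phi> ((copy2 m n A X \<otimes>\<^bsub>End2_tensor m n A\<^esub> copy1 m n A Y) i j k l) =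
    (-1) ^ ((par m k + par m l) * (par m i + par m j)) * \<phi> (tw (par m i + par m j) (X k l)) * \<phi> (Y i j)"
  unfolding End2_mult_map[OF \<phi> copy2_closed[OF X] copy1_closed[OF Y] ind]
  by (subst sum_sum_single[of _ i l])
    (use ind in \<open>auto simp: copy1_apply copy2_apply map_zero tw_def\<close>)

lemma map_perm_left:
  assumes X: "X \<in> carrier (End2_tensor m n A)"
    and ind: "i \<in> idx m n" "j \<in> idx m n" "k \<in> idx m n" "l \<in> idx m n"
  shows "\<phi> ((perm_elt m n A \<otimes>\<^bsub>End2_tensor m n A\<^esub> X) i j k l) = (-1) ^ ((par m k + par m i) * (par m k + par m j) + par m k) * \<phi> (X k j i l)"
  unfolding End2_mult_map[OF \<phi> perm_elt_closed X ind]
  by (subst sum_sum_single[of _ k i])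
    (use ind End2_carrierD(1)[OF X] in \<open>auto simp: perm_elt_def map_zero map_one tw_signed ring_map_signed[OF \<phi>] power_add\<close>)

lemma map_perm_right:
  assumes X: "X \<in> carrier (End2_tensor m n A)"
    and ind: "i \<in> idx m n" "j \<in> idx m n" "k \<in> idx m n" "l \<in> idx m n"
  shows "\<phi> ((X \<otimes>\<^bsub>End2_tensor m n A\<^esub> perm_elt m n A) i j k l) = (-1) ^ ((par m k + par m j) * (par m l + par m j) + par m j) * \<phi> (X i l k j)"
  unfolding End2_mult_map[OF \<phi> X perm_elt_closed ind]
  by (subst sum_sum_single[of _ l j])
    (use ind End2_carrierD(1)[OF X] in \<open>auto simp: perm_elt_def map_zero map_one ring_map_signed[OF \<phi>] power_add tw_def
       minus_one_power_iff\<close>)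

lemma map_scalar2_left:
  assumes X: "X \<in> carrier (End2_tensor m n A)" and w: "w \<in> carrier A" "invol A w = w"
    and ind: "i \<in> idx m n" "j \<in> idx m n" "k \<in> idx m n" "l \<in> idx m n"
  shows "\<phi> ((scalar2 m n w \<otimes>\<^bsub>End2_tensor m n A\<^esub> X) i j k l) = \<phi> w * \<phi> (X i j k l)"
  unfolding End2_mult_map[OF \<phi> scalar2_closed[OF w(1)] X ind]
  by (subst sum_sum_single[of _ i k])
    (use ind End2_carrierD(1)[OF X] w in \<open>auto simp: scalar2_apply map_zero tw_def\<close>)

lemma map_scalar2_right:
  assumes X: "X \<in> carrier (End2_tensor m n A)" and w: "w \<in> carrier A"
    and ind: "i \<in> idx m n" "j \<in> idx m n" "k \<in> idx m n" "l \<in> idx m n"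
  shows "\<phi> ((X \<otimes>\<^bsub>End2_tensor m n A\<^esub> scalar2 m n w) i j k l) = \<phi> (X i j k l) * \<phi> w"
  unfolding End2_mult_map[OF \<phi> X scalar2_closed[OF w(1)] ind]
  by (subst sum_sum_single[of _ j l])
    (use ind End2_carrierD(1)[OF X] w in \<open>auto simp: scalar2_apply map_zero tw_def\<close>)

end

end

section \<open>Even matrices and the entries of the defining equations\<close>

context superalg begin

text \<open>The entry at \<open>i j\<close> has the parity of the matrix unit there, so the matrix
  as a whole is an even element of End \<otimes> A.\<close>

definition homogeneous :: "nat \<Rightarrow> nat \<Rightarrow> (nat \<Rightarrow> nat \<Rightarrow> 'a) \<Rightarrow> bool" where
  "homogeneous m n X \<longleftrightarrow> X \<in> carrier (End_tensor m n A) \<and> (\<forall>i\<in>idx m n. \<forall>j\<in>idx m n.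
      invol A (X i j) = signed A (par m i + par m j) (X i j))"

lemma End2_minus:
  assumes "X \<in> carrier (End2_tensor m n A)" "Y \<in> carrier (End2_tensor m n A)"
  shows "X \<ominus>\<^bsub>End2_tensor m n A\<^esub> Y = (\<lambda>i j k l. X i j k l \<ominus> Y i j k l)"
proof -
  interpret E: superalg "End_tensor m n A" by (rule superalg_End_tensor)
  show ?thesis
    unfolding E.End_tensor_minus[OF assms]
    using End_tensor_minus[OF E.End_carrierD(1)[OF assms(1)] E.End_carrierD(1)[OF assms(2)]]
    by (simp add: fun_eq_iff)
qed

text \<open>Here the involution disappears: on an even matrix the twist of an entry is a sign known
  from its indices, and such a sign makes sense in an ungraded target.\<close>

lemma map_tw_homogeneous:
  fixes \<phi> :: "'a \<Rightarrow> 'r::ring_1"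
  assumes "ring_map A \<phi>" "homogeneous m n X" "i \<in> idx m n" "j \<in> idx m n"
  shows "\<phi> (tw c (X i j)) = (-1) ^ (c * (par m i + par m j)) * \<phi> (X i j)"
proof -
  have "X \<in> carrier (End_tensor m n A)" using assms(2) unfolding homogeneous_def by blast
  note D = End_carrierD(1)[OF this]
  have "invol A (X i j) = signed A (par m i + par m j) (X i j)"
    using assms unfolding homogeneous_def by blast
  then show ?thesis
    by (auto simp: tw_def ring_map_signed[OF assms(1)] D minus_one_power_iff)
qed

text \<open>Multiplication by \<open>P\<close> only permutes indices, so an entry reduces to two
  products of entries of \<open>X\<close> and \<open>Y\<close>. The exponents are left as they
  arise; \<open>RTT_sign_change\<close> matches them with those of \<open>RTT\<close>.\<close>

lemma map_RTT_left:
  fixes \<phi> :: "'a \<Rightarrow> 'r::ring_1" and m n :: nat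
  defines "p \<equiv> par m" and "E \<equiv> End2_tensor m n A"
  assumes \<phi>: "ring_map A \<phi>" and hX: "homogeneous m n X" and hY: "homogeneous m n Y"
    and w: "w \<in> carrier A" "invol A w = w"
    and ind: "i \<in> idx m n" "j \<in> idx m n" "k \<in> idx m n" "l \<in> idx m n"
  shows "\<phi> (((scalar2 m n w \<ominus>\<^bsub>E\<^esub> perm_elt m n A) \<otimes>\<^bsub>E\<^esub> copy1 m n A X \<otimes>\<^bsub>E\<^esub> copy2 m n A Y) i j k l) =
    (-1) ^ ((p i + p j) * (p k + p l)) * (\<phi> w * \<phi> (X i j) * \<phi> (Y k l)) -
    (-1) ^ (p k + (p k + p j) * (p k + p l)) * (\<phi> (X k j) * \<phi> (Y i l))"
    (is "\<phi> ?L = _")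
proof -
  interpret E1: superalg "End_tensor m n A" by (rule superalg_End_tensor)
  interpret E2: superalg E unfolding E_def by (rule E1.superalg_End_tensor)
  let ?D = "scalar2 m n w" and ?P = "perm_elt m n A" and ?X = "copy1 m n A X" and ?Y = "copy2 m n A Y"
  have X: "X \<in> carrier (End_tensor m n A)" and Y: "Y \<in> carrier (End_tensor m n A)"
    using hX hY unfolding homogeneous_def by blast+
  have c: "?D \<in> carrier E" "?P \<in> carrier E" "?X \<in> carrier E" "?Y \<in> carrier E"
    using scalar2_closed[OF w(1)] perm_elt_closed copy1_closed[OF X] copy2_closed[OF Y]
    unfolding E_def by blast+
  let ?Z = "?X \<otimes>\<^bsub>E\<^esub> ?Y"
  have Z: "?Z \<in> carrier E" using c by blast
  have "(?D \<ominus>\<^bsub>E\<^esub> ?P) \<otimes>\<^bsub>E\<^esub> ?X \<otimes>\<^bsub>E\<^esub> ?Y = (?D \<ominus>\<^bsub>E\<^esub> ?P) \<otimes>\<^bsub>E\<^esub> ?Z"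
    by (rule E2.m_assoc) (use c in auto)
  also have "\<dots> = ?D \<otimes>\<^bsub>E\<^esub> ?Z \<ominus>\<^bsub>E\<^esub> ?P \<otimes>\<^bsub>E\<^esub> ?Z"
    using c Z by (simp add: E2.minus_eq E2.l_distr E2.l_minus)
  finally have e0: "(?D \<ominus>\<^bsub>E\<^esub> ?P) \<otimes>\<^bsub>E\<^esub> ?X \<otimes>\<^bsub>E\<^esub> ?Y = ?D \<otimes>\<^bsub>E\<^esub> ?Z \<ominus>\<^bsub>E\<^esub> ?P \<otimes>\<^bsub>E\<^esub> ?Z" .
  have e: "?L = (?D \<otimes>\<^bsub>E\<^esub> ?Z) i j k l \<ominus> (?P \<otimes>\<^bsub>E\<^esub> ?Z) i j k l"
    unfolding e0 using c Z End2_minus[of _ m n, folded E_def] by simp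
  have "\<phi> ?L = \<phi> ((?D \<otimes>\<^bsub>E\<^esub> ?Z) i j k l) - \<phi> ((?P \<otimes>\<^bsub>E\<^esub> ?Z) i j k l)"
    unfolding e by (intro ring_map_minus[OF \<phi>] End2_carrierD(1)[of _ m n, folded E_def] E2.m_closed c Z)
  also have "\<phi> ((?D \<otimes>\<^bsub>E\<^esub> ?Z) i j k l) = \<phi> w * \<phi> (?Z i j k l)"
    unfolding E_def by (rule map_scalar2_left[OF \<phi> Z[unfolded E_def] w ind])
  also have "\<phi> ((?P \<otimes>\<^bsub>E\<^esub> ?Z) i j k l) = (-1) ^ ((p k + p i) * (p k + p j) + p k) * \<phi> (?Z k j i l)"
    unfolding E_def p_def by (rule map_perm_left[OF \<phi> Z[unfolded E_def] ind])
  also have "\<phi> (?Z i j k l) = (-1) ^ ((p i + p j) * (p k + p l)) * (\<phi> (X i j) * \<phi> (Y k l))"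
    unfolding E_def p_def using ind
    by (simp add: map_copy1_copy2[OF \<phi> X Y] map_tw_homogeneous[OF \<phi> hX] mult.commute mult.assoc)
  also have "\<phi> (?Z k j i l) = (-1) ^ ((p i + p l) * (p k + p j)) * (\<phi> (X k j) * \<phi> (Y i l))"
    unfolding E_def p_def using ind
    by (simp add: map_copy1_copy2[OF \<phi> X Y] map_tw_homogeneous[OF \<phi> hX] mult.commute mult.assoc)
  finally show ?thesis
    by (auto simp: minus_one_power_iff mult.assoc)
qed

lemma map_RTT_right:
  fixes \<phi> :: "'a \<Rightarrow> 'r::ring_1" and m n :: nat
  defines "p \<equiv> par m" and "E \<equiv> End2_tensor m n A"
  assumes \<phi>: "ring_map A \<phi>" and hX: "homogeneous m n X" and hY: "homogeneous m n Y"
    and w: "w \<in> carrier A" "invol A w = w"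
    and ind: "i \<in> idx m n" "j \<in> idx m n" "k \<in> idx m n" "l \<in> idx m n"
  shows "\<phi> ((copy2 m n A Y \<otimes>\<^bsub>E\<^esub> copy1 m n A X \<otimes>\<^bsub>E\<^esub> (scalar2 m n w \<ominus>\<^bsub>E\<^esub> perm_elt m n A)) i j k l) =
    \<phi> (Y k l) * \<phi> (X i j) * \<phi> w -
    (-1) ^ (p k + (p k + p j) * (p k + p l)) * (\<phi> (Y k j) * \<phi> (X i l))"
    (is "\<phi> ?L = _")
proof -
  interpret E1: superalg "End_tensor m n A" by (rule superalg_End_tensor)
  interpret E2: superalg E unfolding E_def by (rule E1.superalg_End_tensor)
  let ?D = "scalar2 m n w" and ?P = "perm_elt m n A" and ?X = "copy1 m n A X" and ?Y = "copy2 m n A Y"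
  have X: "X \<in> carrier (End_tensor m n A)" and Y: "Y \<in> carrier (End_tensor m n A)"
    using hX hY unfolding homogeneous_def by blast+
  have c: "?D \<in> carrier E" "?P \<in> carrier E" "?X \<in> carrier E" "?Y \<in> carrier E"
    using scalar2_closed[OF w(1)] perm_elt_closed copy1_closed[OF X] copy2_closed[OF Y]
    unfolding E_def by blast+
  let ?Z = "?Y \<otimes>\<^bsub>E\<^esub> ?X"
  have Z: "?Z \<in> carrier E" using c by blast
  have e0: "?Z \<otimes>\<^bsub>E\<^esub> (?D \<ominus>\<^bsub>E\<^esub> ?P) = ?Z \<otimes>\<^bsub>E\<^esub> ?D \<ominus>\<^bsub>E\<^esub> ?Z \<otimes>\<^bsub>E\<^esub> ?P"
    using c Z by (simp add: E2.minus_eq E2.r_distr E2.r_minus)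
  have e: "?L = (?Z \<otimes>\<^bsub>E\<^esub> ?D) i j k l \<ominus> (?Z \<otimes>\<^bsub>E\<^esub> ?P) i j k l"
    unfolding e0 using c Z End2_minus[of _ m n, folded E_def] by simp
  have "\<phi> ?L = \<phi> ((?Z \<otimes>\<^bsub>E\<^esub> ?D) i j k l) - \<phi> ((?Z \<otimes>\<^bsub>E\<^esub> ?P) i j k l)"
    unfolding e by (intro ring_map_minus[OF \<phi>] End2_carrierD(1)[of _ m n, folded E_def] E2.m_closed c Z)
  also have "\<phi> ((?Z \<otimes>\<^bsub>E\<^esub> ?D) i j k l) = \<phi> (?Z i j k l) * \<phi> w"
    unfolding E_def by (rule map_scalar2_right[OF \<phi> Z[unfolded E_def] w(1) ind])
  also have "\<phi> ((?Z \<otimes>\<^bsub>E\<^esub> ?P) i j k l) = (-1) ^ ((p k + p j) * (p l + p j) + p j) * \<phi> (?Z i l k j)"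
    unfolding E_def p_def by (rule map_perm_right[OF \<phi> Z[unfolded E_def] ind])
  also have "\<phi> (?Z i j k l) = \<phi> (Y k l) * \<phi> (X i j)"
    unfolding E_def p_def using ind
    by (auto simp: map_copy2_copy1[OF \<phi> Y X] map_tw_homogeneous[OF \<phi> hY] minus_one_power_iff)
  also have "\<phi> (?Z i l k j) = \<phi> (Y k j) * \<phi> (X i l)"
    unfolding E_def p_def using ind
    by (auto simp: map_copy2_copy1[OF \<phi> Y X] map_tw_homogeneous[OF \<phi> hY] minus_one_power_iff)
  finally show ?thesis
    by (auto simp: minus_one_power_iff)
qed

lemma invol_End2:
  fixes m n :: nat
  defines "p \<equiv> par m"
  assumes "Z \<in> carrier (End2_tensor m n A)" "invol (End2_tensor m n A) Z = Z"
  shows "invol A (Z i j k l) = signed A (p i + p j + (p k + p l)) (Z i j k l)"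
proof -
  interpret E1: superalg "End_tensor m n A" by (rule superalg_End_tensor)
  note D = E1.End_carrierD(1)[OF assms(2)]
  note DD = End_carrierD(1)[OF D]
  have s: "signed (End_tensor m n A) c W = (\<lambda>i j. signed A c (W i j))"
    if "W \<in> carrier (End_tensor m n A)" for c W
    unfolding signed_def using End_tensor_uminus[OF that] by auto
  have "invol (End2_tensor m n A) Z i j k l =
      signed (End_tensor m n A) (p i + p j) (invol (End_tensor m n A) (Z i j)) k l"
    by (simp add: p_def)
  also have "\<dots> = signed A (p i + p j) (signed A (p k + p l) (invol A (Z i j k l)))"
    using s[OF E1.invol_closed[OF D]] by (simp add: p_def)
  also have "\<dots> = signed A (p i + p j + (p k + p l)) (invol A (Z i j k l))"
    by (simp add: signed_signed DD)
  finally have "Z i j k l = signed A (p i + p j + (p k + p l)) (invol A (Z i j k l))"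
    by (simp only: assms(3))
  then have "signed A (p i + p j + (p k + p l)) (Z i j k l) =
     signed A (p i + p j + (p k + p l)) (signed A (p i + p j + (p k + p l)) (invol A (Z i j k l)))"
    by simp
  also have "\<dots> = invol A (Z i j k l)"
    by (simp add: signed_signed DD) (simp add: signed_def)
  finally show ?thesis by simp
qed

lemma signed_cancel: "a \<in> carrier A \<Longrightarrow> signed A k (signed A l (signed A (k + l) a)) = a"
  by (auto simp: signed_def)

lemma invol_End2I:
  fixes m n :: nat
  defines "p \<equiv> par m"
  assumes "Z \<in> carrier (End2_tensor m n A)"
    and "\<And>i j k l. invol A (Z i j k l) = signed A (p i + p j + (p k + p l)) (Z i j k l)"
  shows "invol (End2_tensor m n A) Z = Z"
proof (intro ext)
  fix i j k l
  interpret E1: superalg "End_tensor m n A" by (rule superalg_End_tensor)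
  note D = E1.End_carrierD(1)[OF assms(2)]
  note DD = End_carrierD(1)[OF D]
  have s: "signed (End_tensor m n A) c W = (\<lambda>i j. signed A c (W i j))"
    if "W \<in> carrier (End_tensor m n A)" for c W
    unfolding signed_def using End_tensor_uminus[OF that] by auto
  have "invol (End2_tensor m n A) Z i j k l =
      signed (End_tensor m n A) (p i + p j) (invol (End_tensor m n A) (Z i j)) k l"
    by (simp add: p_def)
  also have "\<dots> = signed A (p i + p j) (signed A (p k + p l) (invol A (Z i j k l)))"
    using s[OF E1.invol_closed[OF D]] by (simp add: p_def)
  also have "\<dots> = Z i j k l"
    unfolding assms(3) by (rule signed_cancel[OF DD])
  finally show "invol (End2_tensor m n A) Z i j k l = Z i j k l" .
qed

text \<open>Every factor is even, hence so are both sides. This gives the parity of each coefficient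
  of the defining relation, and with it the stability of the ideal of relations under the
  grading.\<close>

lemma invol_RTT:
  fixes m n :: nat
  defines "E \<equiv> End2_tensor m n A"
  assumes hX: "homogeneous m n X" and hY: "homogeneous m n Y"
    and w: "w \<in> carrier A" "invol A w = w"
  defines "R \<equiv> scalar2 m n w \<ominus>\<^bsub>E\<^esub> perm_elt m n A"
  shows "R \<otimes>\<^bsub>E\<^esub> copy1 m n A X \<otimes>\<^bsub>E\<^esub> copy2 m n A Y \<in> carrier E"
    "invol E (R \<otimes>\<^bsub>E\<^esub> copy1 m n A X \<otimes>\<^bsub>E\<^esub> copy2 m n A Y) = R \<otimes>\<^bsub>E\<^esub> copy1 m n A X \<otimes>\<^bsub>E\<^esub> copy2 m n A Y"
    "copy2 m n A Y \<otimes>\<^bsub>E\<^esub> copy1 m n A X \<otimes>\<^bsub>E\<^esub> R \<in> carrier E"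
    "invol E (copy2 m n A Y \<otimes>\<^bsub>E\<^esub> copy1 m n A X \<otimes>\<^bsub>E\<^esub> R) = copy2 m n A Y \<otimes>\<^bsub>E\<^esub> copy1 m n A X \<otimes>\<^bsub>E\<^esub> R"
proof -
  interpret E1: superalg "End_tensor m n A" by (rule superalg_End_tensor)
  interpret E2: superalg E unfolding E_def by (rule E1.superalg_End_tensor)
  let ?D = "scalar2 m n w" and ?P = "perm_elt m n A" and ?X = "copy1 m n A X" and ?Y = "copy2 m n A Y"
  have X: "X \<in> carrier (End_tensor m n A)" and Y: "Y \<in> carrier (End_tensor m n A)"
    using hX hY unfolding homogeneous_def by blast+
  have c: "?D \<in> carrier E" "?P \<in> carrier E" "?X \<in> carrier E" "?Y \<in> carrier E"
    using scalar2_closed[OF w(1)] perm_elt_closed copy1_closed[OF X] copy2_closed[OF Y]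
    unfolding E_def by blast+
  have h: "invol A (X i j) = signed A (par m i + par m j) (X i j)"
    "invol A (Y i j) = signed A (par m i + par m j) (Y i j)" for i j
    using hX hY End_carrierD(2,3)[OF X, of i j] End_carrierD(2,3)[OF Y, of i j]
    unfolding homogeneous_def by (cases "i \<in> idx m n \<and> j \<in> idx m n"; force)+
  have i: "invol E ?D = ?D" "invol E ?P = ?P" "invol E ?X = ?X" "invol E ?Y = ?Y"
    unfolding E_def
    by (rule invol_End2I; use c in \<open>auto simp: E_def scalar2_apply perm_elt_def copy1_apply copy2_apply
       w invol_signed h intro!: signed_cong\<close>; simp add: signed_def; fail)+
  have R: "R \<in> carrier E" "invol E R = R"
    using c i by (auto simp: R_def E2.invol_minus)
  show "R \<otimes>\<^bsub>E\<^esub> copy1 m n A X \<otimes>\<^bsub>E\<^esub> copy2 m n A Y \<in> carrier E"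
    "copy2 m n A Y \<otimes>\<^bsub>E\<^esub> copy1 m n A X \<otimes>\<^bsub>E\<^esub> R \<in> carrier E"
    using R c by blast+
  show "invol E (R \<otimes>\<^bsub>E\<^esub> copy1 m n A X \<otimes>\<^bsub>E\<^esub> copy2 m n A Y) = R \<otimes>\<^bsub>E\<^esub> copy1 m n A X \<otimes>\<^bsub>E\<^esub> copy2 m n A Y"
    "invol E (copy2 m n A Y \<otimes>\<^bsub>E\<^esub> copy1 m n A X \<otimes>\<^bsub>E\<^esub> R) = copy2 m n A Y \<otimes>\<^bsub>E\<^esub> copy1 m n A X \<otimes>\<^bsub>E\<^esub> R"
    using R c i E2.invol_mult E2.m_closed by metis+
qed

text \<open>The transposed permutation is a signed sum of \<open>e i j\<close> \<otimes>
  \<open>e i j\<close>, so multiplying by it contracts matrix indices. One diagonal entry of the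
  equation for z already determines the series, and the signs of the supertransposition cancel
  against the Koszul signs up to a common factor.\<close>

lemma map_z_left:
  fixes \<phi> :: "'a \<Rightarrow> 'r::ring_1" and m n :: nat
  defines "p \<equiv> par m" and "E \<equiv> End2_tensor m n A"
  defines "Q \<equiv> supertranspose2 m A (perm_elt m n A)"
  assumes \<phi>: "ring_map A \<phi>" and hX: "homogeneous m n X" and S: "S \<in> carrier (End_tensor m n A)"
    and i: "i \<in> idx m n"
  shows "\<phi> ((Q \<otimes>\<^bsub>E\<^esub> copy1 m n A X \<otimes>\<^bsub>E\<^esub> supertranspose2 m A (copy2 m n A S)) i i i i) =
    (-1) ^ p i * (\<Sum>j\<in>idx m n. \<phi> (X j i) * \<phi> (S i j))"
    and "w \<in> carrier A \<Longrightarrow> \<phi> ((Q \<otimes>\<^bsub>E\<^esub> scalar2 m n w) i i i i) = (-1) ^ p i * \<phi> w"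
proof -
  interpret E1: superalg "End_tensor m n A" by (rule superalg_End_tensor)
  interpret E2: superalg E unfolding E_def by (rule E1.superalg_End_tensor)
  have X: "X \<in> carrier (End_tensor m n A)"
    using hX unfolding homogeneous_def by blast+
  let ?X = "copy1 m n A X" and ?U = "supertranspose2 m A (copy2 m n A S)"
  note DS = End_carrierD(1)[OF S] and DX = End_carrierD(1)[OF X]
  \<comment> \<open>\<open>P\<close> contributes the exponent \<open>p j\<close> and the
    supertransposition \<open>p i * p j + p j\<close>; together these leave
    \<open>p i * p j\<close>.\<close>
  have Qa: "Q i j k l = (if i \<in> idx m n \<and> j \<in> idx m n \<and> l = j \<and> k = i then signed A (p i * p j) \<one> else \<zero>)" for i j k l
    unfolding Q_def supertranspose2_def supertranspose_def perm_elt_def p_def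
    by (auto simp: signed_signed intro!: signed_cong)
  have Ua: "?U i j k l = (if i \<in> idx m n \<and> i = j then signed A (p k * p l + p l) (S l k) else \<zero>)" for i j k l
    unfolding supertranspose2_def supertranspose_def p_def
    by (auto simp: copy2_apply mult.commute)
  have c: "Q \<in> carrier E" "?X \<in> carrier E" "?U \<in> carrier E"
    unfolding E_def
    subgoal by (rule End2_carrierI) (auto simp: Qa)
    subgoal by (rule copy1_closed[OF X])
    subgoal by (rule End2_carrierI) (use End_carrierD[OF S] in \<open>auto simp: Ua\<close>)
    done
  have QZ: "\<phi> ((Q \<otimes>\<^bsub>E\<^esub> Z) i i i i) =
      (\<Sum>j\<in>idx m n. (-1) ^ ((p i + p j) + p i * p j) * \<phi> (Z j i j i))" if Z: "Z \<in> carrier E" for Z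
  proof -
    have "\<phi> ((Q \<otimes>\<^bsub>E\<^esub> Z) i i i i) = (\<Sum>j\<in>idx m n. \<Sum>l\<in>idx m n. (-1) ^ ((p i + p l) * (p j + p i)) *
         \<phi> (tw (p j + p i + p l + p i) (Q i j i l)) * \<phi> (Z j i l i))"
      unfolding E_def p_def using c Z by (intro End2_mult_map[OF \<phi>]) (auto simp: E_def i)
    also have "\<dots> = (\<Sum>j\<in>idx m n. \<Sum>l\<in>idx m n. if l = j then (-1) ^ ((p i + p j) + p i * p j) * \<phi> (Z j i j i) else 0)"
      by (intro sum.cong refl)
        (auto simp: Qa i tw_signed ring_map_signed[OF \<phi>] ring_map_zero[OF \<phi>] map_one[OF \<phi>] minus_one_power_iff)
    finally show ?thesis by simp
  qed
  have XU: "\<phi> ((?X \<otimes>\<^bsub>E\<^esub> ?U) j i j i) = (-1) ^ ((p j + p i) + p j * p i + p i) * (\<phi> (X j i) * \<phi> (S i j))"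
    if j: "j \<in> idx m n" for j
  proof -
    have "\<phi> ((?X \<otimes>\<^bsub>E\<^esub> ?U) j i j i) = (\<Sum>a\<in>idx m n. \<Sum>b\<in>idx m n. (-1) ^ ((p j + p b) * (p a + p i)) *
         \<phi> (tw (p a + p i + p b + p i) (?X j a j b)) * \<phi> (?U a i b i))"
      unfolding E_def p_def using c j by (intro End2_mult_map[OF \<phi>]) (auto simp: E_def i)
    also have "\<dots> = (-1) ^ ((p j + p j) * (p i + p i)) *
         \<phi> (tw (p i + p i + p j + p i) (?X j i j j)) * \<phi> (?U i i j i)"
      by (rule sum_sum_single) (use i j in \<open>auto simp: copy1_apply Ua ring_map_zero[OF \<phi>]\<close>)
    also have "\<dots> = (-1) ^ ((p j + p i) + p j * p i + p i) * (\<phi> (X j i) * \<phi> (S i j))"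
      using i j by (auto simp: copy1_apply Ua ring_map_signed[OF \<phi>] map_tw_homogeneous[OF \<phi> hX] DS
        minus_one_power_iff p_def)
    finally show ?thesis .
  qed
  have "Q \<otimes>\<^bsub>E\<^esub> ?X \<otimes>\<^bsub>E\<^esub> ?U = Q \<otimes>\<^bsub>E\<^esub> (?X \<otimes>\<^bsub>E\<^esub> ?U)"
    using c by (rule E2.m_assoc)
  then show "\<phi> ((Q \<otimes>\<^bsub>E\<^esub> ?X \<otimes>\<^bsub>E\<^esub> ?U) i i i i) = (-1) ^ p i * (\<Sum>j\<in>idx m n. \<phi> (X j i) * \<phi> (S i j))"
    using QZ[OF E2.m_closed[OF c(2,3)]] XU
    by (auto simp: sum_distrib_left minus_one_power_iff intro!: sum.cong)
  show "\<phi> ((Q \<otimes>\<^bsub>E\<^esub> scalar2 m n w) i i i i) = (-1) ^ p i * \<phi> w" if w: "w \<in> carrier A"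
    unfolding E_def using c w i
    by (subst map_scalar2_right[OF \<phi>]) 
       (auto simp: E_def Qa ring_map_signed[OF \<phi>] map_one[OF \<phi>] minus_one_power_iff)
qed

end

section \<open>Quotients and completions\<close>

lemma superalg_image:
  fixes A :: "'a superalgebra" and B :: "'b superalgebra"
  assumes "superalg A" "\<pi> ` carrier A = carrier B"
    and "\<pi> \<zero>\<^bsub>A\<^esub> = \<zero>\<^bsub>B\<^esub>" "\<pi> \<one>\<^bsub>A\<^esub> = \<one>\<^bsub>B\<^esub>"
    and "\<And>x y. x \<in> carrier A \<Longrightarrow> y \<in> carrier A \<Longrightarrow> \<pi> (x \<oplus>\<^bsub>A\<^esub> y) = \<pi> x \<oplus>\<^bsub>B\<^esub> \<pi> y"
    and "\<And>x y. x \<in> carrier A \<Longrightarrow> y \<in> carrier A \<Longrightarrow> \<pi> (x \<otimes>\<^bsub>A\<^esub> y) = \<pi> x \<otimes>\<^bsub>B\<^esub> \<pi> y"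
    and "\<And>x. x \<in> carrier A \<Longrightarrow> \<pi> (invol A x) = invol B (\<pi> x)"
  shows "superalg B"
proof -
  interpret A: superalg A by fact
  have s: "\<exists>a\<in>carrier A. \<pi> a = b" if "b \<in> carrier B" for b
    using that unfolding assms(2)[symmetric] by blast
  have c: "\<pi> a \<in> carrier B" if "a \<in> carrier A" for a
    using that unfolding assms(2)[symmetric] by blast
  note ops = assms(3-7)[symmetric]
  show ?thesis
  proof (rule superalgI)
    fix a b c assume "a \<in> carrier B" "b \<in> carrier B" "c \<in> carrier B"
    then obtain x y z where [simp]: "x \<in> carrier A" "y \<in> carrier A" "z \<in> carrier A"
      and [simp]: "a = \<pi> x" "b = \<pi> y" "c = \<pi> z" using s by metis
    show "a \<oplus>\<^bsub>B\<^esub> b \<oplus>\<^bsub>B\<^esub> c = a \<oplus>\<^bsub>B\<^esub> (b \<oplus>\<^bsub>B\<^esub> c)" "a \<otimes>\<^bsub>B\<^esub> b \<otimes>\<^bsub>B\<^esub> c = a \<otimes>\<^bsub>B\<^esub> (b \<otimes>\<^bsub>B\<^esub> c)"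
      "(a \<oplus>\<^bsub>B\<^esub> b) \<otimes>\<^bsub>B\<^esub> c = a \<otimes>\<^bsub>B\<^esub> c \<oplus>\<^bsub>B\<^esub> b \<otimes>\<^bsub>B\<^esub> c"
      "c \<otimes>\<^bsub>B\<^esub> (a \<oplus>\<^bsub>B\<^esub> b) = c \<otimes>\<^bsub>B\<^esub> a \<oplus>\<^bsub>B\<^esub> c \<otimes>\<^bsub>B\<^esub> b"
      by (simp_all add: ops A.a_assoc A.m_assoc A.l_distr A.r_distr)
  next
    fix a b assume "a \<in> carrier B" "b \<in> carrier B"
    then obtain x y where [simp]: "x \<in> carrier A" "y \<in> carrier A"
      and [simp]: "a = \<pi> x" "b = \<pi> y" using s by metis
    show "a \<oplus>\<^bsub>B\<^esub> b \<in> carrier B" "a \<otimes>\<^bsub>B\<^esub> b \<in> carrier B" "a \<oplus>\<^bsub>B\<^esub> b = b \<oplus>\<^bsub>B\<^esub> a"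
      "invol B (a \<oplus>\<^bsub>B\<^esub> b) = invol B a \<oplus>\<^bsub>B\<^esub> invol B b"
      "invol B (a \<otimes>\<^bsub>B\<^esub> b) = invol B a \<otimes>\<^bsub>B\<^esub> invol B b"
      by (simp_all add: ops c A.a_comm A.invol_add A.invol_mult)
  next
    fix a assume "a \<in> carrier B"
    then obtain x where [simp]: "x \<in> carrier A" and [simp]: "a = \<pi> x" using s by metis
    show "\<zero>\<^bsub>B\<^esub> \<oplus>\<^bsub>B\<^esub> a = a" "\<one>\<^bsub>B\<^esub> \<otimes>\<^bsub>B\<^esub> a = a" "a \<otimes>\<^bsub>B\<^esub> \<one>\<^bsub>B\<^esub> = a" "invol B a \<in> carrier B" "invol B (invol B a) = a"
      by (simp_all add: ops c)
    show "\<exists>b\<in>carrier B. b \<oplus>\<^bsub>B\<^esub> a = \<zero>\<^bsub>B\<^esub>"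
      by (rule bexI[of _ "\<pi> (\<ominus>\<^bsub>A\<^esub> x)"]) (simp_all add: ops c A.l_neg)
  qed (simp_all add: ops c)
qed

lemma super_quot_simps:
  "carrier (super_quot A I) = carrier (A Quot I)"
  "x \<otimes>\<^bsub>super_quot A I\<^esub> y = x \<otimes>\<^bsub>A Quot I\<^esub> y"
  "\<one>\<^bsub>super_quot A I\<^esub> = \<one>\<^bsub>A Quot I\<^esub>"
  "\<zero>\<^bsub>super_quot A I\<^esub> = \<zero>\<^bsub>A Quot I\<^esub>"
  "x \<oplus>\<^bsub>super_quot A I\<^esub> y = x \<oplus>\<^bsub>A Quot I\<^esub> y"
  "invol (super_quot A I) x = invol A ` x"
  "scalar (super_quot A I) c = I +>\<^bsub>A\<^esub> scalar A c"
  by (simp_all add: super_quot_def ring.defs superalgebra.defs)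

locale super_ideal = superalg A + ideal I A for A :: "'a superalgebra" (structure) and I +
  assumes invol_ideal: "a \<in> I \<Longrightarrow> invol A a \<in> I"
begin

lemma quot_carrier: "carrier (super_quot A I) = (\<lambda>a. I +> a) ` carrier A"
  by (auto simp: super_quot_simps FactRing_simps)

lemma quot_one: "\<one>\<^bsub>super_quot A I\<^esub> = I +> \<one>"
  by (simp add: super_quot_simps FactRing_def)

lemma quot_zero: "\<zero>\<^bsub>super_quot A I\<^esub> = I +> \<zero>"
  by (simp add: super_quot_simps FactRing_def a_coset_add_zero a_subset)

lemma quot_add: "x \<in> carrier A \<Longrightarrow> y \<in> carrier A \<Longrightarrow> (I +> x) \<oplus>\<^bsub>super_quot A I\<^esub> (I +> y) = I +> (x \<oplus> y)"
  by (simp add: super_quot_simps FactRing_def a_rcos_sum)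

lemma quot_mult: "x \<in> carrier A \<Longrightarrow> y \<in> carrier A \<Longrightarrow> (I +> x) \<otimes>\<^bsub>super_quot A I\<^esub> (I +> y) = I +> (x \<otimes> y)"
  by (simp add: super_quot_simps FactRing_def rcoset_mult_add)

lemma coset_mem: "y \<in> I +> x \<longleftrightarrow> (\<exists>h\<in>I. y = h \<oplus> x)"
  by (auto simp: a_r_coset_def')

lemma quot_invol:
  assumes x: "x \<in> carrier A"
  shows "invol (super_quot A I) (I +> x) = I +> invol A x"
proof -
  have "invol A ` (I +> x) \<subseteq> I +> invol A x"
    using x invol_ideal by (force simp: coset_mem invol_add a_Hcarr)
  moreover have "y \<in> invol A ` (I +> x)" if "y \<in> I +> invol A x" for y
  proof -
    from that obtain h where h: "h \<in> I" "y = h \<oplus> invol A x" by (auto simp: coset_mem)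
    then have "y = invol A (invol A h \<oplus> x)" using x by (simp add: invol_add a_Hcarr)
    moreover have "invol A h \<oplus> x \<in> I +> x" using h invol_ideal by (auto simp: coset_mem)
    ultimately show ?thesis by blast
  qed
  ultimately show ?thesis by (auto simp: super_quot_simps)
qed

lemma superalg_quot: "superalg (super_quot A I)"
  by (rule superalg_image[where A = A and \<pi> = "\<lambda>a. I +> a"])
    (auto simp: superalg_axioms quot_carrier quot_zero quot_one quot_add quot_mult quot_invol)

lemma coset_eq_iff:
  assumes "x \<in> carrier A" "y \<in> carrier A"
  shows "I +> x = I +> y \<longleftrightarrow> x \<ominus> y \<in> I"
  using assms quotient_eq_iff_same_a_r_cos[of I x y] ideal_axioms by blast

lemma coset_zero_iff: "x \<in> carrier A \<Longrightarrow> I +> x = \<zero>\<^bsub>super_quot A I\<^esub> \<longleftrightarrow> x \<in> I"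
  using coset_eq_iff[of x \<zero>] by (simp add: quot_zero minus_eq)

end

section \<open>Completion along a filtration by ideals\<close>

locale super_filtration = superalg A for A :: "'a superalgebra" (structure) and F :: "nat \<Rightarrow> 'a set" +
  assumes ideals: "super_ideal A (F p)"
    and antimono: "p \<le> q \<Longrightarrow> F q \<subseteq> F p"
begin

sublocale F: super_ideal A "F p" for p
  by (rule ideals)

abbreviation "C \<equiv> completion A F"

lemma coset_mono:
  assumes "p \<le> q" "a \<in> carrier A" "b \<in> carrier A"
  shows "F q +> a \<subseteq> F p +> b \<longleftrightarrow> F p +> a = F p +> b"
proof
  assume "F q +> a \<subseteq> F p +> b"
  moreover have "a \<in> F q +> a" using assms by (simp add: F.a_rcos_self)
  ultimately have "a \<in> F p +> b" by blast
  then show "F p +> a = F p +> b"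
    using assms F.a_repr_independence' by metis
next
  assume "F p +> a = F p +> b"
  moreover have "F q +> a \<subseteq> F p +> a" using antimono[OF assms(1)] by (fastforce simp: F.coset_mem)
  ultimately show "F q +> a \<subseteq> F p +> b" by simp
qed

text \<open>Compatibility makes a representative at level \<open>p\<close> serve for all lower
  levels. An operation on the inverse limit can thus be computed with one element of
  \<open>A\<close> up to any prescribed level.\<close>

lemma completion_carrier:
  "x \<in> carrier C \<longleftrightarrow> (\<forall>p. \<exists>a\<in>carrier A. \<forall>q\<le>p. x q = F q +> a)"
proof
  assume "x \<in> carrier C"
  then have x: "x p \<in> carrier (super_quot A (F p))" "p \<le> q \<Longrightarrow> x q \<subseteq> x p" for p q
    by (auto simp: completion_def)
  show "\<forall>p. \<exists>a\<in>carrier A. \<forall>q\<le>p. x q = F q +> a"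
  proof
    fix p
    obtain a where a: "a \<in> carrier A" "x p = F p +> a" using x(1)[of p] unfolding F.quot_carrier by auto
    have "x q = F q +> a" if "q \<le> p" for q
    proof -
      obtain b where b: "b \<in> carrier A" "x q = F q +> b" using x(1)[of q] unfolding F.quot_carrier by auto
      then show ?thesis using x(2)[OF that] a coset_mono[OF that, of a b] by auto
    qed
    then show "\<exists>a\<in>carrier A. \<forall>q\<le>p. x q = F q +> a" using a by blast
  qed
next
  assume *: "\<forall>p. \<exists>a\<in>carrier A. \<forall>q\<le>p. x q = F q +> a"
  have "x p \<in> carrier (super_quot A (F p))" for p
    using * unfolding F.quot_carrier by blast
  moreover have "x q \<subseteq> x p" if pq: "p \<le> q" for p q
  proof -
    obtain a where "a \<in> carrier A" "x q = F q +> a" "x p = F p +> a" using * pq by (metis order_refl)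
    then show ?thesis using coset_mono[OF pq, of a a] by simp
  qed
  ultimately show "x \<in> carrier C" by (simp add: completion_def)
qed

lemma completion_rep:
  assumes "x \<in> carrier C"
  obtains a where "a \<in> carrier A" "\<And>q. q \<le> p \<Longrightarrow> x q = F q +> a"
  using assms unfolding completion_carrier by metis

lemma completion_simps [simp]:
  "\<zero>\<^bsub>C\<^esub> = (\<lambda>p. \<zero>\<^bsub>super_quot A (F p)\<^esub>)"
  "\<one>\<^bsub>C\<^esub> = (\<lambda>p. \<one>\<^bsub>super_quot A (F p)\<^esub>)"
  "x \<oplus>\<^bsub>C\<^esub> y = (\<lambda>p. x p \<oplus>\<^bsub>super_quot A (F p)\<^esub> y p)"
  "x \<otimes>\<^bsub>C\<^esub> y = (\<lambda>p. x p \<otimes>\<^bsub>super_quot A (F p)\<^esub> y p)"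
  "invol C x = (\<lambda>p. invol (super_quot A (F p)) (x p))"
  "scalar C c = (\<lambda>p. scalar (super_quot A (F p)) c)"
  by (simp_all add: completion_def)

sublocale Q: superalg "super_quot A (F p)" for p
  by (rule F.superalg_quot)

lemma completion_level: "x \<in> carrier C \<Longrightarrow> x p \<in> carrier (super_quot A (F p))"
  by (auto simp: completion_def)

lemma superalg_completion: "superalg C"
proof (rule superalgI)
  show "\<zero>\<^bsub>C\<^esub> \<in> carrier C" unfolding completion_carrier
    by (auto simp: F.quot_zero)
  show "\<one>\<^bsub>C\<^esub> \<in> carrier C" unfolding completion_carrier
    by (auto simp: F.quot_one)
next
  fix x y assume xy: "x \<in> carrier C" "y \<in> carrier C"
  show "x \<oplus>\<^bsub>C\<^esub> y \<in> carrier C" "x \<otimes>\<^bsub>C\<^esub> y \<in> carrier C"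
  proof -
    have "\<exists>a\<in>carrier A. \<forall>q\<le>p. (x \<oplus>\<^bsub>C\<^esub> y) q = F q +> a" "\<exists>a\<in>carrier A. \<forall>q\<le>p. (x \<otimes>\<^bsub>C\<^esub> y) q = F q +> a" for p
    proof -
      obtain a b where "a \<in> carrier A" "b \<in> carrier A" "\<And>q. q \<le> p \<Longrightarrow> x q = F q +> a" "\<And>q. q \<le> p \<Longrightarrow> y q = F q +> b"
        using xy completion_rep by metis
      then show "\<exists>a\<in>carrier A. \<forall>q\<le>p. (x \<oplus>\<^bsub>C\<^esub> y) q = F q +> a" "\<exists>a\<in>carrier A. \<forall>q\<le>p. (x \<otimes>\<^bsub>C\<^esub> y) q = F q +> a"
        by (auto simp: F.quot_add F.quot_mult)
    qed
    then show "x \<oplus>\<^bsub>C\<^esub> y \<in> carrier C" "x \<otimes>\<^bsub>C\<^esub> y \<in> carrier C"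
      unfolding completion_carrier by blast+
  qed
  show "x \<oplus>\<^bsub>C\<^esub> y = y \<oplus>\<^bsub>C\<^esub> x" 
    "invol C (x \<oplus>\<^bsub>C\<^esub> y) = invol C x \<oplus>\<^bsub>C\<^esub> invol C y"
    "invol C (x \<otimes>\<^bsub>C\<^esub> y) = invol C x \<otimes>\<^bsub>C\<^esub> invol C y"
    by (simp_all add: fun_eq_iff xy[THEN completion_level] Q.a_comm Q.invol_add Q.invol_mult)
next
  fix x y z assume "x \<in> carrier C" "y \<in> carrier C" "z \<in> carrier C"
  note this[THEN completion_level]
  then show "x \<oplus>\<^bsub>C\<^esub> y \<oplus>\<^bsub>C\<^esub> z = x \<oplus>\<^bsub>C\<^esub> (y \<oplus>\<^bsub>C\<^esub> z)" "x \<otimes>\<^bsub>C\<^esub> y \<otimes>\<^bsub>C\<^esub> z = x \<otimes>\<^bsub>C\<^esub> (y \<otimes>\<^bsub>C\<^esub> z)"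
    "(x \<oplus>\<^bsub>C\<^esub> y) \<otimes>\<^bsub>C\<^esub> z = x \<otimes>\<^bsub>C\<^esub> z \<oplus>\<^bsub>C\<^esub> y \<otimes>\<^bsub>C\<^esub> z" "z \<otimes>\<^bsub>C\<^esub> (x \<oplus>\<^bsub>C\<^esub> y) = z \<otimes>\<^bsub>C\<^esub> x \<oplus>\<^bsub>C\<^esub> z \<otimes>\<^bsub>C\<^esub> y"
    by (simp_all add: fun_eq_iff Q.a_assoc Q.m_assoc Q.l_distr Q.r_distr)
next
  fix x assume x: "x \<in> carrier C"
  note l = this[THEN completion_level]
  show "\<zero>\<^bsub>C\<^esub> \<oplus>\<^bsub>C\<^esub> x = x" "\<one>\<^bsub>C\<^esub> \<otimes>\<^bsub>C\<^esub> x = x" "x \<otimes>\<^bsub>C\<^esub> \<one>\<^bsub>C\<^esub> = x" "invol C (invol C x) = x"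
    by (simp_all add: fun_eq_iff l)
  show "invol C x \<in> carrier C" unfolding completion_carrier
  proof
    fix p
    obtain a where "a \<in> carrier A" "\<And>q. q \<le> p \<Longrightarrow> x q = F q +> a"
      using x completion_rep by metis
    then show "\<exists>a\<in>carrier A. \<forall>q\<le>p. invol C x q = F q +> a"
      by (intro bexI[of _ "invol A a"]) (auto simp: F.quot_invol)
  qed
  show "\<exists>y\<in>carrier C. y \<oplus>\<^bsub>C\<^esub> x = \<zero>\<^bsub>C\<^esub>"
  proof (rule bexI[of _ "\<lambda>p. \<ominus>\<^bsub>super_quot A (F p)\<^esub> x p"])
    show "(\<lambda>p. \<ominus>\<^bsub>super_quot A (F p)\<^esub> x p) \<oplus>\<^bsub>C\<^esub> x = \<zero>\<^bsub>C\<^esub>"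
      by (simp add: fun_eq_iff l Q.l_neg)
    show "(\<lambda>p. \<ominus>\<^bsub>super_quot A (F p)\<^esub> x p) \<in> carrier C"
      unfolding completion_carrier
    proof
      fix p
      obtain a where a: "a \<in> carrier A" "\<And>q. q \<le> p \<Longrightarrow> x q = F q +> a"
        using x completion_rep by metis
      have "\<ominus>\<^bsub>super_quot A (F q)\<^esub> x q = F q +> \<ominus> a" if "q \<le> p" for q
        by (rule Q.minus_equality) (use a that in \<open>auto simp: F.quot_add F.quot_zero l_neg F.quot_carrier\<close>)
      then show "\<exists>a\<in>carrier A. \<forall>q\<le>p. \<ominus>\<^bsub>super_quot A (F q)\<^esub> x q = F q +> a"
        using a by blast
    qed
  qed
qed

lemma to_completion_closed: "a \<in> carrier A \<Longrightarrow> to_completion A F a \<in> carrier C"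
  unfolding completion_carrier to_completion_def by auto

end

text \<open>The coefficient is an argument of \<open>h\<close> because the target is a type without
  scalar multiplication; additivity of \<open>h\<close> in this argument plays the role of
  linearity.\<close>

definition lin_ext :: "('w \<Rightarrow> complex \<Rightarrow> 'r::comm_monoid_add) \<Rightarrow> ('w \<Rightarrow>\<^sub>0 complex) \<Rightarrow> 'r" where
  "lin_ext h f = (\<Sum>w\<in>Poly_Mapping.keys f. h w (Poly_Mapping.lookup f w))"

context
  fixes h :: "'w \<Rightarrow> complex \<Rightarrow> 'r::ring"
  assumes h_add: "h w (a + b) = h w a + h w b"
begin

lemma h_zero: "h w 0 = 0"
  using h_add[of w 0 0] by simp

lemma lin_ext_superset:
  assumes "finite S" "Poly_Mapping.keys f \<subseteq> S"
  shows "lin_ext h f = (\<Sum>w\<in>S. h w (Poly_Mapping.lookup f w))"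
  unfolding lin_ext_def
  by (rule sum.mono_neutral_left) (use assms in \<open>auto simp: in_keys_iff h_zero\<close>)

lemma lin_ext_add: "lin_ext h (f + g) = lin_ext h f + lin_ext h g"
proof -
  let ?S = "Poly_Mapping.keys f \<union> Poly_Mapping.keys g"
  have "lin_ext h (f + g) = (\<Sum>w\<in>?S. h w (Poly_Mapping.lookup (f + g) w))"
    by (rule lin_ext_superset) (use Poly_Mapping.keys_add[of f g] in auto)
  also have "\<dots> = lin_ext h f + lin_ext h g"
    by (simp add: lookup_add h_add sum.distrib lin_ext_superset[of ?S])
  finally show ?thesis .
qed

lemma lin_ext_zero: "lin_ext h 0 = 0"
  by (simp add: lin_ext_def)

lemma lin_ext_sum: "lin_ext h (sum f S) = (\<Sum>i\<in>S. lin_ext h (f i))"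
  by (induction S rule: infinite_finite_induct) (simp_all add: lin_ext_zero lin_ext_add)

lemma lin_ext_single: "lin_ext h (Poly_Mapping.single w c) = h w c"
  by (simp add: lin_ext_def h_zero)

end

lemma poly_mapping_sum_singles:
  "f = (\<Sum>w\<in>Poly_Mapping.keys f. Poly_Mapping.single w (Poly_Mapping.lookup f w))"
  by (rule poly_mapping_eqI) (auto simp: lookup_sum lookup_single when_def in_keys_iff sum.delta)

text \<open>The universal property of the algebra of words. It serves both for the parity involution
  of the free superalgebra and for its action on tensor powers.\<close>

lemma lin_ext_mult:
  fixes h :: "'w::monoid_add \<Rightarrow> complex \<Rightarrow> 'r::ring"
  assumes "\<And>w a b. h w (a + b) = h w a + h w b"
    and "\<And>v w a b. h (v + w) (a * b) = h v a * h w b"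
  shows "lin_ext h (f * g) = lin_ext h f * lin_ext h g"
proof -
  have "f * g = (\<Sum>v\<in>Poly_Mapping.keys f. \<Sum>w\<in>Poly_Mapping.keys g.
     Poly_Mapping.single (v + w) (Poly_Mapping.lookup f v * Poly_Mapping.lookup g w))"
    by (subst poly_mapping_sum_singles[of f], subst poly_mapping_sum_singles[of g])
      (simp add: sum_product mult_single)
  then show ?thesis
    by (simp add: lin_ext_sum[of h, OF assms(1)] lin_ext_single[of h, OF assms(1)] assms(2) sum_product)
      (simp add: lin_ext_def sum_product)
qed

section \<open>The defining relation\<close>

context superalg begin

lemma signed_power_series:
  assumes "f \<in> carrier (power_series A)"
  shows "signed (power_series A) k f = (\<lambda>i. signed A k (f i))"
  using power_series_uminus[OF assms] by (auto simp: signed_def)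

lemma homogeneousI:
  assumes "\<And>i j. i \<in> idx m n \<Longrightarrow> j \<in> idx m n \<Longrightarrow> X i j \<in> carrier A"
    and "\<And>i j. \<not> (i \<in> idx m n \<and> j \<in> idx m n) \<Longrightarrow> X i j = \<zero>"
    and "\<And>i j. i \<in> idx m n \<Longrightarrow> j \<in> idx m n \<Longrightarrow> invol A (X i j) = signed A (par m i + par m j) (X i j)"
  shows "homogeneous m n X"
  unfolding homogeneous_def using End_carrierI[of m n X, OF assms(1,2)] assms(3) by blast

lemma homogeneousD:
  assumes "homogeneous m n X"
  shows "X \<in> carrier (End_tensor m n A)"
    "i \<in> idx m n \<Longrightarrow> j \<in> idx m n \<Longrightarrow> invol A (X i j) = signed A (par m i + par m j) (X i j)"
  using assms unfolding homogeneous_def by blast+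

lemma homogeneous_in_u:
  assumes "superalg.homogeneous (power_series A) m n X"
  shows "superalg.homogeneous (power_series2 A) m n (\<lambda>i j. in_u A (X i j))"
proof -
  interpret P: superalg "power_series A" by (rule superalg_power_series)
  interpret P2: superalg "power_series2 A" by (rule P.superalg_power_series)
  note X = P.homogeneousD[OF assms]
  note c = P.End_carrierD(1)[OF X(1)]
  have c2: "in_u A (X i j) \<in> carrier (power_series2 A)" for i j
    using c P.zero_closed unfolding in_u_def ps_const_def by simp
  show ?thesis
  proof (rule P2.homogeneousI)
    fix i j assume ij: "i \<in> idx m n" "j \<in> idx m n"
    show "invol (power_series2 A) (in_u A (X i j)) = signed (power_series2 A) (par m i + par m j) (in_u A (X i j))"
      unfolding P.signed_power_series[OF c2] power_series_simps(6)[of "power_series A"]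
      by (auto simp: in_u_def ps_const_def X(2)[OF ij] simp del: power_series_simps intro!: ext)
  qed (use c2 P.End_carrierD(2,3)[OF X(1)] in \<open>auto simp: in_u_def ps_const_def\<close>)
qed

lemma homogeneous_in_v:
  assumes "superalg.homogeneous (power_series A) m n X"
  shows "superalg.homogeneous (power_series2 A) m n (\<lambda>i j. in_v A (X i j))"
proof -
  interpret P: superalg "power_series A" by (rule superalg_power_series)
  interpret P2: superalg "power_series2 A" by (rule P.superalg_power_series)
  note X = P.homogeneousD[OF assms]
  note c = P.End_carrierD(1)[OF X(1)]
  have c': "X i j q \<in> carrier A" for i j q
    using c[of i j] by simp
  have c1: "ps_const A (X i j q) \<in> carrier (power_series A)" for i j q
    using c' unfolding ps_const_def by simp
  have c2: "in_v A (X i j) \<in> carrier (power_series2 A)" for i j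
    unfolding in_v_def using c1 power_series_simps(1)[of "power_series A"] by blast
  show ?thesis
  proof (rule P2.homogeneousI)
    fix i j assume ij: "i \<in> idx m n" "j \<in> idx m n"
    have e: "invol A (X i j q) = signed A (par m i + par m j) (X i j q)" for q
      using X(2)[OF ij] unfolding signed_power_series[OF c] by (auto simp: fun_eq_iff)
    show "invol (power_series2 A) (in_v A (X i j)) = signed (power_series2 A) (par m i + par m j) (in_v A (X i j))"
      unfolding P.signed_power_series[OF c2] power_series_simps(6)[of "power_series A"]
      unfolding in_v_def signed_power_series[OF c1] power_series_simps(6)
      by (auto simp: ps_const_def e intro!: ext)
  qed (use c2 P.End_carrierD(2,3)[OF X(1)] in \<open>auto simp: in_v_def ps_const_def intro!: ext\<close>)
qed

text \<open>Only positive upper indices are constrained, since the coefficient of u^k in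
  \<open>T_plus\<close> is built from the member with index \<open>Suc k\<close>.\<close>

definition gen_family :: "nat \<Rightarrow> nat \<Rightarrow> (nat \<Rightarrow> nat \<Rightarrow> nat \<Rightarrow> 'a) \<Rightarrow> bool" where
  "gen_family m n t \<longleftrightarrow> (\<forall>i\<in>idx m n. \<forall>j\<in>idx m n. \<forall>r. t i j (Suc r) \<in> carrier A \<and>
     invol A (t i j (Suc r)) = signed A (par m i + par m j) (t i j (Suc r)))"

lemma T_plus_apply:
  assumes "gen_family m n t" "i \<in> idx m n" "j \<in> idx m n"
  shows "T_plus m n A t i j k = signed A (par m i * par m j + par m j)
     ((if i = j \<and> k = 0 then \<one> else \<zero>) \<ominus> t i j (Suc k))"
    "T_plus m n A t i j \<in> carrier (power_series A)"
proof -
  have c: "t i j (Suc r) \<in> carrier A" for r using assms unfolding gen_family_def by blast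
  let ?f = "minus_series A (if i = j then \<one> else \<zero>) (t i j)"
  have f: "?f \<in> carrier (power_series A)"
    using c by (auto simp: minus_series_def ps_const_def)
  show "T_plus m n A t i j k = signed A (par m i * par m j + par m j)
     ((if i = j \<and> k = 0 then \<one> else \<zero>) \<ominus> t i j (Suc k))"
    unfolding T_plus_def using assms signed_power_series[OF f]
    by (auto simp: minus_series_def ps_const_def)
  interpret P: superalg "power_series A" by (rule superalg_power_series)
  show "T_plus m n A t i j \<in> carrier (power_series A)"
    unfolding T_plus_def using assms P.signed_closed[OF f] by auto
qed

lemma T_plus_homogeneous:
  assumes t: "gen_family m n t"
  shows "superalg.homogeneous (power_series A) m n (T_plus m n A t)"
proof -
  interpret P: superalg "power_series A" by (rule superalg_power_series)
  show ?thesis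
  proof (rule P.homogeneousI)
    fix i j assume ij: "i \<in> idx m n" "j \<in> idx m n"
    note T = T_plus_apply[OF t ij]
    show "T_plus m n A t i j \<in> carrier (power_series A)" by (rule T)
    have c: "t i j (Suc r) \<in> carrier A" and
      e: "invol A (t i j (Suc r)) = signed A (par m i + par m j) (t i j (Suc r))" for r
      using t ij unfolding gen_family_def by blast+
    have "invol A (T_plus m n A t i j k) = signed A (par m i + par m j) (T_plus m n A t i j k)" for k
      unfolding T(1) using c e
      by (auto simp: invol_signed signed_signed invol_minus add.commute) (auto simp: signed_def minus_eq minus_add)
    then show "invol (power_series A) (T_plus m n A t i j) =
       signed (power_series A) (par m i + par m j) (T_plus m n A t i j)"
      unfolding signed_power_series[OF T(2)] by auto
  qed (auto simp: T_plus_def)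
qed

definition spectral_difference :: "nat \<Rightarrow> nat \<Rightarrow> 'a" where
  "spectral_difference = in_u A (ps_var A) \<ominus>\<^bsub>power_series2 A\<^esub> in_v A (ps_var A)"

lemma in_var_closed:
  "in_u A (ps_var A) \<in> carrier (power_series2 A)" "in_v A (ps_var A) \<in> carrier (power_series2 A)"
  by (auto simp: in_u_def in_v_def ps_const_def ps_var_def)

lemma spectral_difference:
  "spectral_difference \<in> carrier (power_series2 A)"
  "invol (power_series2 A) spectral_difference = spectral_difference"
proof -
  interpret P: superalg "power_series A" by (rule superalg_power_series)
  interpret P2: superalg "power_series2 A" by (rule P.superalg_power_series)
  show "spectral_difference \<in> carrier (power_series2 A)"
    unfolding spectral_difference_def by (intro P2.minus_closed in_var_closed)
  show "invol (power_series2 A) spectral_difference = spectral_difference"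
  proof -
    have "invol (power_series2 A) (in_u A (ps_var A)) = in_u A (ps_var A)"
      "invol (power_series2 A) (in_v A (ps_var A)) = in_v A (ps_var A)"
      by (auto simp: in_u_def in_v_def ps_const_def ps_var_def intro!: ext)
    then show ?thesis
      unfolding spectral_difference_def P2.invol_minus[OF in_var_closed] by simp
  qed
qed

lemma RTT_eq:
  fixes m n :: nat and t
  defines "B \<equiv> power_series2 A" 
  defines "X \<equiv> \<lambda>i j. in_u A (T_plus m n A t i j)" and "Y \<equiv> \<lambda>i j. in_v A (T_plus m n A t i j)"
  defines "E \<equiv> End2_tensor m n B"
  defines "R \<equiv> superalg.scalar2 B m n spectral_difference \<ominus>\<^bsub>E\<^esub> perm_elt m n B"
  shows "RTT_lhs m n A t = R \<otimes>\<^bsub>E\<^esub> copy1 m n B X \<otimes>\<^bsub>E\<^esub> copy2 m n B Y"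
    "RTT_rhs m n A t = copy2 m n B Y \<otimes>\<^bsub>E\<^esub> copy1 m n B X \<otimes>\<^bsub>E\<^esub> R"
proof -
  interpret P: superalg "power_series A" by (rule superalg_power_series)
  interpret P2: superalg B unfolding B_def by (rule P.superalg_power_series)
  show "RTT_lhs m n A t = R \<otimes>\<^bsub>E\<^esub> copy1 m n B X \<otimes>\<^bsub>E\<^esub> copy2 m n B Y"
    "RTT_rhs m n A t = copy2 m n B Y \<otimes>\<^bsub>E\<^esub> copy1 m n B X \<otimes>\<^bsub>E\<^esub> R"
    unfolding RTT_lhs_def RTT_rhs_def cleared_R_def Let_def R_def E_def B_def X_def Y_def
      P2.scalar2_def[unfolded B_def] spectral_difference_def by (rule refl)+
qed

lemma RTT_coeff:
  assumes t: "gen_family m n t"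
  shows "RTT_lhs m n A t i j k l q p \<in> carrier A" "RTT_rhs m n A t i j k l q p \<in> carrier A"
    "invol A (RTT_lhs m n A t i j k l q p) =
       signed A (par m i + par m j + (par m k + par m l)) (RTT_lhs m n A t i j k l q p)"
    "invol A (RTT_rhs m n A t i j k l q p) =
       signed A (par m i + par m j + (par m k + par m l)) (RTT_rhs m n A t i j k l q p)"
proof -
  interpret P: superalg "power_series A" by (rule superalg_power_series)
  interpret P2: superalg "power_series2 A" by (rule P.superalg_power_series)
  have main: "Z i j k l q p \<in> carrier A" "invol A (Z i j k l q p) =
       signed A (par m i + par m j + (par m k + par m l)) (Z i j k l q p)"
    if Z: "Z \<in> carrier (End2_tensor m n (power_series2 A))"
      "invol (End2_tensor m n (power_series2 A)) Z = Z" for Z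
  proof -
    note D = P2.End2_carrierD(1)[OF Z(1)]
    have D1: "Z i j k l q \<in> carrier (power_series A)" for q
      using D[of i j k l] power_series_simps(1)[of "power_series A"] by blast
    then show "Z i j k l q p \<in> carrier A" by simp
    have "invol (power_series2 A) (Z i j k l) = signed (power_series2 A) (par m i + par m j + (par m k + par m l)) (Z i j k l)"
      by (rule P2.invol_End2[OF Z])
    then have "invol (power_series A) (Z i j k l q) =
        signed (power_series A) (par m i + par m j + (par m k + par m l)) (Z i j k l q)"
      unfolding P.signed_power_series[OF D] power_series_simps(6)[of "power_series A"] by metis
    then show "invol A (Z i j k l q p) =
       signed A (par m i + par m j + (par m k + par m l)) (Z i j k l q p)"
      unfolding signed_power_series[OF D1] power_series_simps(6) by metis
  qed
  note h = T_plus_homogeneous[OF t]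
  note i = P2.invol_RTT[OF homogeneous_in_u[OF h] homogeneous_in_v[OF h] spectral_difference]
  show "RTT_lhs m n A t i j k l q p \<in> carrier A" "invol A (RTT_lhs m n A t i j k l q p) =
       signed A (par m i + par m j + (par m k + par m l)) (RTT_lhs m n A t i j k l q p)"
    unfolding RTT_eq by (intro main i)+
  show "RTT_rhs m n A t i j k l q p \<in> carrier A" "invol A (RTT_rhs m n A t i j k l q p) =
       signed A (par m i + par m j + (par m k + par m l)) (RTT_rhs m n A t i j k l q p)"
    unfolding RTT_eq by (intro main i)+
qed

text \<open>\<open>a\<close> and \<open>b\<close> are the images of the generator matrix in u and in
  v. With a map into series in two variables for \<open>\<phi>\<close>, all coefficients of the
  relation are treated as one identity.\<close>

lemma map_RTT:
  fixes \<phi> :: "(nat \<Rightarrow> nat \<Rightarrow> 'a) \<Rightarrow> 'r::ring_1" and m n :: nat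
  defines "p \<equiv> par m"
  assumes \<phi>: "ring_map (power_series2 A) \<phi>" and t: "gen_family m n t"
    and ind: "i \<in> idx m n" "j \<in> idx m n" "k \<in> idx m n" "l \<in> idx m n"
  defines "a \<equiv> \<lambda>i j. \<phi> (in_u A (T_plus m n A t i j))" and "b \<equiv> \<lambda>i j. \<phi> (in_v A (T_plus m n A t i j))"
  defines "w \<equiv> \<phi> (in_u A (ps_var A)) - \<phi> (in_v A (ps_var A))"
  shows "\<phi> (RTT_lhs m n A t i j k l) = (-1) ^ ((p i + p j) * (p k + p l)) * (w * a i j * b k l) -
      (-1) ^ (p k + (p k + p j) * (p k + p l)) * (a k j * b i l)"
    "\<phi> (RTT_rhs m n A t i j k l) = b k l * a i j * w -
      (-1) ^ (p k + (p k + p j) * (p k + p l)) * (b k j * a i l)"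
proof -
  interpret P: superalg "power_series A" by (rule superalg_power_series)
  interpret P2: superalg "power_series2 A" by (rule P.superalg_power_series)
  note h = T_plus_homogeneous[OF t]
  have w: "w = \<phi> spectral_difference"
    unfolding w_def spectral_difference_def by (rule P2.ring_map_minus[OF \<phi> in_var_closed, symmetric])
  show "\<phi> (RTT_lhs m n A t i j k l) = (-1) ^ ((p i + p j) * (p k + p l)) * (w * a i j * b k l) -
      (-1) ^ (p k + (p k + p j) * (p k + p l)) * (a k j * b i l)"
    unfolding RTT_eq p_def a_def b_def w
    by (rule P2.map_RTT_left[OF \<phi> homogeneous_in_u[OF h] homogeneous_in_v[OF h] spectral_difference ind])
  show "\<phi> (RTT_rhs m n A t i j k l) = b k l * a i j * w -
      (-1) ^ (p k + (p k + p j) * (p k + p l)) * (b k j * a i l)"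
    unfolding RTT_eq p_def a_def b_def w
    by (rule P2.map_RTT_right[OF \<phi> homogeneous_in_u[OF h] homogeneous_in_v[OF h] spectral_difference ind])
qed

text \<open>The generators of \<open>RTT_ideal\<close> are indexed by all natural numbers, so the
  indices outside the matrix range have to be seen to give trivial relations.\<close>

lemma RTT_outside:
  assumes t: "gen_family m n t" and ind: "\<not> (i \<in> idx m n \<and> j \<in> idx m n \<and> k \<in> idx m n \<and> l \<in> idx m n)"
  shows "RTT_lhs m n A t i j k l = RTT_rhs m n A t i j k l"
proof -
  interpret P: superalg "power_series A" by (rule superalg_power_series)
  interpret P2: superalg "power_series2 A" by (rule P.superalg_power_series)
  note h = T_plus_homogeneous[OF t]
  note i = P2.invol_RTT[OF homogeneous_in_u[OF h] homogeneous_in_v[OF h] spectral_difference]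
  show ?thesis unfolding RTT_eq
    using P2.End2_carrierD(2)[OF i(1) ind] P2.End2_carrierD(2)[OF i(3) ind] by simp
qed

end

section \<open>The free superalgebra\<close>

lemma free_simps [simp]:
  "carrier (free_superalgebra m n) = {f. \<forall>w\<in>Poly_Mapping.keys f. set (letters w) \<subseteq> gens m n}"
  "\<one>\<^bsub>free_superalgebra m n\<^esub> = 1"
  "\<zero>\<^bsub>free_superalgebra m n\<^esub> = 0"
  "f \<oplus>\<^bsub>free_superalgebra m n\<^esub> g = f + g"
  "f \<otimes>\<^bsub>free_superalgebra m n\<^esub> g = f * g"
  "scalar (free_superalgebra m n) c = Poly_Mapping.single 0 c"
  by (simp_all add: free_superalgebra_def)

lemma letters_plus [simp]: "letters (v + w) = letters v @ letters w"
  by (simp add: plus_word_def)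

lemma letters_zero [simp]: "letters 0 = []"
  by (simp add: zero_word_def)

lemma lookup_free_invol:
  "Poly_Mapping.lookup (invol (free_superalgebra m n) f) w = (-1) ^ word_parity m w * Poly_Mapping.lookup f w"
  by (auto simp: free_superalgebra_def lookup_mapp when_def in_keys_iff)

lemma free_invol_lin_ext:
  "invol (free_superalgebra m n) f = lin_ext (\<lambda>w c. Poly_Mapping.single w ((-1) ^ word_parity m w * c)) f"
  unfolding lin_ext_def
  by (rule poly_mapping_eqI) (auto simp: lookup_free_invol lookup_sum lookup_single when_def in_keys_iff sum.delta)

lemma superalg_free: "superalg (free_superalgebra m n)"
proof (rule superalgI)
  let ?A = "free_superalgebra m n"
  fix a b assume ab: "a \<in> carrier ?A" "b \<in> carrier ?A"
  show "a \<oplus>\<^bsub>?A\<^esub> b \<in> carrier ?A" using ab Poly_Mapping.keys_add[of a b] by auto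
  show "a \<otimes>\<^bsub>?A\<^esub> b \<in> carrier ?A" using ab keys_mult[of a b] by fastforce
  show "invol ?A (a \<oplus>\<^bsub>?A\<^esub> b) = invol ?A a \<oplus>\<^bsub>?A\<^esub> invol ?A b"
    by (rule poly_mapping_eqI) (simp add: lookup_free_invol lookup_add distrib_left)
  show "invol ?A (a \<otimes>\<^bsub>?A\<^esub> b) = invol ?A a \<otimes>\<^bsub>?A\<^esub> invol ?A b"
    unfolding free_invol_lin_ext free_simps
    by (rule lin_ext_mult, simp only: distrib_left single_add)
      (simp add: mult_single word_parity_def power_add mult_ac)
next
  let ?A = "free_superalgebra m n"
  fix a assume a: "a \<in> carrier ?A"
  show "invol ?A a \<in> carrier ?A" using a by (auto simp: in_keys_iff lookup_free_invol)
  show "invol ?A (invol ?A a) = a"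
    by (rule poly_mapping_eqI) (simp add: lookup_free_invol flip: mult.assoc power_mult_distrib)
  show "\<exists>b\<in>carrier ?A. b \<oplus>\<^bsub>?A\<^esub> a = \<zero>\<^bsub>?A\<^esub>"
    by (rule bexI[of _ "- a"]) (use a in \<open>auto simp: in_keys_iff\<close>)
qed (auto simp: algebra_simps)

lemma free_uminus:
  assumes "f \<in> carrier (free_superalgebra m n)"
  shows "\<ominus>\<^bsub>free_superalgebra m n\<^esub> f = - f"
proof -
  interpret superalg "free_superalgebra m n" by (rule superalg_free)
  show ?thesis by (rule minus_equality) (use assms in \<open>auto simp: in_keys_iff\<close>)
qed

lemma free_gen_closed:
  "i \<in> idx m n \<Longrightarrow> j \<in> idx m n \<Longrightarrow> free_gen i j (Suc r) \<in> carrier (free_superalgebra m n)"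
  by (simp add: free_gen_def gens_def)

lemma free_gen_family: "superalg.gen_family (free_superalgebra m n) m n free_gen"
proof -
  interpret superalg "free_superalgebra m n" by (rule superalg_free)
  have "invol (free_superalgebra m n) (free_gen i j (Suc r)) =
     signed (free_superalgebra m n) (par m i + par m j) (free_gen i j (Suc r))"
    if "i \<in> idx m n" "j \<in> idx m n" for i j r
    using free_uminus[OF free_gen_closed[OF that, of r]]
    by (intro poly_mapping_eqI)
      (auto simp: signed_def lookup_free_invol free_gen_def lookup_single when_def word_parity_def minus_one_power_iff)
  then show ?thesis unfolding gen_family_def using free_gen_closed by blast
qed

section \<open>The filtered dual Yangian\<close>

lemma (in ring) ideal_criterion:
  assumes "I \<subseteq> carrier R" "I \<noteq> {}"
    and "\<And>a b. a \<in> I \<Longrightarrow> b \<in> I \<Longrightarrow> a \<oplus> b \<in> I" "\<And>a. a \<in> I \<Longrightarrow> \<ominus> a \<in> I"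
    and "\<And>a x. a \<in> I \<Longrightarrow> x \<in> carrier R \<Longrightarrow> x \<otimes> a \<in> I"
    and "\<And>a x. a \<in> I \<Longrightarrow> x \<in> carrier R \<Longrightarrow> a \<otimes> x \<in> I"
  shows "ideal I R"
proof (rule idealI[OF ring_axioms])
  show "subgroup I (add_monoid R)"
    by (rule add.subgroupI) (use assms in auto)
qed (use assms in auto)

lemma (in superalg) signed_minus:
  "a \<in> carrier A \<Longrightarrow> b \<in> carrier A \<Longrightarrow> signed A k (a \<ominus> b) = signed A k a \<ominus> signed A k b"
  by (simp add: signed_def minus_eq minus_add)

lemma (in ring) minus_eq_zero_iff: "a \<in> carrier R \<Longrightarrow> b \<in> carrier R \<Longrightarrow> a \<ominus> b = \<zero> \<longleftrightarrow> a = b"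
  by (metis a_inv_closed minus_eq minus_equality minus_minus r_neg)

context ring begin

lemma add_minus_add_left:
  assumes "x \<in> carrier R" "a \<in> carrier R" "b \<in> carrier R"
  shows "(x \<oplus> a) \<ominus> (x \<oplus> b) = a \<ominus> b"
  using assms by algebra

lemma minus_minus_swap:
  assumes "x \<in> carrier R" "a \<in> carrier R" "b \<in> carrier R"
  shows "a \<ominus> b \<ominus> x = \<ominus> ((x \<oplus> b) \<ominus> a)"
  using assms by algebra

lemma minus_distr:
  assumes "x \<in> carrier R" "a \<in> carrier R" "b \<in> carrier R"
  shows "(a \<ominus> b) \<otimes> x = a \<otimes> x \<ominus> b \<otimes> x" "x \<otimes> (a \<ominus> b) = x \<otimes> a \<ominus> x \<otimes> b"
  using assms by (simp_all add: minus_eq l_distr r_distr l_minus r_minus)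

end

lemma super_ideal_RTT: "super_ideal (free_superalgebra m n) (RTT_ideal m n)"
proof -
  let ?A = "free_superalgebra m n"
  interpret superalg ?A by (rule superalg_free)
  let ?L = "RTT_lhs m n ?A free_gen" and ?R = "RTT_rhs m n ?A free_gen"
  let ?G = "{?L i j k l q p \<ominus>\<^bsub>?A\<^esub> ?R i j k l q p | i j k l q p. True}"
  note c = RTT_coeff[OF free_gen_family]
  have G: "?G \<subseteq> carrier ?A" using c(1,2) minus_closed by blast
  have I: "RTT_ideal m n = Idl\<^bsub>?A\<^esub> ?G" unfolding RTT_ideal_def Let_def by (rule refl)
  interpret I: ideal "RTT_ideal m n" ?A unfolding I by (rule genideal_ideal[OF G])
  \<comment> \<open>Stability under the grading follows by minimality: \<open>?J\<close> is an
    ideal, and it contains the generators because each of them is homogeneous, so that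
    \<open>invol\<close> changes it at most by a sign.\<close>
  let ?J = "{a \<in> carrier ?A. invol ?A a \<in> RTT_ideal m n}"
  have "ideal ?J ?A"
  proof (rule ideal_criterion)
    show "?J \<noteq> {}" using invol_zero zero_closed I.zero_closed by (metis (mono_tags, lifting) empty_iff mem_Collect_eq)
  qed (auto simp del: free_simps simp: invol_add invol_uminus invol_mult intro: I.I_l_closed I.I_r_closed)
  moreover have "?G \<subseteq> ?J"
  proof
    fix a assume a: "a \<in> ?G"
    then obtain i j k l q p where e: "a = ?L i j k l q p \<ominus>\<^bsub>?A\<^esub> ?R i j k l q p" by blast
    have ac: "a \<in> carrier ?A" using a G by blast
    have "invol ?A a = signed ?A (par m i + par m j + (par m k + par m l)) a"
      unfolding e using c(1,2) by (simp del: free_simps add: invol_minus c(3,4) signed_minus)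
    moreover have "a \<in> RTT_ideal m n" unfolding I using a genideal_self[OF G] by blast
    ultimately show "a \<in> ?J" using ac by (simp del: free_simps add: signed_def)
  qed
  ultimately have "RTT_ideal m n \<subseteq> ?J" unfolding I[symmetric] by (subst I) (rule genideal_minimal)
  then show ?thesis
    unfolding super_ideal_def super_ideal_axioms_def using superalg_axioms I.ideal_axioms by blast
qed

lemma RTT_ideal_minimal:
  assumes "ideal J (free_superalgebra m n)"
    and "\<And>i j k l q p. RTT_lhs m n (free_superalgebra m n) free_gen i j k l q p
    \<ominus>\<^bsub>free_superalgebra m n\<^esub> RTT_rhs m n (free_superalgebra m n) free_gen i j k l q p \<in> J"
  shows "RTT_ideal m n \<subseteq> J"
proof -
  interpret superalg "free_superalgebra m n" by (rule superalg_free)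
  show ?thesis unfolding RTT_ideal_def Let_def by (rule genideal_minimal[OF assms(1)]) (use assms(2) in blast)
qed

definition free_degree_ge :: "nat \<Rightarrow> nat \<Rightarrow> nat \<Rightarrow> free_alg set" where
  "free_degree_ge m n p = {f \<in> carrier (free_superalgebra m n). \<forall>w\<in>Poly_Mapping.keys f. p \<le> word_degree w}"

lemma word_degree_plus: "word_degree (v + w) = word_degree v + word_degree w"
  by (simp add: word_degree_def)

lemma free_degree_ge_ops:
  "f \<in> free_degree_ge m n p \<Longrightarrow> g \<in> free_degree_ge m n p \<Longrightarrow> f + g \<in> free_degree_ge m n p"
  "f \<in> free_degree_ge m n p \<Longrightarrow> - f \<in> free_degree_ge m n p"
  "f \<in> free_degree_ge m n p \<Longrightarrow> g \<in> free_degree_ge m n q \<Longrightarrow> f * g \<in> free_degree_ge m n (p + q)"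
  "f \<in> free_degree_ge m n p \<Longrightarrow> invol (free_superalgebra m n) f \<in> free_degree_ge m n p"
  "f \<in> free_degree_ge m n p \<Longrightarrow> q \<le> p \<Longrightarrow> f \<in> free_degree_ge m n q"
  subgoal using Poly_Mapping.keys_add[of f g] unfolding free_degree_ge_def free_simps by blast
  subgoal unfolding free_degree_ge_def by (auto simp: in_keys_iff)
  subgoal using keys_mult[of f g] unfolding free_degree_ge_def by (fastforce simp: word_degree_plus add_mono)
  subgoal unfolding free_degree_ge_def by (auto simp: in_keys_iff lookup_free_invol)
  subgoal unfolding free_degree_ge_def by auto
  done

lemma free_degree_ge_0: "free_degree_ge m n 0 = carrier (free_superalgebra m n)"
  by (auto simp: free_degree_ge_def)

text \<open>\<open>F_0\<close> makes level 0 of the completion trivial, and \<open>F_mult\<close> is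
  the instance of multiplicativity by which the powers of an element of \<open>F 1\<close> tend to
  zero.\<close>

locale filtered_superalg = super_filtration +
  assumes F_0: "F 0 = carrier A"
    and F_mult: "a \<in> F 1 \<Longrightarrow> b \<in> F q \<Longrightarrow> a \<otimes> b \<in> F (Suc q)"

lemma filtration_eq: "dual_yangian_filtration m n p =
    (\<lambda>f. RTT_ideal m n +>\<^bsub>free_superalgebra m n\<^esub> f) ` free_degree_ge m n p"
  unfolding dual_yangian_filtration_def free_degree_ge_def by auto

lemma superalg_dual_yangian: "superalg (dual_yangian m n)"
proof -
  interpret super_ideal "free_superalgebra m n" "RTT_ideal m n" by (rule super_ideal_RTT)
  show ?thesis unfolding dual_yangian_def by (rule superalg_quot)
qed

lemma filtered_dual_yangian: "filtered_superalg (dual_yangian m n) (dual_yangian_filtration m n)"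
proof -
  let ?A = "free_superalgebra m n" and ?I = "RTT_ideal m n" and ?D = "dual_yangian m n"
  let ?pi = "\<lambda>f. ?I +>\<^bsub>?A\<^esub> f" and ?F = "dual_yangian_filtration m n"
  interpret A: superalg ?A by (rule superalg_free)
  interpret I: super_ideal ?A ?I by (rule super_ideal_RTT)
  interpret D: superalg ?D by (rule superalg_dual_yangian)
  have car: "carrier ?D = ?pi ` carrier ?A" unfolding dual_yangian_def by (rule I.quot_carrier)
  note ops = I.quot_add[folded dual_yangian_def] I.quot_mult[folded dual_yangian_def]
    I.quot_invol[folded dual_yangian_def] I.quot_zero[folded dual_yangian_def]
  have sub: "f \<in> free_degree_ge m n p \<Longrightarrow> f \<in> carrier ?A" for f p
    unfolding free_degree_ge_def by blast
  have neg: "\<ominus>\<^bsub>?D\<^esub> ?pi f = ?pi (- f)" if "f \<in> carrier ?A" for f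
  proof (rule D.minus_equality)
    have nf: "- f \<in> carrier ?A" using A.a_inv_closed[OF that] unfolding free_uminus[OF that] .
    show "?pi (- f) \<oplus>\<^bsub>?D\<^esub> ?pi f = \<zero>\<^bsub>?D\<^esub>" unfolding ops(1)[OF nf that] ops(4) by simp
    show "?pi f \<in> carrier ?D" "?pi (- f) \<in> carrier ?D" using car that nf by blast+
  qed
  have "super_ideal ?D (?F p)" for p
  proof -
    have "ideal (?F p) ?D"
    proof (rule D.ideal_criterion)
      show "?F p \<subseteq> carrier ?D" unfolding filtration_eq car using sub by blast
      have "0 \<in> free_degree_ge m n p" by (simp add: free_degree_ge_def)
      then show "?F p \<noteq> {}" unfolding filtration_eq by blast
    next
      fix a b assume "a \<in> ?F p" "b \<in> ?F p"
      then obtain f g where fg: "f \<in> free_degree_ge m n p" "g \<in> free_degree_ge m n p" "a = ?pi f" "b = ?pi g"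
        unfolding filtration_eq by blast
      show "a \<oplus>\<^bsub>?D\<^esub> b \<in> ?F p"
        unfolding fg(3,4) ops(1)[OF fg(1,2)[THEN sub]] filtration_eq using free_degree_ge_ops(1)[OF fg(1,2)] by simp
    next
      fix a assume "a \<in> ?F p"
      then obtain f where f: "f \<in> free_degree_ge m n p" "a = ?pi f" unfolding filtration_eq by blast
      show "\<ominus>\<^bsub>?D\<^esub> a \<in> ?F p"
        unfolding f(2) neg[OF sub[OF f(1)]] filtration_eq using free_degree_ge_ops(2)[OF f(1)] by blast
      fix x assume "x \<in> carrier ?D"
      then obtain g where g: "g \<in> carrier ?A" "x = ?pi g" unfolding car by blast
      \<comment> \<open>Every element has degree at least 0; additivity of degrees then makes each
        term of the filtration a two-sided ideal.\<close>
      then have g0: "g \<in> free_degree_ge m n 0" unfolding free_degree_ge_0 by blast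
      show "x \<otimes>\<^bsub>?D\<^esub> a \<in> ?F p" "a \<otimes>\<^bsub>?D\<^esub> x \<in> ?F p"
        unfolding f(2) g(2) ops(2)[OF g(1) sub[OF f(1)]] ops(2)[OF sub[OF f(1)] g(1)] filtration_eq
        using free_degree_ge_ops(3)[OF g0 f(1)] free_degree_ge_ops(3)[OF f(1) g0] by simp_all
    qed
    moreover have "invol ?D a \<in> ?F p" if a: "a \<in> ?F p" for a
    proof -
      obtain f where f: "f \<in> free_degree_ge m n p" "a = ?pi f" using a unfolding filtration_eq by blast
      show ?thesis unfolding f(2) ops(3)[OF sub[OF f(1)]] filtration_eq using free_degree_ge_ops(4)[OF f(1)] by blast
    qed
    ultimately show ?thesis unfolding super_ideal_def super_ideal_axioms_def using D.superalg_axioms by blast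
  qed
  moreover have "?F q \<subseteq> ?F p" if "p \<le> q" for p q
    unfolding filtration_eq using free_degree_ge_ops(5) that by blast
  moreover have "?F 0 = carrier ?D" unfolding filtration_eq free_degree_ge_0 car by (rule refl)
  moreover have "a \<otimes>\<^bsub>?D\<^esub> b \<in> ?F (Suc q)" if ab: "a \<in> ?F 1" "b \<in> ?F q" for a b q
  proof -
    obtain f g where fg: "f \<in> free_degree_ge m n 1" "g \<in> free_degree_ge m n q" "a = ?pi f" "b = ?pi g"
      using ab unfolding filtration_eq by blast
    show ?thesis
      unfolding fg(3,4) ops(2)[OF fg(1,2)[THEN sub]] filtration_eq using free_degree_ge_ops(3)[OF fg(1,2)] by simp
  qed
  ultimately show ?thesis
    by (intro filtered_superalg.intro super_filtration.intro filtered_superalg_axioms.intro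
        super_filtration_axioms.intro D.superalg_axioms)
qed

lemma (in abelian_monoid) finsum_in:
  assumes "finite S" "J \<subseteq> carrier G" "\<zero> \<in> J" "\<And>a b. a \<in> J \<Longrightarrow> b \<in> J \<Longrightarrow> a \<oplus> b \<in> J"
    and "\<And>i. i \<in> S \<Longrightarrow> f i \<in> J"
  shows "(\<Oplus>i\<in>S. f i) \<in> J"
  using assms(1,5)
proof (induction S rule: finite_induct)
  case (insert a S)
  then have "f \<in> S \<rightarrow> carrier G" "f a \<in> carrier G" using assms(2) by auto
  then show ?case using insert assms(4) by (simp add: finsum_insert)
qed (simp add: assms)

abbreviation End_series :: "nat \<Rightarrow> nat \<Rightarrow> 'a superalgebra \<Rightarrow> (nat \<Rightarrow> nat \<Rightarrow> nat \<Rightarrow> 'a) superalgebra" where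
  "End_series m n A \<equiv> End_tensor m n (power_series A)"

context superalg begin

lemma superalg_End_series: "superalg (End_series m n A)"
proof -
  interpret P: superalg "power_series A" by (rule superalg_power_series)
  show ?thesis by (rule P.superalg_End_tensor)
qed

lemma End_series_carrierD: "X \<in> carrier (End_series m n A) \<Longrightarrow> X i j c \<in> carrier A"
proof -
  interpret P: superalg "power_series A" by (rule superalg_power_series)
  assume "X \<in> carrier (End_series m n A)"
  from P.End_carrierD(1)[OF this, of i j] show "X i j c \<in> carrier A" by simp
qed

lemma End_series_minus:
  assumes "X \<in> carrier (End_series m n A)" "Y \<in> carrier (End_series m n A)"
  shows "X \<ominus>\<^bsub>End_series m n A\<^esub> Y = (\<lambda>i j c. X i j c \<ominus> Y i j c)"
proof -
  interpret P: superalg "power_series A" by (rule superalg_power_series)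
  show ?thesis
    unfolding P.End_tensor_minus[OF assms]
    using power_series_minus[OF P.End_carrierD(1)[OF assms(1)] P.End_carrierD(1)[OF assms(2)]] by simp
qed

text \<open>One statement for products of matrices with entries in different terms of the
  filtration. \<open>JX\<close> has to be stable under \<open>invol\<close> because the matrix
  product twists the entries of its left factor.\<close>

lemma End_series_mult_in:
  assumes X: "X \<in> carrier (End_series m n A)" "\<And>i j c. X i j c \<in> JX"
    and Y: "Y \<in> carrier (End_series m n A)" "\<And>i j c. Y i j c \<in> JY"
    and JX: "\<And>a. a \<in> JX \<Longrightarrow> invol A a \<in> JX"
    and JZ: "JZ \<subseteq> carrier A" "\<zero> \<in> JZ" "\<And>a b. a \<in> JZ \<Longrightarrow> b \<in> JZ \<Longrightarrow> a \<oplus> b \<in> JZ"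
    and J: "\<And>a b. a \<in> JX \<Longrightarrow> b \<in> JY \<Longrightarrow> a \<otimes> b \<in> JZ"
  shows "(X \<otimes>\<^bsub>End_series m n A\<^esub> Y) i l c \<in> JZ"
proof -
  interpret P: superalg "power_series A" by (rule superalg_power_series)
  let ?J = "{f. \<forall>c. f c \<in> JZ}"
  have "(\<Oplus>\<^bsub>power_series A\<^esub>j\<in>idx m n. P.tw (par m j + par m l) (X i j) \<otimes>\<^bsub>power_series A\<^esub> Y j l) \<in> ?J"
  proof (rule P.finsum_in)
    show "?J \<subseteq> carrier (power_series A)" using JZ by auto
    fix j
    have "P.tw k (X i j) d \<in> JX" for k d using X(2) JX by (simp add: P.tw_def)
    then show "P.tw (par m j + par m l) (X i j) \<otimes>\<^bsub>power_series A\<^esub> Y j l \<in> ?J"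
      using Y(2) J by (auto intro!: finsum_in JZ)
  qed (use JZ in auto)
  then show ?thesis unfolding P.End_tensor_mult using JZ(2) by simp
qed

end

section \<open>Inverting matrices congruent to the identity\<close>

context filtered_superalg begin

interpretation C: superalg C by (rule superalg_completion)

lemma completion_minus:
  assumes "x \<in> carrier C" "y \<in> carrier C"
  shows "x \<ominus>\<^bsub>C\<^esub> y = (\<lambda>p. x p \<ominus>\<^bsub>super_quot A (F p)\<^esub> y p)"
proof -
  have "\<ominus>\<^bsub>C\<^esub> y = (\<lambda>p. \<ominus>\<^bsub>super_quot A (F p)\<^esub> y p)"
  proof
    fix p
    have "(\<ominus>\<^bsub>C\<^esub> y \<oplus>\<^bsub>C\<^esub> y) p = \<zero>\<^bsub>super_quot A (F p)\<^esub>" using assms by (simp add: C.l_neg del: completion_simps(3))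
    then show "(\<ominus>\<^bsub>C\<^esub> y) p = \<ominus>\<^bsub>super_quot A (F p)\<^esub> y p"
      using assms completion_level C.a_inv_closed by (intro Q.minus_equality[symmetric]) simp_all
  qed
  then show ?thesis by (simp add: a_minus_def)
qed

text \<open>The \<open>q\<close>-th term of the filtration induced on the completion.\<close>

definition vanish :: "nat \<Rightarrow> (nat \<Rightarrow> 'a set) set" where
  "vanish q = {x \<in> carrier C. \<forall>p\<le>q. x p = \<zero>\<^bsub>super_quot A (F p)\<^esub>}"

lemma vanish_0: "vanish 0 = carrier C"
proof -
  have "x 0 = \<zero>\<^bsub>super_quot A (F 0)\<^esub>" if x: "x \<in> carrier C" for x
  proof -
    obtain a where "a \<in> carrier A" "\<And>q. q \<le> 0 \<Longrightarrow> x q = F q +> a" using completion_rep[OF x, of 0] by metis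
    then have a: "a \<in> carrier A" "x 0 = F 0 +> a" by simp_all
    have "a \<in> F 0" unfolding F_0 by (rule a)
    then show ?thesis unfolding a(2) using F.coset_zero_iff[OF a(1)] by blast
  qed
  then show ?thesis unfolding vanish_def by auto
qed

lemma vanish_ops:
  "vanish q \<subseteq> carrier C" "\<zero>\<^bsub>C\<^esub> \<in> vanish q"
  "x \<in> vanish q \<Longrightarrow> y \<in> vanish q \<Longrightarrow> x \<oplus>\<^bsub>C\<^esub> y \<in> vanish q"
  "x \<in> vanish q \<Longrightarrow> invol C x \<in> vanish q"
  "x \<in> vanish q \<Longrightarrow> y \<in> carrier C \<Longrightarrow> x \<otimes>\<^bsub>C\<^esub> y \<in> vanish q"
  "x \<in> vanish q \<Longrightarrow> y \<in> carrier C \<Longrightarrow> y \<otimes>\<^bsub>C\<^esub> x \<in> vanish q"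
  using C.zero_closed C.add.m_closed C.invol_closed C.m_closed completion_level
  unfolding vanish_def by (auto simp del: completion_simps(3,4,5)) (auto simp: completion_simps)

lemma vanish_mult:
  assumes "x \<in> vanish 1" "y \<in> vanish q"
  shows "x \<otimes>\<^bsub>C\<^esub> y \<in> vanish (Suc q)"
proof -
  have c: "x \<in> carrier C" "y \<in> carrier C" using assms unfolding vanish_def by blast+
  obtain a where a: "a \<in> carrier A" "\<And>r. r \<le> Suc q \<Longrightarrow> x r = F r +> a" using completion_rep[OF c(1), of "Suc q"] by metis
  obtain b where b: "b \<in> carrier A" "\<And>r. r \<le> Suc q \<Longrightarrow> y r = F r +> b" using completion_rep[OF c(2), of "Suc q"] by metis
  have "x 1 = F 1 +> a" "y q = F q +> b" using a b by auto
  moreover have "x 1 = \<zero>\<^bsub>super_quot A (F 1)\<^esub>" "y q = \<zero>\<^bsub>super_quot A (F q)\<^esub>"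
    using assms unfolding vanish_def by auto
  ultimately have "a \<in> F 1" "b \<in> F q" using a(1) b(1) F.coset_zero_iff by metis+
  then have "a \<otimes> b \<in> F (Suc q)" by (rule F_mult)
  then have "(x \<otimes>\<^bsub>C\<^esub> y) r = \<zero>\<^bsub>super_quot A (F r)\<^esub>" if "r \<le> Suc q" for r
    using antimono[OF that] a b that F.coset_zero_iff[of "a \<otimes> b" r] by (auto simp: F.quot_mult)
  then show ?thesis using C.m_closed[OF c] unfolding vanish_def by blast
qed

text \<open>The geometric series converges because the powers of \<open>X\<close> lie in ever deeper
  terms of the filtration. The \<open>inv\<close> in \<open>is_z_plus\<close> denotes an inverse
  only for units, so the generator matrix has to be inverted over the completion; it differs from
  the identity by entries of positive degree.\<close>

lemma one_minus_unit:
  assumes X: "X \<in> carrier (End_series m n C)" "\<And>i j c. X i j c \<in> vanish 1"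
  defines "M \<equiv> End_series m n C"
  shows "\<exists>S\<in>carrier M. (\<one>\<^bsub>M\<^esub> \<ominus>\<^bsub>M\<^esub> X) \<otimes>\<^bsub>M\<^esub> S = \<one>\<^bsub>M\<^esub> \<and> S \<otimes>\<^bsub>M\<^esub> (\<one>\<^bsub>M\<^esub> \<ominus>\<^bsub>M\<^esub> X) = \<one>\<^bsub>M\<^esub>"
proof -
  interpret P: superalg "power_series C" by (rule C.superalg_power_series)
  interpret M: superalg M unfolding M_def by (rule C.superalg_End_series)
  define N where "N q = {Z \<in> carrier M. \<forall>i j c. Z i j c \<in> vanish q}" for q
  have XM: "X \<in> carrier M" and XN: "X \<in> N 1" using X unfolding N_def M_def by auto
  have N0: "N 0 = carrier M" unfolding N_def vanish_0 M_def using C.End_series_carrierD by blast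
  have Nc: "Z \<in> N q \<Longrightarrow> Z \<in> carrier M" for Z q unfolding N_def by blast
  have Nadd: "Z \<oplus>\<^bsub>M\<^esub> W \<in> N q" if "Z \<in> N q" "W \<in> N q" for Z W q
    using that M.a_closed[of Z W] vanish_ops(3) unfolding N_def M_def
    by (auto simp del: completion_simps End_tensor_simps(1))
  have NE: "Z \<in> carrier (End_series m n C)" "\<And>i j c. Z i j c \<in> vanish q" if "Z \<in> N q" for Z q
    using that unfolding N_def M_def by blast+
  have ME: "Z \<in> carrier (End_series m n C)" "\<And>i j c. Z i j c \<in> carrier C" if "Z \<in> carrier M" for Z
    using that C.End_series_carrierD unfolding M_def by blast+
  have NI: "Z \<in> N q" if "Z \<in> carrier M" "\<And>i j c. Z i j c \<in> vanish q" for Z q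
    using that unfolding N_def by simp
  have Nl: "W \<otimes>\<^bsub>M\<^esub> Z \<in> N q" if Z: "Z \<in> N q" and W: "W \<in> carrier M" for Z W q
  proof (rule NI)
    show "W \<otimes>\<^bsub>M\<^esub> Z \<in> carrier M" by (rule M.m_closed[OF W Nc[OF Z]])
    show "(W \<otimes>\<^bsub>M\<^esub> Z) i l c \<in> vanish q" for i l c
      unfolding M_def
      by (rule C.End_series_mult_in[OF ME(1)[OF W] _ NE(1)[OF Z]],
        rule ME(2)[OF W], rule NE(2)[OF Z], erule C.invol_closed, rule vanish_ops(1), rule vanish_ops(2),
        erule (1) vanish_ops(3), erule (1) vanish_ops(6)[rotated])
  qed
  have Nr: "Z \<otimes>\<^bsub>M\<^esub> W \<in> N q" if Z: "Z \<in> N q" and W: "W \<in> carrier M" for Z W q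
  proof (rule NI)
    show "Z \<otimes>\<^bsub>M\<^esub> W \<in> carrier M" by (rule M.m_closed[OF Nc[OF Z] W])
    show "(Z \<otimes>\<^bsub>M\<^esub> W) i l c \<in> vanish q" for i l c
      unfolding M_def
      by (rule C.End_series_mult_in[OF NE(1)[OF Z] _ ME(1)[OF W]],
        rule NE(2)[OF Z], rule ME(2)[OF W], erule vanish_ops(4), rule vanish_ops(1), rule vanish_ops(2),
        erule (1) vanish_ops(3), erule (1) vanish_ops(5))
  qed
  have N1: "X \<otimes>\<^bsub>M\<^esub> Z \<in> N (Suc q)" if Z: "Z \<in> N q" for Z q
  proof (rule NI)
    show "X \<otimes>\<^bsub>M\<^esub> Z \<in> carrier M" by (rule M.m_closed[OF XM Nc[OF Z]])
    show "(X \<otimes>\<^bsub>M\<^esub> Z) i l c \<in> vanish (Suc q)" for i l c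
      unfolding M_def
      by (rule C.End_series_mult_in[OF NE(1)[OF XN] _ NE(1)[OF Z]],
        rule NE(2)[OF XN], rule NE(2)[OF Z], erule vanish_ops(4), rule vanish_ops(1), rule vanish_ops(2),
        erule (1) vanish_ops(3), erule (1) vanish_mult)
  qed
  have N_iff: "Z \<ominus>\<^bsub>M\<^esub> W \<in> N q \<longleftrightarrow> (\<forall>i j c. \<forall>p\<le>q. Z i j c p = W i j c p)"
    if ZW: "Z \<in> carrier M" "W \<in> carrier M" for Z W q
  proof -
    note cc = C.End_series_carrierD[OF ZW(1)[unfolded M_def]] C.End_series_carrierD[OF ZW(2)[unfolded M_def]]
    have "Z i j c \<ominus>\<^bsub>C\<^esub> W i j c \<in> vanish q \<longleftrightarrow> (\<forall>p\<le>q. Z i j c p = W i j c p)" for i j c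
      using C.minus_closed[OF cc(1)[of i j c] cc(2)[of i j c]] Q.minus_eq_zero_iff[OF completion_level[OF cc(1)] completion_level[OF cc(2)]]
      unfolding vanish_def by (auto simp: completion_minus[OF cc])
    then show ?thesis
      using M.minus_closed[OF ZW] C.End_series_minus[OF ZW[unfolded M_def]]
      unfolding N_def by (auto simp flip: M_def)
  qed
  \<comment> \<open>\<open>G q\<close> is 1 + X + ... + X^(q-1), written as a fixed point iteration
    so that consecutive differences gain one degree in each step.\<close>
  define G where "G q = ((\<lambda>Y. \<one>\<^bsub>M\<^esub> \<oplus>\<^bsub>M\<^esub> X \<otimes>\<^bsub>M\<^esub> Y) ^^ q) \<zero>\<^bsub>M\<^esub>" for q
  have G0: "G 0 = \<zero>\<^bsub>M\<^esub>" and GS: "G (Suc q) = \<one>\<^bsub>M\<^esub> \<oplus>\<^bsub>M\<^esub> X \<otimes>\<^bsub>M\<^esub> G q" for q by (simp_all add: G_def)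
  have Gc: "G q \<in> carrier M" for q
  proof (induction q)
    case 0 show ?case unfolding G0 by (rule M.zero_closed)
  next
    case (Suc q) then show ?case unfolding GS by (intro M.a_closed M.m_closed XM M.one_closed)
  qed
  have GX: "G q \<otimes>\<^bsub>M\<^esub> X = X \<otimes>\<^bsub>M\<^esub> G q" for q
  proof (induction q)
    case 0 show ?case unfolding G0 using XM M.l_null M.r_null by presburger
  next
    case (Suc q)
    have "G (Suc q) \<otimes>\<^bsub>M\<^esub> X = X \<oplus>\<^bsub>M\<^esub> X \<otimes>\<^bsub>M\<^esub> (G q \<otimes>\<^bsub>M\<^esub> X)"
      unfolding GS using XM Gc M.l_distr M.m_assoc M.l_one M.m_closed M.one_closed by presburger
    also have "\<dots> = X \<otimes>\<^bsub>M\<^esub> G (Suc q)"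
      unfolding Suc.IH unfolding GS using XM Gc M.r_distr M.r_one M.m_closed M.one_closed by presburger
    finally show ?case .
  qed
  have Gd: "G (Suc q) \<ominus>\<^bsub>M\<^esub> G q \<in> N q" for q
  proof (induction q)
    case 0 show ?case unfolding N0 using Gc M.minus_closed by blast
  next
    case (Suc q)
    have "G (Suc (Suc q)) \<ominus>\<^bsub>M\<^esub> G (Suc q) =
        (\<one>\<^bsub>M\<^esub> \<oplus>\<^bsub>M\<^esub> X \<otimes>\<^bsub>M\<^esub> G (Suc q)) \<ominus>\<^bsub>M\<^esub> (\<one>\<^bsub>M\<^esub> \<oplus>\<^bsub>M\<^esub> X \<otimes>\<^bsub>M\<^esub> G q)" by (simp only: GS[symmetric])
    also have "\<dots> = X \<otimes>\<^bsub>M\<^esub> (G (Suc q) \<ominus>\<^bsub>M\<^esub> G q)"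
    proof -
      have c: "X \<otimes>\<^bsub>M\<^esub> G (Suc q) \<in> carrier M" "X \<otimes>\<^bsub>M\<^esub> G q \<in> carrier M" using M.m_closed XM Gc by blast+
      show ?thesis
        unfolding M.add_minus_add_left[OF M.one_closed c] M.minus_distr(2)[OF XM Gc Gc] by (rule refl)
    qed
    finally show ?case using N1[OF Suc.IH] by simp
  qed
  have Gpq: "G q i j c p = G p i j c p" if "p \<le> q" for i j c p q
    using that
  proof (induction q rule: dec_induct)
    case (step q)
    have "G (Suc q) i j c p = G q i j c p" using N_iff[OF Gc Gc] Gd step by blast
    then show ?case using step by simp
  qed simp
  \<comment> \<open>The limit is taken diagonally: level \<open>p\<close> of the partial sums is
    constant from \<open>G p\<close> on.\<close>
  define S where "S = (\<lambda>i j c p. G p i j c p)"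
  have S: "S \<in> carrier M"
  proof -
    have "S i j c \<in> carrier C" for i j c
      unfolding completion_carrier
    proof
      fix p
      obtain a where "a \<in> carrier A" "\<And>q. q \<le> p \<Longrightarrow> G p i j c q = F q +> a"
        using completion_rep[OF C.End_series_carrierD[OF Gc[unfolded M_def]]] by metis
      then show "\<exists>a\<in>carrier A. \<forall>q\<le>p. S i j c q = F q +> a"
        unfolding S_def using Gpq by metis
    qed
    moreover have "S i j = \<zero>\<^bsub>power_series C\<^esub>" if "i \<notin> idx m n \<or> j \<notin> idx m n" for i j
    proof -
      have "G p i j = \<zero>\<^bsub>power_series C\<^esub>" for p
        using P.End_carrierD(2,3)[OF Gc[unfolded M_def]] that by blast
      then show ?thesis unfolding S_def by (simp add: fun_eq_iff)
    qed
    ultimately show ?thesis unfolding M_def by (intro P.End_carrierI) (auto simp del: completion_simps)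
  qed
  have SG: "S \<ominus>\<^bsub>M\<^esub> G p \<in> N p" for p
    unfolding N_iff[OF S Gc] unfolding S_def using Gpq by metis
  let ?T = "\<one>\<^bsub>M\<^esub> \<ominus>\<^bsub>M\<^esub> X"
  have T: "?T \<in> carrier M" using XM M.minus_closed M.one_closed by blast
  have TG: "?T \<otimes>\<^bsub>M\<^esub> G p \<ominus>\<^bsub>M\<^esub> \<one>\<^bsub>M\<^esub> \<in> N p" "G p \<otimes>\<^bsub>M\<^esub> ?T \<ominus>\<^bsub>M\<^esub> \<one>\<^bsub>M\<^esub> \<in> N p" for p
  proof -
    have XG: "X \<otimes>\<^bsub>M\<^esub> G p \<in> carrier M" using M.m_closed XM Gc by blast
    have "?T \<otimes>\<^bsub>M\<^esub> G p = G p \<ominus>\<^bsub>M\<^esub> X \<otimes>\<^bsub>M\<^esub> G p" "G p \<otimes>\<^bsub>M\<^esub> ?T = G p \<ominus>\<^bsub>M\<^esub> X \<otimes>\<^bsub>M\<^esub> G p"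
      unfolding M.minus_distr(1)[OF Gc M.one_closed XM] M.minus_distr(2)[OF Gc M.one_closed XM]
        M.l_one[OF Gc] M.r_one[OF Gc] GX by (rule refl)+
    \<comment> \<open>The defect of \<open>G p\<close> as an inverse is the negative of the next
      difference, which lies in \<open>N p\<close>.\<close>
    moreover have "G p \<ominus>\<^bsub>M\<^esub> X \<otimes>\<^bsub>M\<^esub> G p \<ominus>\<^bsub>M\<^esub> \<one>\<^bsub>M\<^esub> \<in> N p"
    proof -
      have "G p \<ominus>\<^bsub>M\<^esub> X \<otimes>\<^bsub>M\<^esub> G p \<ominus>\<^bsub>M\<^esub> \<one>\<^bsub>M\<^esub> = \<ominus>\<^bsub>M\<^esub> (G (Suc p) \<ominus>\<^bsub>M\<^esub> G p)"
        unfolding GS by (rule M.minus_minus_swap[OF M.one_closed Gc XG])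
      also have "\<dots> = (\<ominus>\<^bsub>M\<^esub> \<one>\<^bsub>M\<^esub>) \<otimes>\<^bsub>M\<^esub> (G (Suc p) \<ominus>\<^bsub>M\<^esub> G p)"
        using Nc[OF Gd] by (metis M.l_minus M.l_one M.one_closed)
      finally show ?thesis using Nl[OF Gd] M.one_closed M.a_inv_closed by metis
    qed
    ultimately show "?T \<otimes>\<^bsub>M\<^esub> G p \<ominus>\<^bsub>M\<^esub> \<one>\<^bsub>M\<^esub> \<in> N p" "G p \<otimes>\<^bsub>M\<^esub> ?T \<ominus>\<^bsub>M\<^esub> \<one>\<^bsub>M\<^esub> \<in> N p" by simp_all
  qed
  have eqI: "Z = \<one>\<^bsub>M\<^esub>" if Z: "Z \<in> carrier M" "\<And>p. \<exists>W\<in>carrier M. Z \<ominus>\<^bsub>M\<^esub> W \<in> N p \<and> W \<ominus>\<^bsub>M\<^esub> \<one>\<^bsub>M\<^esub> \<in> N p" for Z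
  proof (intro ext)
    fix i j c p
    obtain W where W: "W \<in> carrier M" "Z \<ominus>\<^bsub>M\<^esub> W \<in> N p" "W \<ominus>\<^bsub>M\<^esub> \<one>\<^bsub>M\<^esub> \<in> N p" using Z(2) by blast
    then show "Z i j c p = \<one>\<^bsub>M\<^esub> i j c p"
      using N_iff[OF Z(1) W(1)] N_iff[OF W(1) M.one_closed] by (metis order_refl)
  qed
  have "?T \<otimes>\<^bsub>M\<^esub> S = \<one>\<^bsub>M\<^esub>"
  proof (rule eqI)
    fix p
    have "?T \<otimes>\<^bsub>M\<^esub> S \<ominus>\<^bsub>M\<^esub> ?T \<otimes>\<^bsub>M\<^esub> G p = ?T \<otimes>\<^bsub>M\<^esub> (S \<ominus>\<^bsub>M\<^esub> G p)"
      by (rule M.minus_distr(2)[OF T S Gc, symmetric])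
    then show "\<exists>W\<in>carrier M. ?T \<otimes>\<^bsub>M\<^esub> S \<ominus>\<^bsub>M\<^esub> W \<in> N p \<and> W \<ominus>\<^bsub>M\<^esub> \<one>\<^bsub>M\<^esub> \<in> N p"
      using TG(1) Nl[OF SG T] M.m_closed[OF T Gc] by metis
  qed (use M.m_closed T S in blast)
  moreover have "S \<otimes>\<^bsub>M\<^esub> ?T = \<one>\<^bsub>M\<^esub>"
  proof (rule eqI)
    fix p
    have "S \<otimes>\<^bsub>M\<^esub> ?T \<ominus>\<^bsub>M\<^esub> G p \<otimes>\<^bsub>M\<^esub> ?T = (S \<ominus>\<^bsub>M\<^esub> G p) \<otimes>\<^bsub>M\<^esub> ?T"
      by (rule M.minus_distr(1)[OF T S Gc, symmetric])
    then show "\<exists>W\<in>carrier M. S \<otimes>\<^bsub>M\<^esub> ?T \<ominus>\<^bsub>M\<^esub> W \<in> N p \<and> W \<ominus>\<^bsub>M\<^esub> \<one>\<^bsub>M\<^esub> \<in> N p"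
      using TG(2) Nr[OF SG T] M.m_closed[OF Gc T] by metis
  qed (use M.m_closed T S in blast)
  ultimately show ?thesis using S by blast
qed

end

section \<open>Solutions of the defining relation and their fusion\<close>

lemma sg_cong: "even a = even b \<Longrightarrow> (-1::'r::ring_1) ^ a = (-1) ^ b"
  by (simp add: minus_one_power_iff)

lemma sg_left_commute: "x * ((-1::'r::ring_1) ^ k * y) = (-1) ^ k * (x * y)"
  by (simp add: minus_one_power_iff)

lemma central_left_commute:
  fixes c :: "'r::ring_1"
  assumes "\<And>x. c * x = x * c"
  shows "x * (c * y) = c * (x * y)"
proof -
  have "x * (c * y) = (x * c) * y" by (simp only: mult.assoc)
  also have "\<dots> = c * (x * y)" by (simp only: assms[symmetric] mult.assoc)
  finally show ?thesis .
qed

lemma sum_rotate: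
  "(\<Sum>j\<in>A. \<Sum>a\<in>B. \<Sum>b\<in>C a. f j a b) = (\<Sum>a\<in>B. \<Sum>b\<in>C a. \<Sum>j\<in>A. (f j a b :: 'r::comm_monoid_add))"
proof -
  have "(\<Sum>j\<in>A. \<Sum>a\<in>B. \<Sum>b\<in>C a. f j a b) = (\<Sum>a\<in>B. \<Sum>j\<in>A. \<Sum>b\<in>C a. f j a b)"
    by (rule sum.swap)
  also have "\<dots> = (\<Sum>a\<in>B. \<Sum>b\<in>C a. \<Sum>j\<in>A. f j a b)"
    by (intro sum.cong refl sum.swap)
  finally show ?thesis .
qed

definition rhom :: "('r::ring_1 \<Rightarrow> 's::ring_1) \<Rightarrow> bool" where
  "rhom h \<longleftrightarrow> h 1 = 1 \<and> (\<forall>x y. h (x + y) = h x + h y) \<and> (\<forall>x y. h (x * y) = h x * h y)"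

lemma rhomD:
  assumes "rhom h"
  shows "h 1 = 1" "h (x + y) = h x + h y" "h (x * y) = h x * h y" "h 0 = 0" "h (- x) = - h x"
    "h (x - y) = h x - h y" "h ((-1) ^ k) = (-1) ^ k" "h (sum f S) = (\<Sum>i\<in>S. h (f i))" "h (x ^ k) = h x ^ k"
    "h (of_int i) = of_int i"
proof -
  show 1: "h 1 = 1" and a: "h (x + y) = h x + h y" and mm: "h (x * y) = h x * h y" for x y
    using assms unfolding rhom_def by blast+
  show z: "h 0 = 0" using a[of 0 0] by simp
  show n: "h (- x) = - h x" for x using a[of x "- x"] z by (simp add: eq_neg_iff_add_eq_0 add.commute)
  show "h (x - y) = h x - h y" using a[of x "- y"] n by simp
  show "h ((-1) ^ k) = (-1) ^ k" by (simp add: minus_one_power_iff 1 n)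
  show "h (sum f S) = (\<Sum>i\<in>S. h (f i))"
    by (induction S rule: infinite_finite_induct) (simp_all add: z a)
  show "h (x ^ k) = h x ^ k" by (induction k) (simp_all add: 1 mm)
  have "h (of_nat k) = of_nat k" for k by (induction k) (simp_all add: z a 1)
  then show "h (of_int i) = of_int i" by (cases i) (simp_all add: n a 1 del: of_nat_Suc)
qed

definition fps_map :: "('r \<Rightarrow> 's) \<Rightarrow> 'r fps \<Rightarrow> 's fps" where
  "fps_map h f = Abs_fps (\<lambda>k. h (f $ k))"

lemma fps_map_nth [simp]: "fps_map h f $ k = h (f $ k)"
  by (simp add: fps_map_def)

lemma rhom_fps_map: "rhom h \<Longrightarrow> rhom (fps_map h)"
  unfolding rhom_def[of "fps_map h"]
  by (auto simp: fps_eq_iff rhomD fps_mult_nth)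

lemma rhom_fps_const: "rhom fps_const"
  by (auto simp: rhom_def)

lemma fps_map_const: "rhom h \<Longrightarrow> fps_map h (fps_const x) = fps_const (h x)"
  by (auto simp: fps_eq_iff rhomD)

lemma fps_map_X: "rhom h \<Longrightarrow> fps_map h fps_X = fps_X"
  by (auto simp: fps_eq_iff rhomD fps_X_def)

text \<open>
  The defining relation for \<open>a\<^sub>i\<^sub>j = t\<^sub>i\<^sub>j\<^sup>+(u)\<close>, \<open>b\<^sub>i\<^sub>j = t\<^sub>i\<^sub>j\<^sup>+(v)\<close> and \<open>w = u - v\<close>. The
  entries of \<open>T\<^sup>+(u)\<close> differ from the \<open>a\<^sub>i\<^sub>j\<close> by the signs in \<open>RTT_sign_change\<close> below. It is
  arranged such that the terms on either side are obtained from the first one by exchanging \<open>i\<close>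
  with \<open>k\<close> or \<open>j\<close> with \<open>l\<close>, which is what the proof for products needs.
\<close>

definition RTT :: "nat \<Rightarrow> nat \<Rightarrow> 'r::ring_1 \<Rightarrow> (nat \<Rightarrow> nat \<Rightarrow> 'r) \<Rightarrow> (nat \<Rightarrow> nat \<Rightarrow> 'r) \<Rightarrow> bool" where
  "RTT m n w a b \<longleftrightarrow> (\<forall>i\<in>idx m n. \<forall>j\<in>idx m n. \<forall>k\<in>idx m n. \<forall>l\<in>idx m n.
     (-1) ^ ((par m i + par m j) * (par m k + par m l)) * (w * (a i j * b k l)) -
     (-1) ^ (par m i * par m j + par m i * par m l + par m j * par m l) * (a k j * b i l) =
     w * (b k l * a i j) -
     (-1) ^ (par m i * par m j + par m i * par m l + par m j * par m l) * (b k j * a i l))"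

lemma RTTD:
  assumes "RTT m n w a b" "i \<in> idx m n" "j \<in> idx m n" "k \<in> idx m n" "l \<in> idx m n"
  shows "(-1) ^ ((par m i + par m j) * (par m k + par m l)) * (w * (a i j * b k l)) -
     (-1) ^ (par m i * par m j + par m i * par m l + par m j * par m l) * (a k j * b i l) =
     w * (b k l * a i j) -
     (-1) ^ (par m i * par m j + par m i * par m l + par m j * par m l) * (b k j * a i l)"
  using assms unfolding RTT_def by blast

text \<open>The coproduct argument. With R = w - P, primes for the second solution, and indices for
  the copies of End, it reads R T1 T1' T2 T2' = R T1 T2 T1' T2' = T2 T1 R T1' T2' = T2 T1 T2' T1' R
  = T2 T2' T1 T1' R. The first and the last step use that entries of the two solutions supercommute,
  the middle ones are the two given relations.\<close>

lemma RTT_product: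
  fixes w :: "'r::ring_1"
  assumes 1: "RTT m n w a b" and 2: "RTT m n w a' b'"
    and w: "\<And>x. w * x = x * w"
    and ab: "\<And>i j k l. i \<in> idx m n \<Longrightarrow> j \<in> idx m n \<Longrightarrow> k \<in> idx m n \<Longrightarrow> l \<in> idx m n \<Longrightarrow>
      a' i j * b k l = (-1) ^ ((par m i + par m j) * (par m k + par m l)) * (b k l * a' i j)"
    and ba: "\<And>i j k l. i \<in> idx m n \<Longrightarrow> j \<in> idx m n \<Longrightarrow> k \<in> idx m n \<Longrightarrow> l \<in> idx m n \<Longrightarrow>
      b' i j * a k l = (-1) ^ ((par m i + par m j) * (par m k + par m l)) * (a k l * b' i j)"
  shows "RTT m n w (\<lambda>i j. \<Sum>x\<in>idx m n. a i x * a' x j) (\<lambda>i j. \<Sum>x\<in>idx m n. b i x * b' x j)"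
  unfolding RTT_def
proof (intro ballI)
  let ?I = "idx m n" and ?p = "par m" and ?s = "\<lambda>k. (-1::'r) ^ k"
  fix i j k l assume ind: "i \<in> ?I" "j \<in> ?I" "k \<in> ?I" "l \<in> ?I"
  have w2: "x * (w * y) = w * (x * y)" for x y by (rule central_left_commute[OF w])
  \<comment> \<open>In \<open>AB\<close> and \<open>BA\<close> the entries of the first solution are
    moved to the front, at the cost of Koszul signs.\<close>
  have AB: "(\<Sum>x\<in>?I. a i x * a' x j) * (\<Sum>y\<in>?I. b k y * b' y l) =
     (\<Sum>x\<in>?I. \<Sum>y\<in>?I. ?s ((?p x + ?p j) * (?p k + ?p y)) * (a i x * b k y * (a' x j * b' y l)))"
    if "i \<in> ?I" "k \<in> ?I" for i k
    unfolding sum_product using that ind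
    by (intro sum.cong refl) (simp add: mult.assoc ab[THEN arg_cong[where f = "\<lambda>z. z * _"], unfolded mult.assoc] sg_left_commute)
  have BA: "(\<Sum>y\<in>?I. b k y * b' y l) * (\<Sum>x\<in>?I. a i x * a' x j) =
     (\<Sum>x\<in>?I. \<Sum>y\<in>?I. ?s ((?p y + ?p l) * (?p i + ?p x)) * (b k y * a i x * (b' y l * a' x j)))"
    if "l \<in> ?I" "j \<in> ?I" for l j
    unfolding sum_product using that ind
    by (subst sum.swap, intro sum.cong refl)
      (simp add: mult.assoc ba[THEN arg_cong[where f = "\<lambda>z. z * _"], unfolded mult.assoc] sg_left_commute)
  let ?q = "\<lambda>i j l. ?p i * ?p j + ?p i * ?p l + ?p j * ?p l"
  have "?s ((?p i + ?p j) * (?p k + ?p l)) * (w * ((\<Sum>x\<in>?I. a i x * a' x j) * (\<Sum>y\<in>?I. b k y * b' y l))) -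
     ?s (?q i j l) * ((\<Sum>x\<in>?I. a k x * a' x j) * (\<Sum>y\<in>?I. b i y * b' y l)) =
    (\<Sum>x\<in>?I. \<Sum>y\<in>?I. 
      ?s ((?p i + ?p j) * (?p k + ?p l)) * (w * (?s ((?p x + ?p j) * (?p k + ?p y)) * (a i x * b k y * (a' x j * b' y l)))) -
      ?s (?q i j l) * (?s ((?p x + ?p j) * (?p i + ?p y)) * (a k x * b i y * (a' x j * b' y l))))"
    unfolding AB[OF ind(1,3)] AB[OF ind(3,1)] by (simp only: sum_distrib_left sum_subtractf)
  also have "\<dots> = (\<Sum>x\<in>?I. \<Sum>y\<in>?I. ?s ((?p i + ?p j) * (?p l + ?p y)) * (w * (b k y * a i x * (a' x j * b' y l))) -
      ?s ((?p i + ?p j) * (?p l + ?p y) + ?q i x y) * (b k x * a i y * (a' x j * b' y l)))"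
  proof (intro sum.cong refl)
    fix x y assume xy: "x \<in> ?I" "y \<in> ?I"
    \<comment> \<open>A common sign is factored out of both terms, so that what remains is the first
      relation at the indices \<open>i x k y\<close>.\<close>
    have s1: "?s ((?p i + ?p j) * (?p k + ?p l)) * ?s ((?p x + ?p j) * (?p k + ?p y)) =
        ?s ((?p i + ?p j) * (?p l + ?p y)) * ?s ((?p i + ?p x) * (?p k + ?p y))"
      unfolding power_add[symmetric] by (rule sg_cong) auto
    have s2: "?s (?q i j l) * ?s ((?p x + ?p j) * (?p i + ?p y)) =
        ?s ((?p i + ?p j) * (?p l + ?p y)) * ?s (?q i x y)"
      unfolding power_add[symmetric] by (rule sg_cong) auto
    have "?s ((?p i + ?p j) * (?p k + ?p l)) * (w * (?s ((?p x + ?p j) * (?p k + ?p y)) * (a i x * b k y * (a' x j * b' y l)))) -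
      ?s (?q i j l) * (?s ((?p x + ?p j) * (?p i + ?p y)) * (a k x * b i y * (a' x j * b' y l))) =
      (?s ((?p i + ?p j) * (?p k + ?p l)) * ?s ((?p x + ?p j) * (?p k + ?p y))) * (w * (a i x * b k y)) * (a' x j * b' y l) -
      (?s (?q i j l) * ?s ((?p x + ?p j) * (?p i + ?p y))) * (a k x * b i y) * (a' x j * b' y l)"
      by (simp only: mult.assoc sg_left_commute[of w])
    also have "\<dots> = ?s ((?p i + ?p j) * (?p l + ?p y)) *
       (?s ((?p i + ?p x) * (?p k + ?p y)) * (w * (a i x * b k y)) - ?s (?q i x y) * (a k x * b i y)) * (a' x j * b' y l)"
      unfolding s1 s2 by (simp add: algebra_simps)
    also have "\<dots> = ?s ((?p i + ?p j) * (?p l + ?p y)) *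
       (w * (b k y * a i x) - ?s (?q i x y) * (b k x * a i y)) * (a' x j * b' y l)"
      unfolding RTTD[OF 1 ind(1) xy(1) ind(3) xy(2)] by (rule refl)
    finally show "?s ((?p i + ?p j) * (?p k + ?p l)) * (w * (?s ((?p x + ?p j) * (?p k + ?p y)) * (a i x * b k y * (a' x j * b' y l)))) -
      ?s (?q i j l) * (?s ((?p x + ?p j) * (?p i + ?p y)) * (a k x * b i y * (a' x j * b' y l))) =
      ?s ((?p i + ?p j) * (?p l + ?p y)) * (w * (b k y * a i x * (a' x j * b' y l))) -
      ?s ((?p i + ?p j) * (?p l + ?p y) + ?q i x y) * (b k x * a i y * (a' x j * b' y l))"
      by (simp only: left_diff_distrib right_diff_distrib power_add mult.assoc)
  qed
  also have "\<dots> = (\<Sum>x\<in>?I. \<Sum>y\<in>?I. ?s ((?p i + ?p j) * (?p l + ?p y)) * (w * (b k y * a i x * (a' x j * b' y l)))) -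
      (\<Sum>x\<in>?I. \<Sum>y\<in>?I. ?s ((?p i + ?p j) * (?p l + ?p y) + ?q i x y) * (b k x * a i y * (a' x j * b' y l)))"
    by (simp only: sum_subtractf)
  \<comment> \<open>Exchanging \<open>x\<close> and \<open>y\<close> in the second sum gives both
    terms the left factor \<open>b k y * a i x\<close>, after which the second relation
    applies.\<close>
  also have "(\<Sum>x\<in>?I. \<Sum>y\<in>?I. ?s ((?p i + ?p j) * (?p l + ?p y) + ?q i x y) * (b k x * a i y * (a' x j * b' y l))) =
      (\<Sum>x\<in>?I. \<Sum>y\<in>?I. ?s ((?p i + ?p j) * (?p l + ?p x) + ?q i y x) * (b k y * a i x * (a' y j * b' x l)))"
    by (rule sum.swap)
  also have "(\<Sum>x\<in>?I. \<Sum>y\<in>?I. ?s ((?p i + ?p j) * (?p l + ?p y)) * (w * (b k y * a i x * (a' x j * b' y l)))) - \<dots> =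
      (\<Sum>x\<in>?I. \<Sum>y\<in>?I. 
       w * (?s ((?p y + ?p l) * (?p i + ?p x)) * (b k y * a i x * (b' y l * a' x j))) -
       ?s (?q i j l) * (?s ((?p y + ?p j) * (?p i + ?p x)) * (b k y * a i x * (b' y j * a' x l))))"
    unfolding sum_subtractf[symmetric]
  proof (intro sum.cong refl)
    fix x y assume xy: "x \<in> ?I" "y \<in> ?I"
    let ?r = "?s ((?p i + ?p x) * (?p l + ?p y))" and ?ba = "b k y * a i x"
    have s1: "?s ((?p i + ?p j) * (?p l + ?p y)) = ?r * ?s ((?p x + ?p j) * (?p y + ?p l))"
      unfolding power_add[symmetric] by (rule sg_cong) auto
    have s2: "?s ((?p i + ?p j) * (?p l + ?p x) + ?q i y x) = ?r * ?s (?q x j l)"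
      unfolding power_add[symmetric] by (rule sg_cong) auto
    have s3: "?s ((?p y + ?p l) * (?p i + ?p x)) = ?r" by (rule sg_cong) auto
    have s4: "?s (?q i j l) * ?s ((?p y + ?p j) * (?p i + ?p x)) = ?r * ?s (?q x j l)"
      unfolding power_add[symmetric] by (rule sg_cong) auto
    have "?s ((?p i + ?p j) * (?p l + ?p y)) * (w * (?ba * (a' x j * b' y l))) -
        ?s ((?p i + ?p j) * (?p l + ?p x) + ?q i y x) * (?ba * (a' y j * b' x l)) =
      ?r * (?ba * (?s ((?p x + ?p j) * (?p y + ?p l)) * (w * (a' x j * b' y l)) - ?s (?q x j l) * (a' y j * b' x l)))"
      unfolding s1 s2 by (simp only: right_diff_distrib mult.assoc sg_left_commute[of "b k y"] sg_left_commute[of "a i x"] w2)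
    also have "\<dots> = ?r * (?ba * (w * (b' y l * a' x j) - ?s (?q x j l) * (b' y j * a' x l)))"
      unfolding RTTD[OF 2 xy(1) ind(2) xy(2) ind(4)] by (rule refl)
    also have "\<dots> = w * (?r * (?ba * (b' y l * a' x j))) - (?r * ?s (?q x j l)) * (?ba * (b' y j * a' x l))"
      by (simp only: right_diff_distrib mult.assoc sg_left_commute[of "b k y"] sg_left_commute[of "a i x"] w2)
    also have "\<dots> = w * (?s ((?p y + ?p l) * (?p i + ?p x)) * (?ba * (b' y l * a' x j))) -
       ?s (?q i j l) * (?s ((?p y + ?p j) * (?p i + ?p x)) * (?ba * (b' y j * a' x l)))"
      unfolding s3 s4[symmetric] by (simp only: mult.assoc)
    finally show "?s ((?p i + ?p j) * (?p l + ?p y)) * (w * (?ba * (a' x j * b' y l))) -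
        ?s ((?p i + ?p j) * (?p l + ?p x) + ?q i y x) * (?ba * (a' y j * b' x l)) =
      w * (?s ((?p y + ?p l) * (?p i + ?p x)) * (?ba * (b' y l * a' x j))) -
       ?s (?q i j l) * (?s ((?p y + ?p j) * (?p i + ?p x)) * (?ba * (b' y j * a' x l)))" .
  qed
  also have "\<dots> = w * ((\<Sum>y\<in>?I. b k y * b' y l) * (\<Sum>x\<in>?I. a i x * a' x j)) -
     ?s (?q i j l) * ((\<Sum>y\<in>?I. b k y * b' y j) * (\<Sum>x\<in>?I. a i x * a' x l))"
    unfolding BA[OF ind(4,2)] BA[OF ind(2,4)] by (simp only: sum_distrib_left sum_subtractf)
  finally show "?s ((?p i + ?p j) * (?p k + ?p l)) * (w * ((\<Sum>x\<in>?I. a i x * a' x j) * (\<Sum>y\<in>?I. b k y * b' y l))) -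
     ?s (?q i j l) * ((\<Sum>x\<in>?I. a k x * a' x j) * (\<Sum>y\<in>?I. b i y * b' y l)) =
     w * ((\<Sum>y\<in>?I. b k y * b' y l) * (\<Sum>x\<in>?I. a i x * a' x j)) -
     ?s (?q i j l) * ((\<Sum>y\<in>?I. b k y * b' y j) * (\<Sum>x\<in>?I. a i x * a' x l))" .
qed


text \<open>\<open>E\<close> are the matrix units of one tensor factor, and \<open>sh\<close> moves
  an operator to the remaining factors. Keeping both inside one ring lets the number of factors grow
  by iteration, since the type cannot depend on it.\<close>

locale fusion_ring =
  fixes m n :: nat and E :: "nat \<Rightarrow> nat \<Rightarrow> 'r::ring_1" and sh :: "'r \<Rightarrow> 'r"
  assumes E_mult: "i \<in> idx m n \<Longrightarrow> j \<in> idx m n \<Longrightarrow> k \<in> idx m n \<Longrightarrow> l \<in> idx m n \<Longrightarrow>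
      E i j * E k l = (if j = k then E i l else 0)"
    and E_sum: "(\<Sum>i\<in>idx m n. E i i) = 1"
    and rhom_sh: "rhom sh"
    and sh_E: "i \<in> idx m n \<Longrightarrow> j \<in> idx m n \<Longrightarrow> sh x * E i j = E i j * sh x"
begin

abbreviation "I \<equiv> idx m n"
abbreviation "p \<equiv> par m"

text \<open>The parity operator of the first tensor factor; conjugation by it is the grading on the
  matrix units \<open>E\<close>.\<close>

definition G :: 'r where
  "G = (\<Sum>i\<in>I. (-1) ^ p i * E i i)"

lemma G_E: "i \<in> I \<Longrightarrow> j \<in> I \<Longrightarrow> G * E i j = (-1) ^ p i * E i j"
  by (simp add: G_def sum_distrib_right mult.assoc E_mult if_distrib[where f = "(*) _"] cong: if_cong)

lemma E_G: "i \<in> I \<Longrightarrow> j \<in> I \<Longrightarrow> E i j * G = (-1) ^ p j * E i j"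
  by (simp add: G_def sum_distrib_left sg_left_commute E_mult if_distrib[where f = "(*) _"] cong: if_cong)

lemma G_G: "G * G = 1"
proof -
  have "G * G = G * (\<Sum>i\<in>I. (-1) ^ p i * E i i)" by (simp only: G_def)
  also have "\<dots> = (\<Sum>i\<in>I. (-1) ^ p i * (G * E i i))"
    by (simp only: sum_distrib_left sg_left_commute[of G])
  also have "\<dots> = (\<Sum>i\<in>I. E i i)"
    by (intro sum.cong refl) (simp add: G_E mult.assoc[symmetric] power_add[symmetric])
  finally show ?thesis by (simp add: E_sum)
qed

lemma sh_G: "sh x * G = G * sh x"
  unfolding G_def sum_distrib_left sum_distrib_right
  by (intro sum.cong refl) (simp add: sg_left_commute sh_E mult.assoc)

lemma G_power: "G ^ k = (if even k then 1 else G)"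
  by (induction k) (auto simp: G_G)

lemma G_power_cong: "even k = even l \<Longrightarrow> G ^ k = G ^ l"
  by (simp add: G_power)

lemma sh_G_power: "sh x * G ^ k = G ^ k * sh x"
  by (simp add: G_power sh_G)

lemma G_power_E: "i \<in> I \<Longrightarrow> j \<in> I \<Longrightarrow> G ^ k * E i j = (-1) ^ (k * (p i + p j)) * (E i j * G ^ k)"
  by (auto simp: G_power G_E E_G minus_one_power_iff)

text \<open>The image of t_ij^+(u) when the generator matrix is sent to R(u - a), with c = -1/(u -
  a). The sign (-1)^(p j) of \<open>P\<close> cancels against the same sign in the definition of
  T^+(u), which leaves (-1)^(p i * p j).\<close>

definition vec :: "'r \<Rightarrow> nat \<Rightarrow> nat \<Rightarrow> 'r" where
  "vec c i j = (if i = j then 1 else 0) + (-1) ^ (p i * p j) * (c * E j i)"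

text \<open>Operators on the other factors supercommute with the entries of \<open>vec\<close> once
  they carry the power of \<open>G\<close> that matches their parity.\<close>

lemma vec_twist:
  assumes "\<And>x. c * x = x * c" "i \<in> I" "j \<in> I"
  shows "G ^ k * sh x * vec c i j = (-1) ^ (k * (p i + p j)) * (vec c i j * (G ^ k * sh x))"
proof -
  have "G ^ k * sh x * (c * E j i) = c * (G ^ k * (sh x * E j i))"
    by (simp only: central_left_commute[of c, OF assms(1)] mult.assoc)
  also have "\<dots> = c * (G ^ k * E j i * sh x)"
    by (simp add: sh_E assms mult.assoc)
  also have "\<dots> = (-1) ^ (k * (p i + p j)) * (c * E j i * (G ^ k * sh x))"
    by (simp add: G_power_E assms mult.assoc sg_left_commute add.commute)
  finally show ?thesis
    unfolding vec_def by (auto simp: distrib_left distrib_right minus_one_power_iff)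
qed

lemma vec_mult:
  assumes c: "\<And>x. c * x = x * c" and d: "\<And>x. d * x = x * d" and ind: "i \<in> I" "j \<in> I" "k \<in> I" "l \<in> I"
  shows "vec c i j * vec d k l = (if i = j \<and> k = l then 1 else 0) +
     (if i = j then (-1) ^ (p k * p l) * (d * E l k) else 0) +
     (if k = l then (-1) ^ (p i * p j) * (c * E j i) else 0) +
     (if i = l then (-1) ^ (p i * p j + p k * p l) * (c * d * E j k) else 0)"
proof -
  have "E j i * (d * E l k) = d * (if i = l then E j k else 0)"
    unfolding central_left_commute[of d, OF d] by (simp add: E_mult ind)
  then have "c * E j i * (d * E l k) = (if i = l then c * d * E j k else 0)"
    by (simp add: mult.assoc)
  then show ?thesis
    unfolding vec_def by (auto simp: distrib_left distrib_right minus_one_power_iff mult.assoc)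
qed

text \<open>An instance of the Yang-Baxter equation. For c = -1/(u - a), d = -1/(v - a) and w = u -
  v the last hypothesis is a partial fraction identity, put in a form without division because u - v
  is not invertible among power series.\<close>

lemma RTT_vec:
  assumes c: "\<And>x. c * x = x * c" and d: "\<And>x. d * x = x * d" and w: "w * (c * d) = c - d"
  shows "RTT m n w (vec c) (vec d)"
  unfolding RTT_def
proof (intro ballI)
  fix i j k l assume ind: "i \<in> I" "j \<in> I" "k \<in> I" "l \<in> I"
  have dc: "d * c = c * d" by (rule d)
  have w': "w * (c * (d * x)) = c * x - d * x" for x
    using arg_cong[OF w, of "\<lambda>y. y * x"] by (simp only: mult.assoc left_diff_distrib)
  show "(-1) ^ ((p i + p j) * (p k + p l)) * (w * (vec c i j * vec d k l)) -
     (-1) ^ (p i * p j + p i * p l + p j * p l) * (vec c k j * vec d i l) =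
     w * (vec d k l * vec c i j) -
     (-1) ^ (p i * p j + p i * p l + p j * p l) * (vec d k j * vec c i l)"
    unfolding vec_mult[OF c d ind] vec_mult[OF c d ind(3,2,1,4)] vec_mult[OF d c ind(3,4,1,2)] vec_mult[OF d c ind(3,2,1,4)] dc
    by (auto simp: minus_one_power_iff algebra_simps w')
qed

text \<open>
  The coproduct of the vector representation with \<open>t\<close>. The powers of the parity operator \<open>G\<close>
  supply the signs of the tensor product of superalgebras.
\<close>

definition fuse :: "'r \<Rightarrow> (nat \<Rightarrow> nat \<Rightarrow> 'r) \<Rightarrow> nat \<Rightarrow> nat \<Rightarrow> 'r" where
  "fuse c t i j = (\<Sum>a\<in>I. vec c i a * (G ^ (p a + p j) * sh (t a j)))"

lemma twisted_mult: "(G ^ r * sh x) * (G ^ s * sh y) = G ^ (r + s) * sh (x * y)"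
proof -
  have "(G ^ r * sh x) * (G ^ s * sh y) = G ^ r * ((sh x * G ^ s) * sh y)" by (simp only: mult.assoc)
  also have "\<dots> = G ^ (r + s) * sh (x * y)" by (simp only: sh_G_power rhomD(3)[OF rhom_sh] mult.assoc power_add)
  finally show ?thesis .
qed

text \<open>All four products carry the same total power of \<open>G\<close>, and this power
  commutes with the image of \<open>sh\<close>, so the relation is merely multiplied by it.\<close>

lemma RTT_sh:
  assumes "RTT m n w a b" "\<And>x. w * x = x * w" "sh w = w"
  shows "RTT m n w (\<lambda>i j. G ^ (p i + p j) * sh (a i j)) (\<lambda>i j. G ^ (p i + p j) * sh (b i j))"
  unfolding RTT_def
proof (intro ballI)
  fix i j k l assume ind: "i \<in> I" "j \<in> I" "k \<in> I" "l \<in> I"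
  let ?g = "G ^ (p i + p j + (p k + p l))"
  have m: "(G ^ r * sh x) * (G ^ s * sh y) = G ^ (r + s) * sh (x * y)" for r s x y
    by (rule twisted_mult)
  have g: "G ^ (p k + p j + (p i + p l)) = ?g" "G ^ (p k + p l + (p i + p j)) = ?g"
    by (simp_all add: add_ac)
  have w: "x * (w * y) = w * (x * y)" for x y by (rule central_left_commute[OF assms(2)])
  note e = RTTD[OF assms(1) ind, THEN arg_cong[where f = "\<lambda>x. ?g * sh x"]]
  show "(-1) ^ ((p i + p j) * (p k + p l)) * (w * ((G ^ (p i + p j) * sh (a i j)) * (G ^ (p k + p l) * sh (b k l)))) -
     (-1) ^ (p i * p j + p i * p l + p j * p l) * ((G ^ (p k + p j) * sh (a k j)) * (G ^ (p i + p l) * sh (b i l))) =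
     w * ((G ^ (p k + p l) * sh (b k l)) * (G ^ (p i + p j) * sh (a i j))) -
     (-1) ^ (p i * p j + p i * p l + p j * p l) * ((G ^ (p k + p j) * sh (b k j)) * (G ^ (p i + p l) * sh (a i l)))"
    using e unfolding m g
    by (simp only: rhomD(3,6,7)[OF rhom_sh] assms(3) right_diff_distrib sg_left_commute[of ?g] w[of ?g])
qed

lemma RTT_fuse:
  assumes c: "\<And>x. c * x = x * c" and d: "\<And>x. d * x = x * d" and w: "w * (c * d) = c - d"
    and wc: "\<And>x. w * x = x * w" "sh w = w" and t: "RTT m n w a b"
  shows "RTT m n w (fuse c a) (fuse d b)"
  unfolding fuse_def
  by (rule RTT_product[OF RTT_vec[OF c d w] RTT_sh[OF t wc] wc(1)])
    (simp_all add: vec_twist c d)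

text \<open>Inverses multiply in the opposite order, so \<open>vec\<close> stands on the right. The
  inverse of R(u) is R(-u) divided by 1 - u^-2, whence \<open>- c\<close> and the scalar
  \<open>e\<close>.\<close>

definition fuse_inv :: "'r \<Rightarrow> 'r \<Rightarrow> (nat \<Rightarrow> nat \<Rightarrow> 'r) \<Rightarrow> nat \<Rightarrow> nat \<Rightarrow> 'r" where
  "fuse_inv c e t i j = (\<Sum>a\<in>I. (G ^ (p i + p a) * sh (t i a)) * (e * vec (- c) a j))"

text \<open>Unitarity R(u) R(-u) = 1 - u^-2, a consequence of P^2 = 1.\<close>

lemma vec_inverse:
  assumes c: "\<And>x. c * x = x * c" and e: "\<And>x. e * x = x * e" "e * (1 - c * c) = 1"
    and ind: "i \<in> I" "k \<in> I"
  shows "(\<Sum>j\<in>I. (e * vec (- c) i j) * vec c j k) = (if i = k then 1 else 0)"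
proof -
  have c': "- c * x = x * - c" for x using c by simp
  have "(\<Sum>j\<in>I. vec (- c) i j * vec c j k) = (\<Sum>j\<in>I. (if i = k \<and> j = i then 1 else 0) +
     (if j = i then (-1) ^ (p i * p k) * (c * E k i) else 0) +
     (if j = k then (-1) ^ (p i * p k) * (- c * E k i) else 0) +
     (if i = k then - c * c * E j j else 0))"
    using ind by (intro sum.cong refl) (auto simp: vec_mult[OF c' c] minus_one_power_iff)
  also have "\<dots> = (if i = k then 1 - c * c else 0)"
  proof -
    have "(\<Sum>j\<in>I. - (c * c * E j j)) = - (c * c)"
      by (simp only: sum_negf sum_distrib_left[symmetric] E_sum mult_1_right)
    then show ?thesis using ind by (auto simp: sum.distrib)
  qed
  finally have "(\<Sum>j\<in>I. vec (- c) i j * vec c j k) = (if i = k then 1 - c * c else 0)" .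
  then show ?thesis using e(2) by (auto simp: mult.assoc simp flip: sum_distrib_left)
qed

text \<open>The two vector factors are adjacent in the middle of the product; they cancel first and
  leave the product of the tails.\<close>

lemma fuse_inverse:
  assumes c: "\<And>x. c * x = x * c" and e: "\<And>x. e * x = x * e" "e * (1 - c * c) = 1"
    and t: "\<And>i k. i \<in> I \<Longrightarrow> k \<in> I \<Longrightarrow> (\<Sum>j\<in>I. t' i j * t j k) = (if i = k then 1 else 0)"
    and ind: "i \<in> I" "k \<in> I"
  shows "(\<Sum>j\<in>I. fuse_inv c e t' i j * fuse c t j k) = (if i = k then 1 else 0)"
proof -
  let ?x = "\<lambda>a. G ^ (p i + p a) * sh (t' i a)" and ?y = "\<lambda>a. G ^ (p a + p k) * sh (t a k)"
  have m: "(G ^ r * sh x) * (G ^ s * sh y) = G ^ (r + s) * sh (x * y)" for r s x y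
    by (rule twisted_mult)
  have "(\<Sum>j\<in>I. fuse_inv c e t' i j * fuse c t j k) =
     (\<Sum>j\<in>I. \<Sum>a\<in>I. \<Sum>b\<in>I. ?x a * ((e * vec (- c) a j) * vec c j b) * ?y b)"
    unfolding fuse_inv_def fuse_def sum_product by (simp only: mult.assoc)
  also have "\<dots> = (\<Sum>a\<in>I. \<Sum>b\<in>I. \<Sum>j\<in>I. ?x a * ((e * vec (- c) a j) * vec c j b) * ?y b)"
    by (rule sum_rotate)
  also have "\<dots> = (\<Sum>a\<in>I. \<Sum>b\<in>I. ?x a * (\<Sum>j\<in>I. (e * vec (- c) a j) * vec c j b) * ?y b)"
    by (simp only: sum_distrib_left sum_distrib_right)
  also have "\<dots> = (\<Sum>a\<in>I. \<Sum>b\<in>I. if a = b then ?x a * ?y a else 0)"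
    by (intro sum.cong refl) (auto simp: vec_inverse[OF c e])
  also have "\<dots> = (\<Sum>a\<in>I. G ^ (p i + p k) * sh (t' i a * t a k))"
    by (intro sum.cong refl) (auto simp: m intro!: arg_cong2[where f = "(*)"] G_power_cong)
  also have "\<dots> = G ^ (p i + p k) * sh (\<Sum>a\<in>I. t' i a * t a k)"
    by (simp add: rhomD(8)[OF rhom_sh] sum_distrib_left)
  also have "\<dots> = (if i = k then 1 else 0)"
    using t[OF ind] rhomD(1,4)[OF rhom_sh] by (auto simp: G_power)
  finally show ?thesis .
qed

lemma sum_sign: "(\<Sum>i\<in>I. (-1) ^ p i) = (of_int (int m - int n) :: 'r)"
proof -
  have "(\<Sum>i\<in>I. (-1::'r) ^ p i) = (\<Sum>i\<in>{1..m}. (-1) ^ p i) + (\<Sum>i\<in>{m+1..m+n}. (-1) ^ p i)"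
    unfolding idx_def by (subst sum.union_disjoint[symmetric]) (auto intro!: sum.cong)
  also have "\<dots> = (\<Sum>i\<in>{1..m}. 1) + (\<Sum>i\<in>{m+1..m+n}. -1)"
    by (intro arg_cong2[where f = "(+)"] sum.cong) (auto simp: par_def)
  finally show ?thesis by simp
qed

text \<open>Crossing symmetry. The partial transpose Q of P satisfies Q^2 = (m - n) Q, so (1 + d
  Q)(1 - c Q) = 1 as soon as d - c = (m - n) d c. This holds for c = -1/(u - a) and its shift d =
  -1/(u + m - n - a). For m = n it just says d = c.\<close>

lemma vec_crossing:
  assumes c: "\<And>x. c * x = x * c" and d: "\<And>x. d * x = x * d" and dc: "d - c = of_int (int m - int n) * (d * c)"
    and ind: "a \<in> I" "b \<in> I"
  shows "(\<Sum>l\<in>I. (-1) ^ (p l + p l * (p a + p b)) * (vec d l a * vec (- c) b l)) = (if a = b then (-1) ^ p a else 0)"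
proof -
  have c': "- c * x = x * - c" for x using c by simp
  have "(\<Sum>l\<in>I. (-1) ^ (p l + p l * (p a + p b)) * (vec d l a * vec (- c) b l)) =
    (\<Sum>l\<in>I. (if l = a then (if a = b then (-1) ^ p a else 0) else 0) +
       (if l = a then - (c * E a b) else 0) + (if l = b then d * E a b else 0) +
       (-1) ^ p l * (- (d * c * E a b)))"
    using ind by (intro sum.cong refl) (auto simp: vec_mult[OF d c'] minus_one_power_iff)
  also have "\<dots> = (if a = b then (-1) ^ p a else 0) - c * E a b + d * E a b - of_int (int m - int n) * (d * c * E a b)"
  proof -
    have "(\<Sum>l\<in>I. (-1) ^ p l * (d * c * E a b)) = of_int (int m - int n) * (d * c * E a b)"
      by (simp only: sum_distrib_right[symmetric] sum_sign)
    then show ?thesis using ind by (simp add: sum.distrib sum_subtractf del: of_int_diff)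
  qed
  also have "\<dots> = (if a = b then (-1) ^ p a else 0) + ((d - c) - of_int (int m - int n) * (d * c)) * E a b"
    by (simp add: algebra_simps)
  finally show ?thesis by (simp add: dc)
qed

text \<open>Here the two vector factors enclose the tails instead of meeting. They are brought
  together by \<open>vec_twist\<close> and removed by \<open>vec_crossing\<close>, which leaves the
  same sum for the tails; from the new factor only the scalar \<open>e\<close> of the unitarity
  relation survives.\<close>

lemma fuse_crossing:
  assumes c: "\<And>x. c * x = x * c" and d: "\<And>x. d * x = x * d" and dc: "d - c = of_int (int m - int n) * (d * c)"
    and e: "\<And>x. e * x = x * e" and z: "sh z = z" and j: "j \<in> I"
    and t: "(\<Sum>l\<in>I. (-1) ^ (p j + p l) * (t l j * t' j l)) = z"
  shows "(\<Sum>l\<in>I. (-1) ^ (p j + p l) * (fuse d t l j * fuse_inv c e t' j l)) = e * z"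
proof -
  have m: "(G ^ r * sh x) * (G ^ s * sh y) = G ^ (r + s) * sh (x * y)" for r s x y
    by (rule twisted_mult)
  let ?x = "\<lambda>a b. G ^ (p a + p b) * sh (t a j * t' j b)"
  have "(\<Sum>l\<in>I. (-1) ^ (p j + p l) * (fuse d t l j * fuse_inv c e t' j l)) =
    (\<Sum>l\<in>I. \<Sum>a\<in>I. \<Sum>b\<in>I. (-1) ^ (p j + p l) * (vec d l a * ((G ^ (p a + p j) * sh (t a j)) * (G ^ (p j + p b) * sh (t' j b))) * (e * vec (- c) b l)))"
    unfolding fuse_inv_def fuse_def sum_product by (simp only: mult.assoc sum_distrib_left)
  also have "\<dots> = (\<Sum>l\<in>I. \<Sum>a\<in>I. \<Sum>b\<in>I. e * ((-1) ^ (p j + p a + p a * p b) * (?x a b * ((-1) ^ (p l + p l * (p a + p b)) * (vec d l a * vec (- c) b l)))))"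
  proof (intro sum.cong refl)
    fix l a b assume ind: "l \<in> I" "a \<in> I" "b \<in> I"
    have "G ^ (p a + p j + (p j + p b)) = G ^ (p a + p b)"
      by (rule G_power_cong) (simp only: even_add, blast)
    then have x: "(G ^ (p a + p j) * sh (t a j)) * (G ^ (p j + p b) * sh (t' j b)) = ?x a b" unfolding m by simp
    have tw: "vec d l a * ?x a b = (-1) ^ ((p a + p b) * (p l + p a)) * (?x a b * vec d l a)"
      unfolding vec_twist[OF d ind(1,2)] by (simp add: mult.assoc[symmetric] power_add[symmetric] mult_2[symmetric])
    have "(-1) ^ (p j + p l) * (vec d l a * ?x a b * (e * vec (- c) b l)) =
        e * ((-1) ^ (p j + p l) * (vec d l a * ?x a b * vec (- c) b l))"
      by (simp only: central_left_commute[of e, OF e])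
    also have "\<dots> = e * (((-1) ^ (p j + p l) * (-1) ^ ((p a + p b) * (p l + p a))) * (?x a b * (vec d l a * vec (- c) b l)))"
      unfolding tw by (simp only: mult.assoc)
    also have "(-1::'r) ^ (p j + p l) * (-1) ^ ((p a + p b) * (p l + p a)) =
       (-1) ^ (p j + p a + p a * p b) * (-1) ^ (p l + p l * (p a + p b))"
      unfolding power_add[symmetric] by (rule sg_cong) auto
    finally show "(-1) ^ (p j + p l) * (vec d l a * ((G ^ (p a + p j) * sh (t a j)) * (G ^ (p j + p b) * sh (t' j b))) * (e * vec (- c) b l)) =
       e * ((-1) ^ (p j + p a + p a * p b) * (?x a b * ((-1) ^ (p l + p l * (p a + p b)) * (vec d l a * vec (- c) b l))))"
      unfolding x by (simp only: mult.assoc sg_left_commute[of "G ^ (p a + p b)"] sg_left_commute[of "sh (t a j * t' j b)"])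
  qed
  also have "\<dots> = (\<Sum>a\<in>I. \<Sum>b\<in>I. \<Sum>l\<in>I. e * ((-1) ^ (p j + p a + p a * p b) * (?x a b * ((-1) ^ (p l + p l * (p a + p b)) * (vec d l a * vec (- c) b l)))))"
    by (rule sum_rotate)
  also have "\<dots> = (\<Sum>a\<in>I. \<Sum>b\<in>I. e * ((-1) ^ (p j + p a + p a * p b) * (?x a b * (if a = b then (-1) ^ p a else 0))))"
    by (intro sum.cong refl) (simp only: vec_crossing[OF c d dc] flip: sum_distrib_left)
  also have "\<dots> = (\<Sum>a\<in>I. \<Sum>b\<in>I. if a = b then e * sh ((-1) ^ (p j + p a) * (t a j * t' j a)) else 0)"
    by (intro sum.cong refl) (auto simp: rhomD(1,3,5)[OF rhom_sh] G_power minus_one_power_iff)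
  also have "\<dots> = e * sh (\<Sum>a\<in>I. (-1) ^ (p j + p a) * (t a j * t' j a))"
    by (simp add: rhomD(8)[OF rhom_sh] sum_distrib_left)
  finally show ?thesis by (simp add: t z)
qed

text \<open>Adjoins one formal variable with constant matrix units; applied in turn for \<epsilon>,
  u and v.\<close>

lemma lift: "fusion_ring m n (\<lambda>i j. fps_const (E i j)) (fps_map sh)"
  by unfold_locales
    (auto simp: E_mult rhom_fps_map[OF rhom_sh] sh_E fps_eq_iff rhomD(8)[OF rhom_fps_const, symmetric] E_sum fps_const_mult)

end

text \<open>Fusion is built from ring operations, \<open>E\<close> and \<open>sh\<close> alone. This
  carries it from series in u to the two copies, in u and in v, that the defining relation
  compares.\<close>

lemma fuse_hom:
  assumes A: "fusion_ring m n E sh" and B: "fusion_ring m n E' sh'" and h: "rhom h"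
    and E: "\<And>i j. i \<in> idx m n \<Longrightarrow> j \<in> idx m n \<Longrightarrow> h (E i j) = E' i j" and sh: "\<And>x. h (sh x) = sh' (h x)"
    and ij: "i \<in> idx m n" "j \<in> idx m n"
  shows "h (fusion_ring.fuse m n E sh c t i j) = fusion_ring.fuse m n E' sh' (h c) (\<lambda>i j. h (t i j)) i j"
proof -
  interpret A: fusion_ring m n E sh by fact
  interpret B: fusion_ring m n E' sh' by fact
  have G: "h A.G = B.G"
    unfolding A.G_def B.G_def rhomD(8)[OF h] by (intro sum.cong refl) (simp add: rhomD(3,7)[OF h] E)
  have v: "h (A.vec c i j) = B.vec (h c) i j" if "i \<in> idx m n" "j \<in> idx m n" for i j
    unfolding A.vec_def B.vec_def using that by (simp add: rhomD[OF h] E)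
  show ?thesis
    unfolding A.fuse_def B.fuse_def rhomD(8)[OF h]
    by (intro sum.cong refl) (simp add: rhomD(3,9)[OF h] v ij G sh)
qed

section \<open>Power series in \<open>u\<close> over power series in \<open>\<epsilon>\<close>\<close>

text \<open>
  The outer variable of \<open>'r fps fps\<close> is \<open>u\<close> and the inner one is \<open>\<epsilon>\<close>. The series with \<open>conv\<close> are
  those in \<open>\<epsilon>\<close> and \<open>x = \<epsilon> u\<close>; the substitution \<open>u \<mapsto> u + c\<close> converges on them, and \<open>gr r\<close> takes
  the coefficient of \<open>\<epsilon>^r\<close>, a series in \<open>x\<close>.
\<close>

definition conv :: "'r::ring_1 fps fps \<Rightarrow> bool" where
  "conv f \<longleftrightarrow> (\<forall>s q. q < s \<longrightarrow> f $ s $ q = 0)"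

definition gr :: "nat \<Rightarrow> 'r::ring_1 fps fps \<Rightarrow> 'r fps" where
  "gr r f = Abs_fps (\<lambda>k. f $ k $ (k + r))"

lemma gr_nth [simp]: "gr r f $ k = f $ k $ (k + r)"
  by (simp add: gr_def)

lemma convD: "conv f \<Longrightarrow> q < s \<Longrightarrow> f $ s $ q = 0"
  by (simp add: conv_def)

lemma gr_add: "gr r (f + g) = gr r f + gr r g"
  by (simp add: fps_eq_iff)

text \<open>\<open>gr\<close> sorts the coefficients of u^k \<epsilon>^q by the excess q - k.
  Excesses add under multiplication, and \<open>conv\<close> says that none is negative, so only
  finitely many splittings remain.\<close>

lemma gr_mult:
  assumes "conv f" "conv g"
  shows "gr r (f * g) = (\<Sum>i\<le>r. gr i f * gr (r - i) g)"
proof (rule fps_ext)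
  fix k
  have "gr r (f * g) $ k = (\<Sum>i\<le>k. \<Sum>a\<le>k + r. f $ i $ a * g $ (k - i) $ (k + r - a))"
    by (simp add: fps_mult_nth fps_sum_nth atLeast0AtMost)
  also have "\<dots> = (\<Sum>i\<le>k. \<Sum>s\<le>r. f $ i $ (i + s) * g $ (k - i) $ (k - i + (r - s)))"
  proof (rule sum.cong[OF refl])
    fix i assume i: "i \<in> {..k}"
    have "(\<Sum>a\<le>k + r. f $ i $ a * g $ (k - i) $ (k + r - a)) =
        (\<Sum>a\<in>(\<lambda>s. i + s) ` {..r}. f $ i $ a * g $ (k - i) $ (k + r - a))"
    proof (rule sum.mono_neutral_right)
      show "\<forall>a\<in>{..k + r} - (\<lambda>s. i + s) ` {..r}. f $ i $ a * g $ (k - i) $ (k + r - a) = 0"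
      proof
        fix a assume a: "a \<in> {..k + r} - (\<lambda>s. i + s) ` {..r}"
        then have "a \<noteq> i + (a - i) \<or> a - i > r" by (metis DiffE atMost_iff image_eqI not_le)
        then have "a < i \<or> k + r - a < k - i" using a i by auto
        then show "f $ i $ a * g $ (k - i) $ (k + r - a) = 0" using convD[OF assms(1)] convD[OF assms(2)] by auto
      qed
    qed (use i in auto)
    also have "\<dots> = (\<Sum>s\<le>r. f $ i $ (i + s) * g $ (k - i) $ (k - i + (r - s)))"
      by (subst sum.reindex) (use i in \<open>auto intro!: sum.cong\<close>)
    finally show "(\<Sum>a\<le>k + r. f $ i $ a * g $ (k - i) $ (k + r - a)) =
       (\<Sum>s\<le>r. f $ i $ (i + s) * g $ (k - i) $ (k - i + (r - s)))" .
  qed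
  also have "\<dots> = (\<Sum>i\<le>r. gr i f * gr (r - i) g) $ k"
    unfolding fps_sum_nth fps_mult_nth gr_nth atLeast0AtMost by (rule sum.swap)
  finally show "gr r (f * g) $ k = (\<Sum>i\<le>r. gr i f * gr (r - i) g) $ k" .
qed

lemma conv_mult: "conv f \<Longrightarrow> conv g \<Longrightarrow> conv (f * g)"
  unfolding conv_def
proof (intro allI impI)
  fix s q :: nat
  assume *: "\<forall>s q. q < s \<longrightarrow> f $ s $ q = 0" "\<forall>s q. q < s \<longrightarrow> g $ s $ q = 0" and q: "q < s"
  have "f $ i $ a * g $ (s - i) $ (q - a) = 0" if "i \<le> s" "a \<le> q" for i a
  proof (cases "a < i")
    case False
    then have "q - a < s - i" using that q by auto
    then show ?thesis using * by simp
  qed (use * in simp)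
  then show "(f * g) $ s $ q = 0"
    by (simp add: fps_mult_nth fps_sum_nth)
qed

lemma conv_add: "conv f \<Longrightarrow> conv g \<Longrightarrow> conv (f + g)"
  by (simp add: conv_def)

lemma conv_uminus: "conv f \<Longrightarrow> conv (- f)"
  by (simp add: conv_def)

lemma conv_sum: "(\<And>i. i \<in> S \<Longrightarrow> conv (f i)) \<Longrightarrow> conv (sum f S)"
  by (induction S rule: infinite_finite_induct) (auto simp: conv_add, simp_all add: conv_def)

lemma conv_const: "conv (fps_const a)"
  by (simp add: conv_def)

lemma conv_one: "conv 1"
  using conv_const[of 1] by simp

lemma conv_map: "rhom h \<Longrightarrow> conv f \<Longrightarrow> conv (fps_map (fps_map h) f)"
  by (simp add: conv_def rhomD)

lemma conv_prod_list: "(\<And>x. x \<in> set xs \<Longrightarrow> conv (f x)) \<Longrightarrow> conv (prod_list (map f xs))"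
  by (induction xs) (auto simp: conv_one conv_mult)

text \<open>The sum over \<open>s\<close> would be infinite; for series with \<open>conv\<close> the
  terms with s > q vanish, and truncating at \<open>q\<close> gives the substitution u \<mapsto> u +
  c exactly.\<close>

definition shift :: "int \<Rightarrow> 'r::ring_1 fps fps \<Rightarrow> 'r fps fps" where
  "shift c f = Abs_fps (\<lambda>k. Abs_fps (\<lambda>q. \<Sum>s\<le>q. of_int (of_nat (s choose k) * c ^ (s - k)) * f $ s $ q))"

lemma shift_nth: "shift c f $ k $ q = (\<Sum>s\<le>q. of_int (of_nat (s choose k) * c ^ (s - k)) * f $ s $ q)"
  by (simp add: shift_def)

lemma shift_nth_bound:
  assumes "conv f" "q \<le> N"
  shows "shift c f $ k $ q = (\<Sum>s\<le>N. of_int (of_nat (s choose k) * c ^ (s - k)) * f $ s $ q)"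
  unfolding shift_nth by (rule sum.mono_neutral_left) (use assms in \<open>auto simp: convD\<close>)

lemma conv_shift: "conv f \<Longrightarrow> conv (shift c f)"
  unfolding conv_def[of "shift c f"]
  by (auto simp: shift_nth binomial_eq_0 intro!: sum.neutral)

lemma shift_add: "shift c (f + g) = shift c f + shift c g"
  by (simp add: fps_eq_iff shift_nth distrib_left sum.distrib)

lemma shift_uminus: "shift c (- f) = - shift c f"
  by (simp add: fps_eq_iff shift_nth sum_negf)

lemma shift_zero: "shift c 0 = 0"
  by (simp add: fps_eq_iff shift_nth)

lemma shift_sum: "shift c (sum f S) = (\<Sum>i\<in>S. shift c (f i))"
  by (induction S rule: infinite_finite_induct) (simp_all add: shift_zero shift_add)

lemma shift_const: "shift c (fps_const a) = fps_const a"
proof (intro fps_ext)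
  fix k q
  have "(\<Sum>s\<le>q. of_int (int (s choose k) * c ^ (s - k)) * fps_const a $ s $ q) =
    (\<Sum>s\<le>q. if s = 0 then (if k = 0 then a $ q else 0) else 0)"
    by (intro sum.cong) (auto simp: binomial_eq_0)
  then show "shift c (fps_const a) $ k $ q = fps_const a $ k $ q"
    by (simp add: shift_nth)
qed

lemma shift_map: "rhom h \<Longrightarrow> shift c (fps_map (fps_map h) f) = fps_map (fps_map h) (shift c f)"
  by (auto simp: fps_eq_iff shift_nth rhomD simp del: of_int_mult of_int_power)

text \<open>Vandermonde's identity, with \<open>conv\<close> justifying first the extension of the
  truncated sums to a common range and then their regrouping by total degree in u.\<close>

lemma shift_mult:
  fixes f g :: "'r::ring_1 fps fps"
  assumes f: "conv f" and g: "conv g"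
  shows "shift c (f * g) = shift c f * shift c g"
proof (intro fps_ext)
  fix k q
  let ?b = "\<lambda>s k. int (s choose k) * c ^ (s - k)"
  let ?F = "\<lambda>a s r. f $ s $ a * g $ r $ (q - a)"
  have V: "(\<Sum>i\<le>k. ?b s i * ?b r (k - i)) = ?b (s + r) k" for s r
  proof -
    have "?b s i * ?b r (k - i) = int ((s choose i) * (r choose (k - i))) * c ^ (s + r - k)" if "i \<le> k" for i
    proof (cases "i \<le> s \<and> k - i \<le> r")
      case True
      then have "(s - i) + (r - (k - i)) = s + r - k" using that by auto
      then show ?thesis by (simp flip: power_add)
    qed (auto simp: binomial_eq_0)
    then have "(\<Sum>i\<le>k. ?b s i * ?b r (k - i)) = int (\<Sum>i\<le>k. (s choose i) * (r choose (k - i))) * c ^ (s + r - k)"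
      by (simp add: sum_distrib_right del: of_nat_mult)
    also have "(\<Sum>i\<le>k. (s choose i) * (r choose (k - i))) = (s + r) choose k"
      by (rule vandermonde)
    finally show ?thesis .
  qed
  have "(shift c f * shift c g) $ k $ q = (\<Sum>i\<le>k. \<Sum>a\<le>q. shift c f $ i $ a * shift c g $ (k - i) $ (q - a))"
    by (simp add: fps_mult_nth fps_sum_nth atLeast0AtMost)
  also have "\<dots> = (\<Sum>i\<le>k. \<Sum>a\<le>q. (\<Sum>s\<le>q. of_int (?b s i) * f $ s $ a) * (\<Sum>r\<le>q. of_int (?b r (k - i)) * g $ r $ (q - a)))"
    by (intro sum.cong refl arg_cong2[where f = "(*)"] shift_nth_bound f g) auto
  also have "\<dots> = (\<Sum>i\<le>k. \<Sum>a\<le>q. \<Sum>s\<le>q. \<Sum>r\<le>q. of_int (?b s i * ?b r (k - i)) * ?F a s r)"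
  proof (intro sum.cong refl)
    fix i a
    have e: "(of_int x * y) * (of_int x' * y') = of_int (x * x') * (y * y')" for x x' and y y' :: 'r
      by (simp add: mult.assoc mult_of_int_commute[of x' y] mult_of_int_commute[of x' "y * y'"])
        (metis mult.assoc mult_of_int_commute)
    show "(\<Sum>s\<le>q. of_int (?b s i) * f $ s $ a) * (\<Sum>r\<le>q. of_int (?b r (k - i)) * g $ r $ (q - a)) =
        (\<Sum>s\<le>q. \<Sum>r\<le>q. of_int (?b s i * ?b r (k - i)) * ?F a s r)"
      unfolding sum_product e by (rule refl)
  qed
  also have "\<dots> = (\<Sum>a\<le>q. \<Sum>s\<le>q. \<Sum>r\<le>q. \<Sum>i\<le>k. of_int (?b s i * ?b r (k - i)) * ?F a s r)"
    by (subst sum_rotate) (intro sum.cong refl sum.swap)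
  also have "\<dots> = (\<Sum>a\<le>q. \<Sum>s\<le>q. \<Sum>r\<le>q. of_int (?b (s + r) k) * ?F a s r)"
    by (simp only: V flip: sum_distrib_right of_int_sum)
  also have "\<dots> = (\<Sum>a\<le>q. \<Sum>t\<le>q. \<Sum>s\<le>t. of_int (?b t k) * ?F a s (t - s))"
  proof (rule sum.cong[OF refl])
    fix a assume a: "a \<in> {..q}"
    have "(\<Sum>s\<le>q. \<Sum>r\<le>q. of_int (?b (s + r) k) * ?F a s r) =
       (\<Sum>(s, r)\<in>{..q} \<times> {..q}. of_int (?b (s + r) k) * ?F a s r)"
      by (simp add: sum.cartesian_product)
    also have "\<dots> = (\<Sum>(s, r)\<in>{(s, r). s + r \<le> q}. of_int (?b (s + r) k) * ?F a s r)"
    proof (rule sum.mono_neutral_right)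
      \<comment> \<open>If s + r > q then a < s or q - a < r, and one of the two coefficients
        vanishes by \<open>conv\<close>.\<close>
      show "\<forall>x\<in>{..q} \<times> {..q} - {(s, r). s + r \<le> q}. (case x of (s, r) \<Rightarrow> of_int (?b (s + r) k) * ?F a s r) = 0"
      proof
        fix x assume x: "x \<in> {..q} \<times> {..q} - {(s, r). s + r \<le> q}"
        obtain s r where sr: "x = (s, r)" by fastforce
        then have "a < s \<or> q - a < r" using x a by auto
        then show "(case x of (s, r) \<Rightarrow> of_int (?b (s + r) k) * ?F a s r) = 0"
          using convD[OF f] convD[OF g] by (auto simp: sr)
      qed
    qed auto
    also have "\<dots> = (\<Sum>t\<le>q. \<Sum>s\<le>t. of_int (?b (s + (t - s)) k) * ?F a s (t - s))"
      by (rule sum.triangle_reindex_eq)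
    finally show "(\<Sum>s\<le>q. \<Sum>r\<le>q. of_int (?b (s + r) k) * ?F a s r) = (\<Sum>t\<le>q. \<Sum>s\<le>t. of_int (?b t k) * ?F a s (t - s))"
      by simp
  qed
  also have "\<dots> = (\<Sum>t\<le>q. \<Sum>s\<le>t. \<Sum>a\<le>q. of_int (?b t k) * ?F a s (t - s))"
    by (rule sum_rotate)
  also have "\<dots> = shift c (f * g) $ k $ q"
    by (simp only: shift_nth fps_mult_nth fps_sum_nth atLeast0AtMost sum_distrib_left)
  finally show "shift c (f * g) $ k $ q = (shift c f * shift c g) $ k $ q" by simp
qed

section \<open>Expansions at u = 0 of rational functions with poles at a and its shifts\<close>

definition geom :: "complex \<Rightarrow> complex fps fps" where
  "geom \<beta> = Abs_fps (\<lambda>k. (fps_const \<beta> * fps_X) ^ k)"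

abbreviation "eps \<beta> \<equiv> (fps_const (fps_const \<beta> * fps_X) :: complex fps fps)"

lemma conv_geom: "conv (geom \<beta>)"
  by (auto simp: conv_def geom_def power_mult_distrib fps_const_power)

lemma conv_eps_X: "conv (eps \<beta> * fps_X)"
  by (auto simp: conv_def)

lemma geom_eq: "(1 - eps \<beta> * fps_X) * geom \<beta> = 1"
proof (rule fps_ext)
  fix k show "((1 - eps \<beta> * fps_X) * geom \<beta>) $ k = 1 $ k"
    by (cases k) (auto simp: left_diff_distrib mult.assoc geom_def)
qed

lemma shift_eps_X: "shift c (eps \<beta> * fps_X) = eps \<beta> * fps_X + of_int c * eps \<beta>"
proof (intro fps_ext)
  fix k q
  have "(\<Sum>s\<le>q. of_int (int (s choose k) * c ^ (s - k)) * (eps \<beta> * fps_X) $ s $ q) =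
    (\<Sum>s\<le>q. if s = 1 then of_int (int (1 choose k) * c ^ (1 - k)) * (fps_const \<beta> * fps_X) $ q else 0)"
    by (intro sum.cong) auto
  also have "\<dots> = (if 1 \<le> q then of_int (int (1 choose k) * c ^ (1 - k)) * (fps_const \<beta> * fps_X) $ q else 0)"
    by simp
  also have "\<dots> = (eps \<beta> * fps_X + of_int c * eps \<beta>) $ k $ q"
  proof -
    have "(of_int c :: complex fps fps) = fps_const (fps_const (of_int c))" by (simp add: fps_of_int)
    then show ?thesis by (cases k; cases "k = 1") (auto simp: binomial_eq_0)
  qed
  finally show "shift c (eps \<beta> * fps_X) $ k $ q = (eps \<beta> * fps_X + of_int c * eps \<beta>) $ k $ q"
    unfolding shift_nth .
qed

text \<open>The shifted series is not computed: \<open>shift\<close> is multiplicative, so it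
  carries the equation that characterises 1 / (1 - \<beta> \<epsilon> u) to the one for 1 / (1 -
  \<beta> \<epsilon> (u + c)).\<close>

lemma shift_geom: "(1 - eps \<beta> * fps_X - of_int c * eps \<beta>) * shift c (geom \<beta>) = 1"
proof -
  have c: "conv (1 - eps \<beta> * fps_X)"
    using conv_add[OF conv_one conv_uminus[OF conv_eps_X]] by simp
  have one: "shift c 1 = (1 :: complex fps fps)" using shift_const[of c 1] by simp
  have "shift c (1 - eps \<beta> * fps_X) = 1 - eps \<beta> * fps_X - of_int c * eps \<beta>"
    using shift_add[of c 1 "- (eps \<beta> * fps_X)"] by (simp add: shift_uminus one shift_eps_X)
  then show ?thesis
    using shift_mult[OF c conv_geom, of c \<beta>] unfolding geom_eq one by simp
qed

text \<open>The scalar \<open>- 1 / (u - a)\<close> for \<open>a = 1 / (\<beta> \<epsilon>)\<close>.\<close>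

definition pole :: "complex \<Rightarrow> complex fps fps" where
  "pole \<beta> = eps \<beta> * geom \<beta>"

lemma conv_pole: "conv (pole \<beta>)"
  unfolding pole_def by (intro conv_mult conv_const conv_geom)

lemma pole_nth: "pole \<beta> $ k = fps_const (\<beta> ^ Suc k) * fps_X ^ Suc k"
proof -
  have "pole \<beta> $ k = (fps_const \<beta> * fps_X) ^ Suc k" by (simp add: pole_def geom_def)
  then show ?thesis by (simp only: power_mult_distrib fps_const_power)
qed

lemma gr_pole: "gr 0 (pole \<beta>) = 0" "gr (Suc 0) (pole \<beta>) = Abs_fps (\<lambda>k. \<beta> ^ Suc k)"
  by (simp_all add: fps_eq_iff pole_nth fps_X_power_nth del: power_Suc)

text \<open>The resolvent identity for -1/(u - a) and its shift. With c = m - n it is the hypothesis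
  of \<open>vec_crossing\<close>.\<close>

lemma shift_pole: "shift c (pole \<beta>) - pole \<beta> = of_int c * (shift c (pole \<beta>) * pole \<beta>)"
proof -
  let ?d = "geom \<beta>" and ?d' = "shift c (geom \<beta>)"
  have e: "shift c (pole \<beta>) = eps \<beta> * ?d'"
    unfolding pole_def by (simp add: shift_mult conv_const conv_geom shift_const)
  have "?d' - ?d = ?d' * ((1 - eps \<beta> * fps_X) * ?d) - ?d * ((1 - eps \<beta> * fps_X - of_int c * eps \<beta>) * ?d')"
    by (simp only: geom_eq shift_geom mult_1_right)
  also have "\<dots> = of_int c * (?d' * (eps \<beta> * ?d))" by (simp add: algebra_simps)
  finally have "eps \<beta> * (?d' - ?d) = eps \<beta> * (of_int c * (?d' * (eps \<beta> * ?d)))" by simp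
  then show ?thesis unfolding e unfolding pole_def by (simp only: right_diff_distrib mult_ac)
qed

text \<open>The inverse of \<open>1 - (u - a)\<^bsup>-2\<^esup>\<close>, from \<open>(u - a)\<^sup>2 - 1 = (u - 1 - a) (u + 1 - a)\<close>.\<close>

definition scalar_factor :: "complex \<Rightarrow> complex fps fps" where
  "scalar_factor \<beta> = (1 - eps \<beta> * fps_X) * (1 - eps \<beta> * fps_X) * (shift 1 (geom \<beta>) * shift (-1) (geom \<beta>))"

lemma conv_scalar_factor: "conv (scalar_factor \<beta>)"
proof -
  have "conv (1 - eps \<beta> * fps_X)"
    using conv_add[OF conv_one conv_uminus[OF conv_eps_X]] by simp
  then show ?thesis unfolding scalar_factor_def by (intro conv_mult conv_shift conv_geom)
qed

lemma scalar_factor_eq: "scalar_factor \<beta> * (1 - pole \<beta> * pole \<beta>) = 1"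
proof -
  let ?D = "1 - eps \<beta> * fps_X" and ?e = "shift 1 (geom \<beta>)" and ?f = "shift (-1) (geom \<beta>)"
  have p: "?D * pole \<beta> = eps \<beta>" unfolding pole_def using geom_eq[of \<beta>] by (simp add: mult.left_commute)
  have ef: "(?D - eps \<beta>) * ?e = 1" "(?D + eps \<beta>) * ?f = 1"
    subgoal using shift_geom[of \<beta> 1] by simp
    subgoal using shift_geom[of \<beta> "-1"]
      by (simp only: of_int_minus of_int_1 mult_minus_left mult_1_left diff_minus_eq_add)
    done
  have "scalar_factor \<beta> * (1 - pole \<beta> * pole \<beta>) = (?D * ?D - (?D * pole \<beta>) * (?D * pole \<beta>)) * (?e * ?f)"
  proof -
    have "(D * D * (e * f)) * (1 - x * x) = (D * D - (D * x) * (D * x)) * (e * f)" for D e f x :: "complex fps fps"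
      by (simp add: algebra_simps)
    then show ?thesis unfolding scalar_factor_def .
  qed
  also have "\<dots> = ((?D - eps \<beta>) * ?e) * ((?D + eps \<beta>) * ?f)"
  proof -
    have "(D * D - x * x) * (e * f) = ((D - x) * e) * ((D + x) * f)" for D e f x :: "complex fps fps"
      by (simp add: algebra_simps)
    then show ?thesis unfolding p .
  qed
  finally show ?thesis by (simp only: ef mult_1)
qed

text \<open>Read off from the fixed point equation e = 1 + c^2 e for c =
  \<open>pole \<beta>\<close>. The pole starts in excess 1, so c^2 starts in excess 2, where it is
  the square of a geometric series; the k + 1 equal terms of the convolution give the factor
  \<open>of_nat (Suc k)\<close>.\<close>

lemma gr_scalar_factor:
  "gr 0 (scalar_factor \<beta>) = 1" "gr 1 (scalar_factor \<beta>) = 0"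
  "gr 2 (scalar_factor \<beta>) $ k = of_nat (Suc k) * \<beta> ^ (k + 2)"
proof -
  let ?e = "scalar_factor \<beta>" and ?c = "pole \<beta>"
  let ?g = "Abs_fps (\<lambda>k. \<beta> ^ Suc k)"
  have e: "?e = 1 + ?c * ?c * ?e" using scalar_factor_eq[of \<beta>] by (simp add: algebra_simps)
  have cc: "conv (?c * ?c)" by (intro conv_mult conv_pole)
  have c0: "gr 0 (?c * ?c) = 0" by (simp add: gr_mult conv_pole gr_pole)
  have c1: "gr 1 (?c * ?c) = 0" by (simp add: gr_mult conv_pole gr_pole)
  have c2: "gr 2 (?c * ?c) = ?g * ?g" by (simp add: gr_mult conv_pole gr_pole numeral_2_eq_2)
  have o: "gr r 1 = (if r = 0 then 1 else 0)" for r :: nat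
    by (auto simp: fps_eq_iff)
  have s: "gr r ?e = gr r 1 + (\<Sum>i\<le>r. gr i (?c * ?c) * gr (r - i) ?e)" for r
    by (subst e) (simp only: gr_add gr_mult[OF cc conv_scalar_factor])
  show 0: "gr 0 ?e = 1" using s[of 0] by (simp add: o c0)
  show 1: "gr 1 ?e = 0" using s[of 1] c1 by (simp add: o c0)
  have "gr 2 ?e = ?g * ?g" using s[of 2] c1 c2 by (simp add: o c0 0 numeral_2_eq_2)
  then have "gr 2 ?e $ k = (\<Sum>i\<le>k. \<beta> ^ Suc i * \<beta> ^ Suc (k - i))"
    by (simp add: fps_mult_nth atLeast0AtMost)
  also have "\<dots> = (\<Sum>i\<le>k. \<beta> ^ (k + 2))"
    by (intro sum.cong refl) (simp only: power_add[symmetric], simp)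
  finally show "gr 2 ?e $ k = of_nat (Suc k) * \<beta> ^ (k + 2)" by simp
qed

text \<open>Each factor is 1 plus terms of excess at least 2, so in excess 2 the product becomes a
  sum over the factors. This is the origin of the power sums.\<close>

lemma gr_scalar_factors:
  fixes \<beta>s :: "complex list"
  defines "Z \<equiv> prod_list (map scalar_factor \<beta>s)"
  shows "gr 0 Z = 1" "gr 1 Z = 0" "gr 2 Z $ k = of_nat (Suc k) * (\<Sum>\<beta>\<leftarrow>\<beta>s. \<beta> ^ (k + 2))"
proof -
  have "gr 0 Z = 1 \<and> gr 1 Z = 0 \<and> gr 2 Z $ k = of_nat (Suc k) * (\<Sum>\<beta>\<leftarrow>\<beta>s. \<beta> ^ (k + 2))"
    unfolding Z_def
  proof (induction \<beta>s)
    case Nil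
    then show ?case by (auto simp: fps_eq_iff)
  next
    case (Cons \<beta> \<beta>s)
    have c: "conv (prod_list (map scalar_factor \<beta>s))" by (intro conv_prod_list conv_scalar_factor)
    note g = gr_scalar_factor[of \<beta>]
    show ?case
      using Cons g(2) by (simp add: gr_mult[OF conv_scalar_factor c] g numeral_2_eq_2 distrib_left)
        (use g(3)[of k] in \<open>simp add: numeral_2_eq_2\<close>)
  qed
  then show "gr 0 Z = 1" "gr 1 Z = 0" "gr 2 Z $ k = of_nat (Suc k) * (\<Sum>\<beta>\<leftarrow>\<beta>s. \<beta> ^ (k + 2))" by blast+
qed

section \<open>Tensor products of vector representations\<close>

text \<open>One ring for tensor powers of every length. Functions on all natural numbers, rather
  than on a finite range of codes, leave room for further tensor factors.\<close>

typedef complex_op = "{X :: (nat \<Rightarrow> complex) \<Rightarrow> nat \<Rightarrow> complex.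
    (\<forall>f g. X (\<lambda>x. f x + g x) = (\<lambda>x. X f x + X g x)) \<and> (\<forall>c f. X (\<lambda>x. c * f x) = (\<lambda>x. c * X f x))}"
  by (rule exI[of _ "\<lambda>f. f"]) simp

setup_lifting type_definition_complex_op

instantiation complex_op :: ring_1
begin

lift_definition zero_complex_op :: complex_op is "\<lambda>f x. 0" by simp
lift_definition one_complex_op :: complex_op is "\<lambda>f. f" by simp
lift_definition plus_complex_op :: "complex_op \<Rightarrow> complex_op \<Rightarrow> complex_op" is "\<lambda>X Y f x. X f x + Y f x"
  by (simp add: algebra_simps)
lift_definition minus_complex_op :: "complex_op \<Rightarrow> complex_op \<Rightarrow> complex_op" is "\<lambda>X Y f x. X f x - Y f x"
  by (simp add: algebra_simps)
lift_definition uminus_complex_op :: "complex_op \<Rightarrow> complex_op" is "\<lambda>X f x. - X f x"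
  by (simp add: algebra_simps)
lift_definition times_complex_op :: "complex_op \<Rightarrow> complex_op \<Rightarrow> complex_op" is "\<lambda>X Y f. X (Y f)"
  by simp

instance
proof
  have "(\<lambda>f x. 0) \<noteq> (\<lambda>f :: nat \<Rightarrow> complex. f)"
    by (metis zero_neq_one)
  then show "(0::complex_op) \<noteq> 1" by transfer
qed (transfer; simp add: algebra_simps)+

end

lift_definition scal :: "complex \<Rightarrow> complex_op" is "\<lambda>c f x. c * f x"
  by (simp add: algebra_simps)

text \<open>
  A natural number in base \<open>d\<close> encodes a basis vector of a tensor power of a \<open>d\<close>-dimensional space.
  \<open>unit_op d i j\<close> is the matrix unit on the least significant digit, and \<open>tail_op d X\<close> lets \<open>X\<close>
  act on the remaining ones.
\<close>

lift_definition unit_op :: "nat \<Rightarrow> nat \<Rightarrow> nat \<Rightarrow> complex_op" is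
  "\<lambda>d i j f x. if x mod d = i - 1 then f (d * (x div d) + (j - 1)) else 0"
  by (auto simp: algebra_simps)

lift_definition tail_op :: "nat \<Rightarrow> complex_op \<Rightarrow> complex_op" is
  "\<lambda>d X f x. X (\<lambda>y. f (d * y + x mod d)) (x div d)"
  by auto

lemma rhom_scal: "rhom scal"
  unfolding rhom_def by (intro conjI allI; transfer; simp add: algebra_simps)

lemma scal_central: "scal c * X = X * scal c"
  by transfer simp

lemma scal_inj: "scal a = scal b \<longleftrightarrow> a = b"
proof
  assume "scal a = scal b"
  then have "(\<lambda>(f :: nat \<Rightarrow> complex) x. a * f x) = (\<lambda>f x. b * f x)" by transfer
  then show "a = b" by (drule_tac x = "\<lambda>_. 1" in fun_cong, drule_tac x = 0 in fun_cong) simp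
qed simp

lemma tail_op_scal: "d > 0 \<Longrightarrow> tail_op d (scal c) = scal c"
  by transfer (simp add: mult.commute)

lemma rhom_tail_op:
  assumes d: "d > 0"
  shows "rhom (tail_op d)"
proof -
  have "tail_op d 1 = 1" by transfer simp
  moreover have "tail_op d (X + Y) = tail_op d X + tail_op d Y" for X Y by transfer simp
  moreover have "tail_op d (X * Y) = tail_op d X * tail_op d Y" for X Y
    using d by transfer simp
  ultimately show ?thesis unfolding rhom_def by blast
qed

lemma sum_complex_op_transfer:
  "Rep_complex_op (sum X S) f x = (\<Sum>i\<in>S. Rep_complex_op (X i) f x)"
  by (induction S rule: infinite_finite_induct) (simp_all add: zero_complex_op.rep_eq plus_complex_op.rep_eq)

text \<open>Matrix units act on the last digit and \<open>tail_op\<close> on the others, hence the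
  two commute.\<close>

lemma fusion_ring_complex_op:
  assumes "m + n > 0"
  shows "fusion_ring m n (unit_op (m + n)) (tail_op (m + n))"
proof
  let ?d = "m + n"
  fix i j k l assume ind: "i \<in> idx m n" "j \<in> idx m n" "k \<in> idx m n" "l \<in> idx m n"
  \<comment> \<open>Digits start at 0 and matrix indices at 1; on \<open>idx\<close> the truncated
    subtraction is injective and yields genuine digits.\<close>
  then have "j - 1 < ?d" "(j - 1 = k - 1) = (j = k)" by (auto simp: idx_def)
  then show "unit_op ?d i j * unit_op ?d k l = (if j = k then unit_op ?d i l else 0)"
    using assms by transfer (auto simp: fun_eq_iff)
next
  let ?d = "m + n"
  have "(\<Sum>i\<in>idx m n. Rep_complex_op (unit_op ?d i i) f x) = f x" for f x
  proof -
    \<comment> \<open>Exactly one diagonal unit sees \<open>x\<close>, namely the one belonging to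
      its last digit.\<close>
    have "(\<Sum>i\<in>idx m n. Rep_complex_op (unit_op ?d i i) f x) = (\<Sum>i\<in>idx m n. if i = x mod ?d + 1 then f x else 0)"
      by (intro sum.cong refl) (auto simp: unit_op.rep_eq idx_def)
    also have "\<dots> = f x"
      using assms mod_less_divisor[OF assms, of x] by (simp add: idx_def Suc_le_eq)
    finally show ?thesis .
  qed
  then show "(\<Sum>i\<in>idx m n. unit_op ?d i i) = 1"
    by (intro Rep_complex_op_inject[THEN iffD1] ext) (simp add: sum_complex_op_transfer one_complex_op.rep_eq)
next
  show "rhom (tail_op (m + n))"
    by (rule rhom_tail_op[OF assms])
next
  let ?d = "m + n"
  fix i j x assume "i \<in> idx m n" "j \<in> idx m n"
  then have "j - 1 < ?d" by (auto simp: idx_def)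
  then have d: "(?d * y + (j - 1)) mod ?d = j - 1" "(?d * y + (j - 1)) div ?d = y" for y
    using assms by (simp_all add: div_add1_eq)
  have d': "(?d * y + z mod ?d) mod ?d = z mod ?d" "(?d * y + z mod ?d) div ?d = y" for y z
    using assms by simp_all
  \<comment> \<open>If the last digit is not \<open>i - 1\<close>, then \<open>x\<close> is applied
    to the zero function, and linearity is what makes the result vanish.\<close>
  have z: "Rep_complex_op x (\<lambda>y. 0) = (\<lambda>y. 0)"
  proof -
    have "\<forall>c f. Rep_complex_op x (\<lambda>y. c * f y) = (\<lambda>y. c * Rep_complex_op x f y)" using Rep_complex_op[of x] by blast
    from this[THEN spec, THEN spec, of 0 "\<lambda>_. 0"] show ?thesis by simp
  qed
  show "tail_op ?d x * unit_op ?d i j = unit_op ?d i j * tail_op ?d x"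
  proof (intro Rep_complex_op_inject[THEN iffD1] ext)
    fix f y
    show "Rep_complex_op (tail_op ?d x * unit_op ?d i j) f y = Rep_complex_op (unit_op ?d i j * tail_op ?d x) f y"
      by (cases "y mod ?d = i - 1")
        (simp_all only: times_complex_op.rep_eq unit_op.rep_eq tail_op.rep_eq d d' z if_True if_False refl)
  qed
qed

lemma fps_central:
  fixes f g :: "'r::ring_1 fps"
  assumes "\<And>k x. f $ k * x = x * f $ k"
  shows "f * g = g * f"
proof (rule fps_ext)
  fix k
  show "(f * g) $ k = (g * f) $ k"
    unfolding fps_mult_nth
    by (rule sum.reindex_bij_witness[of _ "\<lambda>i. k - i" "\<lambda>i. k - i"]) (auto simp: assms)
qed

definition emb :: "complex fps fps \<Rightarrow> complex_op fps fps" where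
  "emb = fps_map (fps_map scal)"

lemma rhom_emb: "rhom emb"
  unfolding emb_def by (intro rhom_fps_map rhom_scal)

lemma emb_nth [simp]: "emb c $ k $ q = scal (c $ k $ q)"
  by (simp add: emb_def)

lemma emb_central: "emb c * x = x * emb c"
  by (intro fps_central) (simp add: scal_central)

lemma conv_emb: "conv c \<Longrightarrow> conv (emb c)"
  unfolding emb_def by (rule conv_map[OF rhom_scal])

lemma emb_const_central: "fps_const (emb c) * x = x * fps_const (emb c)"
  by (intro fps_central) (simp add: scal_central)

lemma emb_map_central: "fps_map fps_const (emb c) * x = x * fps_map fps_const (emb c)"
  by (intro fps_central) (simp add: scal_central)

text \<open>The outermost variable is v: \<open>fps_const\<close> regards a series in u as constant
  in v, and \<open>fps_map fps_const\<close> renames u to v. The partial fraction identity required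
  by \<open>RTT_vec\<close> is proved over the commutative scalars and then carried to operators by
  \<open>emb\<close>.\<close>

lemma pole_difference:
  "(fps_const fps_X - fps_X) * (fps_const (emb (pole \<beta>)) * fps_map fps_const (emb (pole \<beta>))) =
    fps_const (emb (pole \<beta>)) - fps_map fps_const (emb (pole \<beta>))"
proof -
  let ?a = "fps_const (eps \<beta>)" and ?U = "fps_const (geom \<beta>)" and ?V = "fps_map fps_const (geom \<beta>)"
  have gen: "(x - y) * ((a * U) * (a * V)) = a * U - a * V" if "(1 - a * x) * U = 1" "(1 - a * y) * V = 1"
    for a x y U V :: "complex fps fps fps"
  proof -
    have "a * U - a * V = a * U * ((1 - a * y) * V) - a * V * ((1 - a * x) * U)" by (simp add: that)
    also have "\<dots> = (x - y) * ((a * U) * (a * V))" by (simp add: algebra_simps)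
    finally show ?thesis by simp
  qed
  note h1 = rhomD[OF rhom_fps_const] and h2 = rhomD[OF rhom_fps_map[OF rhom_fps_const]]
  have 1: "(1 - ?a * fps_const fps_X) * ?U = 1"
    using arg_cong[OF geom_eq[of \<beta>], of fps_const] unfolding h1(1,3,6) .
  have 2: "(1 - ?a * fps_X) * ?V = 1"
    using arg_cong[OF geom_eq[of \<beta>], of "fps_map fps_const"]
    unfolding h2(1,3,6) fps_map_const[OF rhom_fps_const] fps_map_X[OF rhom_fps_const] .
  have 3: "fps_const (pole \<beta>) = ?a * ?U" unfolding pole_def h1 by (rule refl)
  have 4: "fps_map fps_const (pole \<beta>) = ?a * ?V"
    unfolding pole_def h2 fps_map_const[OF rhom_fps_const] by (rule refl)
  have e: "(fps_const fps_X - fps_X) * (fps_const (pole \<beta>) * fps_map fps_const (pole \<beta>)) =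
     fps_const (pole \<beta>) - fps_map fps_const (pole \<beta>)"
    unfolding 3 4 by (rule gen[OF 1 2])
  note h3 = rhomD[OF rhom_fps_map[OF rhom_emb]]
  have 5: "fps_map emb (fps_map fps_const (pole \<beta>)) = fps_map fps_const (emb (pole \<beta>))"
    by (auto simp: fps_eq_iff emb_def rhomD(4)[OF rhom_scal])
  have 6: "fps_map emb (fps_const fps_X) = fps_const fps_X"
    unfolding fps_map_const[OF rhom_emb] unfolding emb_def fps_map_X[OF rhom_fps_map[OF rhom_scal]] by (rule refl)
  have 7: "emb fps_X = fps_X" unfolding emb_def by (rule fps_map_X[OF rhom_fps_map[OF rhom_scal]])
  show ?thesis
    using arg_cong[OF e, of "fps_map emb"]
    unfolding h3(3,6) 5 6 fps_map_X[OF rhom_emb] fps_map_const[OF rhom_emb] 7 .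
qed

text \<open>The same fusion at three levels of scalars: \<open>L\<close> over the numbers,
  \<open>L2\<close> over series in \<epsilon> and u, and \<open>L3\<close> with v adjoined, where
  the defining relation lives.\<close>

locale nontrivial_dims =
  fixes m n :: nat
  assumes dims: "m + n > 0"
begin

sublocale L: fusion_ring m n "unit_op (m + n)" "tail_op (m + n)"
  by (rule fusion_ring_complex_op[OF dims])

sublocale L2: fusion_ring m n "\<lambda>i j. fps_const (fps_const (unit_op (m + n) i j))" "fps_map (fps_map (tail_op (m + n)))"
  by (rule fusion_ring.lift[OF L.lift])

sublocale L3: fusion_ring m n "\<lambda>i j. fps_const (fps_const (fps_const (unit_op (m + n) i j)))"
    "fps_map (fps_map (fps_map (tail_op (m + n))))"
  by (rule L2.lift)

lemma tail_emb: "fps_map (fps_map (tail_op (m + n))) (emb c) = emb c"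
  by (simp add: emb_def fps_eq_iff tail_op_scal[OF dims])

section \<open>Monodromy matrices of tensor products\<close>

primrec monodromy :: "complex list \<Rightarrow> nat \<Rightarrow> nat \<Rightarrow> complex_op fps fps" where
  "monodromy [] = (\<lambda>i j. if i = j then 1 else 0)"
| "monodromy (\<beta> # \<beta>s) = L2.fuse (emb (pole \<beta>)) (monodromy \<beta>s)"

primrec monodromy_inv :: "complex list \<Rightarrow> nat \<Rightarrow> nat \<Rightarrow> complex_op fps fps" where
  "monodromy_inv [] = (\<lambda>i j. if i = j then 1 else 0)"
| "monodromy_inv (\<beta> # \<beta>s) = L2.fuse_inv (emb (pole \<beta>)) (emb (scalar_factor \<beta>)) (monodromy_inv \<beta>s)"

lemma conv_sign: "conv f \<Longrightarrow> conv ((-1) ^ k * f)"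
  by (simp add: minus_one_power_iff conv_uminus)

lemma shift_sign: "shift c ((-1) ^ k * f) = (-1) ^ k * shift c f"
  by (simp add: minus_one_power_iff shift_uminus)

lemma conv_vec: "conv c \<Longrightarrow> conv (L2.vec c i j)"
  unfolding L2.vec_def
  by (intro conv_add conv_sign conv_mult conv_const) (auto simp: conv_one conv_const[of 0, simplified])

lemma G_const: "L2.G ^ k = fps_const (fps_const (L.G ^ k))"
proof -
  have "rhom (\<lambda>x :: complex_op. fps_const (fps_const x))" by (simp add: rhom_def)
  note h = rhomD[OF this]
  have "L2.G = fps_const (fps_const L.G)"
    unfolding L2.G_def L.G_def h(8) h(3) h(7) by (rule refl)
  then show ?thesis by (simp only: h(9))
qed

lemma conv_fuse:
  assumes "conv c" "\<And>i j. conv (t i j)"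
  shows "conv (L2.fuse c t i j)"
  unfolding L2.fuse_def G_const
  by (intro conv_sum conv_mult conv_const conv_vec conv_map L.rhom_sh assms)

lemma shift_fuse:
  assumes "conv c" "\<And>i j. conv (t i j)"
  shows "shift k (L2.fuse c t i j) = L2.fuse (shift k c) (\<lambda>i j. shift k (t i j)) i j"
proof -
  have one: "shift k (if i = j then 1 else 0) = (if i = j then 1 else 0 :: complex_op fps fps)" for i j :: nat
    using shift_const[of k "1 :: complex_op fps"] by (simp add: shift_zero)
  have v: "shift k (L2.vec c i j) = L2.vec (shift k c) i j" for i j
    unfolding L2.vec_def shift_add shift_sign one
    by (simp add: shift_mult assms(1) conv_const shift_const)
  show ?thesis
    unfolding L2.fuse_def shift_sum
    by (intro sum.cong refl)
      (simp add: G_const shift_mult conv_vec conv_mult conv_const conv_map L.rhom_sh assms shift_const shift_map v)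
qed

lemma conv_monodromy: "conv (monodromy \<beta>s i j)"
proof (induction \<beta>s arbitrary: i j)
  case (Cons \<beta> \<beta>s)
  then show ?case by (auto intro: conv_fuse conv_emb conv_pole)
qed (auto simp: conv_one conv_const[of 0, simplified])

lemma shift_emb: "shift c (emb f) = emb (shift c f)"
  unfolding emb_def by (rule shift_map[OF rhom_scal])

lemma monodromy_inverse:
  assumes "i \<in> idx m n" "k \<in> idx m n"
  shows "(\<Sum>j\<in>idx m n. monodromy_inv \<beta>s i j * monodromy \<beta>s j k) = (if i = k then 1 else 0)"
  using assms
proof (induction \<beta>s arbitrary: i k)
  case Nil
  then show ?case by (auto simp: if_distrib[where f = "\<lambda>x. x * _"] cong: if_cong)
next
  case (Cons \<beta> \<beta>s)
  have "emb (scalar_factor \<beta>) * (1 - emb (pole \<beta>) * emb (pole \<beta>)) = 1"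
    using arg_cong[OF scalar_factor_eq[of \<beta>], of emb] unfolding rhomD(1,3,6)[OF rhom_emb] .
  then show ?case unfolding monodromy.simps monodromy_inv.simps
    by (intro L2.fuse_inverse emb_central Cons) 
qed

text \<open>Each application of \<open>fuse_crossing\<close> contributes one
  \<open>scalar_factor\<close>. The induction closes because the value for the tail is a scalar and
  as such is fixed by \<open>tail_op\<close>.\<close>

lemma monodromy_crossing:
  assumes j: "j \<in> idx m n"
  shows "(\<Sum>l\<in>idx m n. (-1) ^ (par m j + par m l) * (shift (int m - int n) (monodromy \<beta>s l j) * monodromy_inv \<beta>s j l)) =
    emb (prod_list (map scalar_factor \<beta>s))"
proof (induction \<beta>s)
  case Nil
  have "shift k (if i = j then 1 else 0) = (if i = j then 1 else 0 :: complex_op fps fps)" for i j :: nat and k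
    using shift_const[of k "1 :: complex_op fps"] by (simp add: shift_zero)
  then show ?case using j by (auto simp: rhomD[OF rhom_emb] if_distrib cong: if_cong)
next
  case (Cons \<beta> \<beta>s)
  let ?k = "int m - int n"
  have e: "shift ?k (monodromy (\<beta> # \<beta>s) l j) = L2.fuse (emb (shift ?k (pole \<beta>))) (\<lambda>i j. shift ?k (monodromy \<beta>s i j)) l j" for l
    unfolding monodromy.simps shift_emb[symmetric] by (intro shift_fuse conv_emb conv_pole conv_monodromy)
  have d: "emb (shift ?k (pole \<beta>)) - emb (pole \<beta>) = of_int ?k * (emb (shift ?k (pole \<beta>)) * emb (pole \<beta>))"
    using arg_cong[OF shift_pole[of ?k \<beta>], of emb] unfolding rhomD(3,6,10)[OF rhom_emb] .
  have p: "emb (prod_list (map scalar_factor (\<beta> # \<beta>s))) = emb (scalar_factor \<beta>) * emb (prod_list (map scalar_factor \<beta>s))"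
    by (simp add: rhomD(3)[OF rhom_emb])
  show ?case unfolding e p monodromy_inv.simps
    by (intro L2.fuse_crossing[OF _ _ d] emb_central tail_emb j Cons.IH)
qed

text \<open>\<open>conv\<close> alone makes the coefficient of u^(r-1) divisible by \<epsilon>^(r-1)
  only. Poles have positive excess, so the part of excess 0 is that of the identity matrix;
  subtracting it gains the missing power of \<epsilon> for the image of t^(-r).\<close>

lemma gr_monodromy:
  assumes "i \<in> idx m n" "j \<in> idx m n"
  shows "gr 0 (monodromy \<beta>s i j) = (if i = j then 1 else 0)"
  using assms
proof (induction \<beta>s arbitrary: i j)
  case Nil
  then show ?case by (auto simp: fps_eq_iff)
next
  case (Cons \<beta> \<beta>s)
  have s: "gr 0 ((-1) ^ k * f) = (-1) ^ k * gr 0 f" for k and f :: "complex_op fps fps"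
    by (auto simp: minus_one_power_iff fps_eq_iff)
  have su: "gr 0 (sum f S) = (\<Sum>i\<in>S. gr 0 (f i))" for f :: "nat \<Rightarrow> complex_op fps fps" and S
    by (induction S rule: infinite_finite_induct) (simp_all add: gr_add, simp_all add: fps_eq_iff)
  have g: "gr 0 (emb (pole \<beta>)) = 0"
    using gr_pole(1)[of \<beta>] by (auto simp: fps_eq_iff emb_def rhomD(4)[OF rhom_scal])
  have k: "gr 0 (fps_const (fps_const x)) = fps_const x" for x :: complex_op
    by (auto simp: fps_eq_iff)
  have mp: "gr 0 (fps_map (fps_map h) f) = fps_map h (gr 0 f)" for h and f :: "complex_op fps fps"
    by (auto simp: fps_eq_iff)
  have v: "gr 0 (L2.vec (emb (pole \<beta>)) i a) = (if i = a then 1 else 0)" for i a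
  proof -
    have "gr 0 (if i = a then 1 else 0 :: complex_op fps fps) = (if i = a then 1 else 0)" by (auto simp: fps_eq_iff)
    then show ?thesis unfolding L2.vec_def gr_add s
      by (simp add: gr_mult conv_emb conv_pole conv_const g)
  qed
  have "gr 0 (monodromy (\<beta> # \<beta>s) i j) = (\<Sum>a\<in>idx m n. (if i = a then 1 else 0) *
     (fps_const (L.G ^ (par m a + par m j)) * fps_map (tail_op (m + n)) (if a = j then 1 else 0)))"
    unfolding monodromy.simps L2.fuse_def su
    using Cons by (intro sum.cong refl)
      (simp add: gr_mult conv_vec conv_emb conv_pole conv_mult G_const conv_const conv_map L.rhom_sh conv_monodromy v k mp)
  also have "\<dots> = (if i = j then 1 else 0)"
    using Cons.prems rhomD(1,4)[OF rhom_fps_map[OF L.rhom_sh]]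
    by (auto simp: L.G_power if_distrib[where f = "\<lambda>x. x * _"] cong: if_cong)
  finally show ?case .
qed

text \<open>Induction with \<open>RTT_fuse\<close> over \<open>L3\<close>; by
  \<open>fuse_hom\<close> the two embeddings of series in u commute with fusion.\<close>

lemma RTT_monodromy: "RTT m n (fps_const fps_X - fps_X) (\<lambda>i j. fps_const (monodromy \<beta>s i j)) (\<lambda>i j. fps_map fps_const (monodromy \<beta>s i j))"
proof (induction \<beta>s)
  case Nil
  have "fps_const (monodromy [] i j) = (if i = j then 1 else 0)" "fps_map fps_const (monodromy [] i j) = (if i = j then 1 else 0)" for i j
    using rhomD(1,4)[OF rhom_fps_map[OF rhom_fps_const]] by auto
  then show ?case by (auto simp: RTT_def minus_one_power_iff)
next
  case (Cons \<beta> \<beta>s)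
  let ?sh1 = "fps_map (tail_op (m + n))"
  note sh1 = rhom_fps_map[OF L.rhom_sh]
  note sh2 = rhom_fps_map[OF sh1]
  note sh3 = rhom_fps_map[OF sh2]
  have u: "fps_const (monodromy (\<beta> # \<beta>s) i j) = L3.fuse (fps_const (emb (pole \<beta>))) (\<lambda>i j. fps_const (monodromy \<beta>s i j)) i j"
    if "i \<in> idx m n" "j \<in> idx m n" for i j
    unfolding monodromy.simps
    by (rule fuse_hom[OF L2.fusion_ring_axioms L3.fusion_ring_axioms rhom_fps_const _ _ that])
      (simp_all add: fps_map_const[OF sh2])
  have v: "fps_map fps_const (monodromy (\<beta> # \<beta>s) i j) = L3.fuse (fps_map fps_const (emb (pole \<beta>))) (\<lambda>i j. fps_map fps_const (monodromy \<beta>s i j)) i j"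
    if "i \<in> idx m n" "j \<in> idx m n" for i j
    unfolding monodromy.simps
    by (rule fuse_hom[OF L2.fusion_ring_axioms L3.fusion_ring_axioms rhom_fps_map[OF rhom_fps_const] _ _ that])
      (auto simp: fps_map_const[OF rhom_fps_const] fps_eq_iff rhomD(4)[OF L.rhom_sh])
  have w: "fps_map (fps_map ?sh1) (fps_const fps_X - fps_X) = fps_const fps_X - fps_X"
    unfolding rhomD(6)[OF sh3] fps_map_const[OF sh2] fps_map_X[OF sh1] fps_map_X[OF sh2] by (rule refl)
  have wc: "(fps_const fps_X - fps_X) * x = x * (fps_const fps_X - fps_X)" for x :: "complex_op fps fps fps"
  proof -
    have X: "fps_X * y = y * fps_X" for y :: "'a::ring_1 fps" by (rule fps_central) (simp add: fps_X_def)
    then have "fps_const fps_X * x = x * fps_const fps_X" by (intro fps_central) auto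
    then show ?thesis using X[of x] by (simp add: left_diff_distrib right_diff_distrib)
  qed
  have "RTT m n (fps_const fps_X - fps_X) (L3.fuse (fps_const (emb (pole \<beta>))) (\<lambda>i j. fps_const (monodromy \<beta>s i j)))
     (L3.fuse (fps_map fps_const (emb (pole \<beta>))) (\<lambda>i j. fps_map fps_const (monodromy \<beta>s i j)))"
    by (rule L3.RTT_fuse[OF emb_const_central emb_map_central pole_difference wc w Cons.IH])
  then show ?case unfolding RTT_def using u v by simp
qed

end

section \<open>The representation of the extended dual Yangian\<close>

lemma fps_order_mult:
  fixes f g :: "'r::ring_1 fps"
  assumes "\<And>q. q < a \<Longrightarrow> f $ q = 0" "\<And>q. q < b \<Longrightarrow> g $ q = 0" "q < a + b"
  shows "(f * g) $ q = 0"
  unfolding fps_mult_nth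
proof (rule sum.neutral, rule ballI)
  fix i assume "i \<in> {0..q}"
  then have "i < a \<or> q - i < b" using assms(3) by auto
  then show "f $ i * g $ (q - i) = 0" using assms(1,2) by auto
qed

text \<open>Inserts the signs by which the entries of \<open>T_plus\<close> differ from the series
  t_ij^+(u). The exponents matter modulo 2 only, so sixteen parity patterns are checked.\<close>

lemma RTT_sign_change:
  fixes W P Q R S T U :: "'r::ring_1" and i j k l :: nat
  assumes "(-1) ^ ((i + j) * (k + l)) * (W * (P * Q)) - (-1) ^ (i * j + i * l + j * l) * (R * S) =
      W * (Q * P) - (-1) ^ (i * j + i * l + j * l) * (T * U)"
  shows "(-1) ^ ((i + j) * (k + l)) * (W * ((-1) ^ (i * j + j) * P) * ((-1) ^ (k * l + l) * Q)) -
      (-1) ^ (k + (k + j) * (k + l)) * ((-1) ^ (k * j + j) * R * ((-1) ^ (i * l + l) * S)) =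
    W * ((-1) ^ (k * l + l) * Q * ((-1) ^ (i * j + j) * P)) -
      (-1) ^ (k + (k + j) * (k + l)) * ((-1) ^ (k * j + j) * T * ((-1) ^ (i * l + l) * U))"
  using assms
  by (cases "even i"; cases "even j"; cases "even k"; cases "even l"; simp add: minus_one_power_iff mult.assoc)
    (simp_all add: algebra_simps)

lemma (in superalg) one_tensor_mult:
  assumes "a \<in> carrier A" "b \<in> carrier A"
  shows "one_tensor m n A a \<otimes>\<^bsub>End_tensor m n A\<^esub> one_tensor m n A b = one_tensor m n A (a \<otimes> b)"
proof (intro ext)
  fix i l
  have "(\<Oplus>j\<in>idx m n. tw (par m j + par m l) (if i \<in> idx m n \<and> i = j then a else \<zero>) \<otimes>
      (if j \<in> idx m n \<and> j = l then b else \<zero>)) =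
    (\<Oplus>j\<in>idx m n. if i = j then (if i = l then a \<otimes> b else \<zero>) else \<zero>)"
    by (rule finsum_cong') (use assms in \<open>auto simp: tw_def\<close>)
  also have "i \<in> idx m n \<Longrightarrow> \<dots> = (if i = l then a \<otimes> b else \<zero>)"
    using assms by (subst finsum_singleton) auto
  finally show "(one_tensor m n A a \<otimes>\<^bsub>End_tensor m n A\<^esub> one_tensor m n A b) i l = one_tensor m n A (a \<otimes> b) i l"
    unfolding End_tensor_mult one_tensor_def by auto
qed

text \<open>The embedding into the second copy is multiplicative, so the inverse in
  \<open>is_z_plus\<close> can be computed before embedding.\<close>

lemma (in superalg) inv_copy2:
  assumes T: "T \<in> carrier (End_tensor m n A)" and S: "S \<in> carrier (End_tensor m n A)"
    and TS: "T \<otimes>\<^bsub>End_tensor m n A\<^esub> S = \<one>\<^bsub>End_tensor m n A\<^esub>" "S \<otimes>\<^bsub>End_tensor m n A\<^esub> T = \<one>\<^bsub>End_tensor m n A\<^esub>"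
  shows "inv\<^bsub>End2_tensor m n A\<^esub> (copy2 m n A T) = copy2 m n A S"
proof -
  interpret E: superalg "End_tensor m n A" by (rule superalg_End_tensor)
  interpret E2: superalg "End2_tensor m n A" by (rule E.superalg_End_tensor)
  have o: "one_tensor m n (End_tensor m n A) \<one>\<^bsub>End_tensor m n A\<^esub> = \<one>\<^bsub>End2_tensor m n A\<^esub>"
    unfolding one_tensor_def End_tensor_simps(3)[of m n "End_tensor m n A"] by (rule refl)
  have "copy2 m n A T \<otimes>\<^bsub>End2_tensor m n A\<^esub> copy2 m n A S = \<one>\<^bsub>End2_tensor m n A\<^esub>"
    unfolding copy2_def E.one_tensor_mult[OF T S] TS by (rule o)
  moreover have "copy2 m n A S \<otimes>\<^bsub>End2_tensor m n A\<^esub> copy2 m n A T = \<one>\<^bsub>End2_tensor m n A\<^esub>"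
    unfolding copy2_def E.one_tensor_mult[OF S T] TS by (rule o)
  ultimately show ?thesis
    by (intro E2.inv_char copy2_closed T S)
qed

section \<open>Convergent sums in the completion\<close>

context filtered_superalg begin

interpretation C: superalg C by (rule superalg_completion)

text \<open>Only the terms of index at most \<open>p\<close> are visible at level \<open>p\<close>,
  so the partial sums become constant and the description by \<open>THE\<close> has a unique
  solution. The term of index 0 is exempt from the vanishing condition because the constant
  coefficient of the generator matrix contains 1.\<close>

lemma completed_sum_eq:
  assumes x: "\<And>s. x s \<in> carrier C" "\<And>s p. 1 \<le> s \<Longrightarrow> p \<le> s \<Longrightarrow> x s p = \<zero>\<^bsub>super_quot A (F p)\<^esub>"
    and N: "p < N"
  shows "completed_sum C x p = (\<Oplus>\<^bsub>C\<^esub>s\<in>{..<N}. x s) p"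
proof -
  have step: "(\<Oplus>\<^bsub>C\<^esub>s\<in>{..<Suc k}. x s) p = (\<Oplus>\<^bsub>C\<^esub>s\<in>{..<k}. x s) p" if "p < k" for k
  proof -
    have "(\<Oplus>\<^bsub>C\<^esub>s\<in>{..<Suc k}. x s) = x k \<oplus>\<^bsub>C\<^esub> (\<Oplus>\<^bsub>C\<^esub>s\<in>{..<k}. x s)"
      unfolding lessThan_Suc by (rule C.finsum_insert) (use x in auto)
    moreover have "(\<Oplus>\<^bsub>C\<^esub>s\<in>{..<k}. x s) \<in> carrier C" using x(1) by (intro C.finsum_closed) auto
    ultimately show ?thesis using x(2)[of k p] that completion_level by simp
  qed
  have const: "(\<Oplus>\<^bsub>C\<^esub>s\<in>{..<k}. x s) p = (\<Oplus>\<^bsub>C\<^esub>s\<in>{..<Suc p}. x s) p" if "Suc p \<le> k" for k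
    using that by (induction k rule: dec_induct) (simp_all add: step)
  have "completed_sum C x p = (\<Oplus>\<^bsub>C\<^esub>s\<in>{..<Suc p}. x s) p"
    unfolding completed_sum_def
  proof (rule the_equality)
    show "\<exists>N0. \<forall>N\<ge>N0. (\<Oplus>\<^bsub>C\<^esub>s\<in>{..<N}. x s) p = (\<Oplus>\<^bsub>C\<^esub>s\<in>{..<Suc p}. x s) p" using const by blast
    fix a assume "\<exists>N0. \<forall>N\<ge>N0. (\<Oplus>\<^bsub>C\<^esub>s\<in>{..<N}. x s) p = a"
    then obtain N0 where "\<And>N. N \<ge> N0 \<Longrightarrow> (\<Oplus>\<^bsub>C\<^esub>s\<in>{..<N}. x s) p = a" by blast
    from this[of "max N0 (Suc p)"] show "a = (\<Oplus>\<^bsub>C\<^esub>s\<in>{..<Suc p}. x s) p" using const[of "max N0 (Suc p)"] by simp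
  qed
  then show ?thesis using const[of N] N by simp
qed

lemma completed_sum_closed:
  assumes x: "\<And>s. x s \<in> carrier C" "\<And>s p. 1 \<le> s \<Longrightarrow> p \<le> s \<Longrightarrow> x s p = \<zero>\<^bsub>super_quot A (F p)\<^esub>"
  shows "completed_sum C x \<in> carrier C"
  unfolding completion_carrier
proof
  fix p
  have "(\<Oplus>\<^bsub>C\<^esub>s\<in>{..<Suc p}. x s) \<in> carrier C" using x(1) by (intro C.finsum_closed) auto
  then obtain a where a: "a \<in> carrier A" "\<And>q. q \<le> p \<Longrightarrow> (\<Oplus>\<^bsub>C\<^esub>s\<in>{..<Suc p}. x s) q = F q +> a"
    using completion_rep[of "\<Oplus>\<^bsub>C\<^esub>s\<in>{..<Suc p}. x s" p] by blast
  have "completed_sum C x q = F q +> a" if "q \<le> p" for q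
    using completed_sum_eq[OF x, where p = q and N = "Suc p"] a(2)[OF that] that by simp
  then show "\<exists>a\<in>carrier A. \<forall>q\<le>p. completed_sum C x q = F q +> a" using a(1) by blast
qed

lemma signed_level:
  assumes "x \<in> carrier C"
  shows "signed C k x p = signed (super_quot A (F p)) k (x p)"
proof -
  have "(\<ominus>\<^bsub>C\<^esub> x \<oplus>\<^bsub>C\<^esub> x) p = \<zero>\<^bsub>C\<^esub> p" by (simp only: C.l_neg[OF assms])
  then have "(\<ominus>\<^bsub>C\<^esub> x) p = \<ominus>\<^bsub>super_quot A (F p)\<^esub> x p"
    using completion_level[OF assms] completion_level[OF C.a_inv_closed[OF assms]]
    by (intro Q.minus_equality[symmetric]) simp_all
  then show ?thesis by (simp add: signed_def)
qed

lemma completed_sum_signed: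
  assumes x: "\<And>s. x s \<in> carrier C" "\<And>s p. 1 \<le> s \<Longrightarrow> p \<le> s \<Longrightarrow> x s p = \<zero>\<^bsub>super_quot A (F p)\<^esub>"
    and i: "\<And>s. invol C (x s) = signed C k (x s)"
  shows "invol C (completed_sum C x) = signed C k (completed_sum C x)"
proof
  fix p
  let ?S = "\<Oplus>\<^bsub>C\<^esub>s\<in>{..<Suc p}. x s"
  have S: "?S \<in> carrier C" using x(1) by (intro C.finsum_closed) auto
  have e: "completed_sum C x p = ?S p" by (rule completed_sum_eq[OF x lessI])
  have "invol C ?S = signed C k ?S"
    using x(1) by (subst C.invol_finsum) (auto simp: i C.signed_finsum simp del: completion_simps)
  then have "invol C ?S p = signed C k ?S p" by simp
  then show "invol C (completed_sum C x) p = signed C k (completed_sum C x) p"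
    using signed_level[OF S] signed_level[OF completed_sum_closed[OF x]] by (simp add: e)
qed

end

section \<open>The action of the free superalgebra and its extension to the completion\<close>

locale yangian_rep = nontrivial_dims m n for m n :: nat +
  fixes \<beta>s :: "complex list"
begin

abbreviation "A0 \<equiv> free_superalgebra m n"
abbreviation "D \<equiv> dual_yangian m n"
abbreviation "Fil \<equiv> dual_yangian_filtration m n"
abbreviation "Y \<equiv> ext_dual_yangian m n"

sublocale A0: superalg A0 by (rule superalg_free)
sublocale I: super_ideal A0 "RTT_ideal m n" by (rule super_ideal_RTT)
sublocale D: filtered_superalg D Fil by (rule filtered_dual_yangian)

lemma Y_eq: "Y = completion D Fil"
  by (simp add: ext_dual_yangian_def)

sublocale Y: superalg Y
  unfolding Y_eq by (rule D.superalg_completion)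

text \<open>The equation t^+(u) = \<delta> - \<Sum> t^(-r) u^(r-1), solved for the coefficients with
  the monodromy matrix on its left.\<close>

definition genval :: "gen \<Rightarrow> complex_op fps" where
  "genval = (\<lambda>(i, j, r). (if i = j \<and> r = 1 then 1 else 0) - monodromy \<beta>s i j $ (r - 1))"

definition act :: "free_alg \<Rightarrow> complex_op fps" where
  "act = lin_ext (\<lambda>w c. fps_const (scal c) * prod_list (map genval (letters w)))"

lemma scal_fps_central: "fps_const (scal c) * x = x * fps_const (scal c)"
  by (intro fps_central) (simp add: scal_central)

lemma act_add: "act (f + g) = act f + act g"
  unfolding act_def by (rule lin_ext_add) (simp add: rhomD(2)[OF rhom_scal] distrib_right flip: fps_const_add)

lemma act_mult: "act (f * g) = act f * act g"
  unfolding act_def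
proof (rule lin_ext_mult)
  fix v w :: "gen word" and a b :: complex
  let ?P = "\<lambda>w. prod_list (map genval (letters w))"
  have "fps_const (scal (a * b)) = fps_const (scal a) * fps_const (scal b)"
    by (simp add: rhomD(3)[OF rhom_scal])
  then show "fps_const (scal (a * b)) * ?P (v + w) = fps_const (scal a) * ?P v * (fps_const (scal b) * ?P w)"
    by (simp only: letters_plus map_append prod_list.append mult.assoc
        central_left_commute[of "fps_const (scal b)", OF scal_fps_central])
qed (simp add: rhomD(2)[OF rhom_scal] distrib_right flip: fps_const_add)

lemma act_single: "act (Poly_Mapping.single w c) = fps_const (scal c) * prod_list (map genval (letters w))"
  unfolding act_def by (rule lin_ext_single) (simp add: rhomD(2)[OF rhom_scal] distrib_right flip: fps_const_add)

lemma act_scalar: "act (Poly_Mapping.single 0 c) = fps_const (scal c)"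
  by (simp add: act_single)

lemma act_one: "act 1 = 1"
  using act_scalar[of 1] by (simp add: rhomD(1)[OF rhom_scal])

lemma act_gen: "act (free_gen i j r) = genval (i, j, r)"
  by (simp add: free_gen_def act_single rhomD(1)[OF rhom_scal])

lemma ring_map_act: "ring_map A0 act"
  by (rule ring_mapI) (simp_all add: act_one act_add act_mult)

lemma genval_order:
  assumes "(i, j, r) \<in> gens m n" "q < r"
  shows "genval (i, j, r) $ q = 0"
proof -
  have ij: "i \<in> idx m n" "j \<in> idx m n" "1 \<le> r" using assms by (auto simp: gens_def)
  show ?thesis
  proof (cases "q < r - 1")
    case True
    then show ?thesis using convD[OF conv_monodromy True, of \<beta>s i j] by (auto simp: genval_def)
  next
    case False
    then have "q = r - 1" using assms by simp
    moreover have "monodromy \<beta>s i j $ (r - 1) $ (r - 1) = (if i = j then 1 else 0) $ (r - 1)"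
      using gr_monodromy[OF ij(1,2), of \<beta>s] gr_nth[of 0 "monodromy \<beta>s i j" "r - 1"] by simp
    ultimately show ?thesis using ij(3) by (auto simp: genval_def)
  qed
qed

text \<open>Continuity of the action: degree in the filtration becomes order in \<epsilon>, as this
  holds for each generator and orders add in products.\<close>

lemma act_order:
  assumes "f \<in> free_degree_ge m n p" "q < p"
  shows "act f $ q = 0"
proof -
  have w: "prod_list (map genval xs) $ q = 0" if "set xs \<subseteq> gens m n" "q < (\<Sum>(i, j, r)\<leftarrow>xs. r)" for xs q
    using that
  proof (induction xs arbitrary: q)
    case (Cons x xs)
    obtain i j r where x: "x = (i, j, r)" by (cases x)
    show ?case unfolding list.map prod_list.Cons x
      by (rule fps_order_mult[of r _ "\<Sum>(i, j, r)\<leftarrow>xs. r"]) (use Cons x genval_order in auto)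
  qed simp
  show ?thesis
    unfolding act_def lin_ext_def fps_sum_nth
  proof (rule sum.neutral, rule ballI)
    fix v assume v: "v \<in> Poly_Mapping.keys f"
    have "prod_list (map genval (letters v)) $ q = 0"
      by (rule w) (use assms v in \<open>auto simp: free_degree_ge_def word_degree_def\<close>)
    then show "(fps_const (scal (Poly_Mapping.lookup f v)) * prod_list (map genval (letters v))) $ q = 0" by simp
  qed
qed

lemma act_T_plus:
  assumes "i \<in> idx m n" "j \<in> idx m n"
  shows "Abs_fps (\<lambda>k. act (T_plus m n A0 free_gen i j k)) = (-1) ^ (par m i * par m j + par m j) * monodromy \<beta>s i j"
proof (rule fps_ext)
  fix k :: nat
  have c: "(if i = j \<and> k = 0 then \<one>\<^bsub>A0\<^esub> else \<zero>\<^bsub>A0\<^esub>) \<in> carrier A0" by simp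
  have "act (T_plus m n A0 free_gen i j k) = (-1) ^ (par m i * par m j + par m j) *
     ((if i = j \<and> k = 0 then 1 else 0) - genval (i, j, Suc k))"
    unfolding A0.T_plus_apply(1)[OF free_gen_family assms]
    using A0.ring_map_signed[OF ring_map_act A0.minus_closed[OF c free_gen_closed[OF assms, of k]]]
      A0.ring_map_minus[OF ring_map_act c free_gen_closed[OF assms, of k]]
    by (simp add: act_gen act_one A0.ring_map_zero[OF ring_map_act, simplified] del: free_simps(1))
  then show "Abs_fps (\<lambda>k. act (T_plus m n A0 free_gen i j k)) $ k = ((-1) ^ (par m i * par m j + par m j) * monodromy \<beta>s i j) $ k"
    by (auto simp: genval_def minus_one_power_iff)
qed

text \<open>Applied coefficientwise, \<open>act\<close> maps series in u and v over the free
  superalgebra to series over operators. There the relation is \<open>RTT_monodromy\<close>, and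
  comparing coefficients returns to the individual generators of the ideal.\<close>

lemma act_RTT: "act (RTT_lhs m n A0 free_gen i j k l q p) = act (RTT_rhs m n A0 free_gen i j k l q p)"
proof (cases "i \<in> idx m n \<and> j \<in> idx m n \<and> k \<in> idx m n \<and> l \<in> idx m n")
  case False
  then show ?thesis using A0.RTT_outside[OF free_gen_family False] by simp
next
  case True
  then have ind: "i \<in> idx m n" "j \<in> idx m n" "k \<in> idx m n" "l \<in> idx m n" by auto
  interpret P: superalg "power_series A0" by (rule A0.superalg_power_series)
  let ?phi = "\<lambda>F. Abs_fps (\<lambda>q. Abs_fps (\<lambda>p. act (F q p)))"
  have phi: "ring_map (power_series2 A0) ?phi"
    using P.ring_map_power_series[OF A0.ring_map_power_series[OF ring_map_act]] .
  have z: "act 0 = 0" using A0.ring_map_zero[OF ring_map_act] by simp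
  have u: "?phi (in_u A0 f) = fps_const (Abs_fps (\<lambda>k. act (f k)))" for f
    by (auto simp: fps_eq_iff in_u_def ps_const_def z)
  have v: "?phi (in_v A0 f) = fps_map fps_const (Abs_fps (\<lambda>k. act (f k)))" for f
    by (auto simp: fps_eq_iff in_v_def ps_const_def z)
  have X: "Abs_fps (\<lambda>k. act (ps_var A0 k)) = fps_X"
    by (auto simp: fps_eq_iff ps_var_def z act_one)
  note h1 = rhomD[OF rhom_fps_const] and h2 = rhomD[OF rhom_fps_map[OF rhom_fps_const]]
  let ?w = "fps_const fps_X - fps_X :: complex_op fps fps fps"
  let ?a = "\<lambda>i j. fps_const (monodromy \<beta>s i j)" and ?b = "\<lambda>i j. fps_map fps_const (monodromy \<beta>s i j)"
  have w: "?phi (in_u A0 (ps_var A0)) - ?phi (in_v A0 (ps_var A0)) = ?w"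
    unfolding u v X by (simp only: fps_map_X[OF rhom_fps_const])
  have a: "?phi (in_u A0 (T_plus m n A0 free_gen i j)) = (-1) ^ (par m i * par m j + par m j) * ?a i j"
    if "i \<in> idx m n" "j \<in> idx m n" for i j
    unfolding u act_T_plus[OF that] h1(3,7) by (rule refl)
  have b: "?phi (in_v A0 (T_plus m n A0 free_gen i j)) = (-1) ^ (par m i * par m j + par m j) * ?b i j"
    if "i \<in> idx m n" "j \<in> idx m n" for i j
    unfolding v act_T_plus[OF that] h2(3,7) by (rule refl)
  have wc: "x * ?w = ?w * x" for x
  proof -
    have X: "fps_X * y = y * fps_X" for y :: "'a::ring_1 fps" by (rule fps_central) (simp add: fps_X_def)
    then have "fps_const fps_X * x = x * fps_const fps_X" by (intro fps_central) auto
    then show ?thesis using X[of x] by (simp add: left_diff_distrib right_diff_distrib)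
  qed
  have "?phi (RTT_lhs m n A0 free_gen i j k l) = ?phi (RTT_rhs m n A0 free_gen i j k l)"
    unfolding A0.map_RTT[OF phi free_gen_family ind] w a[OF ind(1,2)] a[OF ind(3,2)] a[OF ind(1,4)]
      b[OF ind(3,4)] b[OF ind(1,4)] b[OF ind(3,2)] wc
    by (rule RTT_sign_change[OF RTTD[OF RTT_monodromy[of \<beta>s] ind]])
  then have "?phi (RTT_lhs m n A0 free_gen i j k l) $ q $ p = ?phi (RTT_rhs m n A0 free_gen i j k l) $ q $ p" by simp
  then show ?thesis by simp
qed

lemma act_ideal:
  assumes "f \<in> RTT_ideal m n"
  shows "act f = 0"
proof -
  let ?J = "{f \<in> carrier A0. act f = 0}"
  have z: "act 0 = 0" using A0.ring_map_zero[OF ring_map_act] by simp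
  note c = A0.RTT_coeff(1,2)[OF free_gen_family]
  have "ideal ?J A0"
  proof (rule A0.ideal_criterion)
    have "0 \<in> ?J" by (simp add: z)
    then show "?J \<noteq> {}" by blast
    fix a b assume "a \<in> ?J" "b \<in> ?J"
    then show "a \<oplus>\<^bsub>A0\<^esub> b \<in> ?J" using A0.a_closed[of a b] by (simp add: act_add)
  next
    fix a assume a: "a \<in> ?J"
    then show "\<ominus>\<^bsub>A0\<^esub> a \<in> ?J" using A0.a_inv_closed[of a] A0.ring_map_uminus[OF ring_map_act, of a]
      by (simp del: free_simps)
    fix x assume "x \<in> carrier A0"
    then show "x \<otimes>\<^bsub>A0\<^esub> a \<in> ?J" "a \<otimes>\<^bsub>A0\<^esub> x \<in> ?J"
      using a A0.m_closed[of x a] A0.m_closed[of a x] by (simp_all add: act_mult)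
  qed blast
  moreover have "RTT_lhs m n A0 free_gen i j k l q p \<ominus>\<^bsub>A0\<^esub> RTT_rhs m n A0 free_gen i j k l q p \<in> ?J" for i j k l q p
    using A0.minus_closed[OF c] A0.ring_map_minus[OF ring_map_act c] act_RTT by (simp del: free_simps)
  ultimately have "RTT_ideal m n \<subseteq> ?J" by (rule RTT_ideal_minimal)
  then show ?thesis using assms by blast
qed

abbreviation pr :: "free_alg \<Rightarrow> free_alg set" where
  "pr f \<equiv> RTT_ideal m n +>\<^bsub>A0\<^esub> f"

definition rep :: "ext_yangian \<Rightarrow> nat \<Rightarrow> free_alg" where
  "rep x p = (SOME f. f \<in> carrier A0 \<and> x p = Fil p +>\<^bsub>D\<^esub> pr f)"

text \<open>The coefficient of \<epsilon>^q is read at level \<open>q + 1\<close>, where the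
  ambiguity of a representative has order greater than q. \<open>act_cong\<close> makes the choice
  in \<open>rep\<close> immaterial.\<close>

definition \<Phi> :: "ext_yangian \<Rightarrow> complex_op fps" where
  "\<Phi> x = Abs_fps (\<lambda>q. act (rep x (Suc q)) $ q)"

lemma D_carrier: "carrier D = pr ` carrier A0"
  unfolding dual_yangian_def by (rule I.quot_carrier)

lemma obtain_rep:
  assumes "x \<in> carrier Y"
  obtains f where "f \<in> carrier A0" "\<And>q. q \<le> p \<Longrightarrow> x q = Fil q +>\<^bsub>D\<^esub> pr f"
proof -
  obtain a where a: "a \<in> carrier D" "\<And>q. q \<le> p \<Longrightarrow> x q = Fil q +>\<^bsub>D\<^esub> a"
    using D.completion_rep[of x p] assms unfolding Y_eq by metis
  then obtain f where "f \<in> carrier A0" "a = pr f" unfolding D_carrier by blast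
  with a(2) that show ?thesis by blast
qed

text \<open>Representatives of one coset at level \<open>p\<close> differ by a relation, which acts
  by zero, and by an element of degree at least \<open>p\<close>, which acts with order at least
  \<open>p\<close>.\<close>

lemma act_cong:
  assumes f: "f \<in> carrier A0" and g: "g \<in> carrier A0"
    and e: "Fil p +>\<^bsub>D\<^esub> pr f = Fil p +>\<^bsub>D\<^esub> pr g" and q: "q < p"
  shows "act f $ q = act g $ q"
proof -
  have d: "pr f \<in> carrier D" "pr g \<in> carrier D" using f g unfolding D_carrier by blast+
  have "pr f \<in> Fil p +>\<^bsub>D\<^esub> pr f" by (rule D.F.a_rcos_self[OF d(1)])
  then have "pr f \<in> Fil p +>\<^bsub>D\<^esub> pr g" unfolding e .
  then obtain H where H: "H \<in> Fil p" "pr f = H \<oplus>\<^bsub>D\<^esub> pr g" unfolding D.F.coset_mem by blast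
  then obtain h where h: "h \<in> free_degree_ge m n p" "pr f = pr h \<oplus>\<^bsub>D\<^esub> pr g"
    unfolding filtration_eq by blast
  have hc: "h \<in> carrier A0" using h(1) unfolding free_degree_ge_def by blast
  have "pr f = pr (h \<oplus>\<^bsub>A0\<^esub> g)" using h(2) I.quot_add[OF hc g] unfolding dual_yangian_def by simp
  then have "f \<ominus>\<^bsub>A0\<^esub> (h \<oplus>\<^bsub>A0\<^esub> g) \<in> RTT_ideal m n"
    using I.coset_eq_iff[OF f A0.a_closed[OF hc g]] by blast
  from act_ideal[OF this] have "act f = act h + act g"
    using A0.ring_map_minus[OF ring_map_act f A0.a_closed[OF hc g]] by (simp add: act_add)
  then show ?thesis using act_order[OF h(1) q] by simp
qed

lemma \<Phi>_rep:
  assumes x: "x \<in> carrier Y" and f: "f \<in> carrier A0" "x p = Fil p +>\<^bsub>D\<^esub> pr f" and q: "q < p"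
  shows "\<Phi> x $ q = act f $ q"
proof -
  obtain g where g: "g \<in> carrier A0" "\<And>r. r \<le> p \<Longrightarrow> x r = Fil r +>\<^bsub>D\<^esub> pr g"
    using obtain_rep[OF x] by metis
  have "x (Suc q) = Fil (Suc q) +>\<^bsub>D\<^esub> pr g" using g(2) q by simp
  then have "rep x (Suc q) \<in> carrier A0 \<and> x (Suc q) = Fil (Suc q) +>\<^bsub>D\<^esub> pr (rep x (Suc q))"
    unfolding rep_def using g(1) by (intro someI_ex[where P = "\<lambda>f. f \<in> carrier A0 \<and> x (Suc q) = Fil (Suc q) +>\<^bsub>D\<^esub> pr f"]) blast
  then have "act (rep x (Suc q)) $ q = act g $ q"
    using act_cong[OF _ g(1), of "rep x (Suc q)" "Suc q" q] g(2)[of "Suc q"] q by simp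
  also have "\<dots> = act f $ q" using act_cong[OF g(1) f(1) _ q] g(2)[of p] f(2) by simp
  finally show ?thesis by (simp add: \<Phi>_def)
qed

lemma \<Phi>_level:
  assumes "x (Suc q) = y (Suc q)"
  shows "\<Phi> x $ q = \<Phi> y $ q"
  unfolding \<Phi>_def rep_def using assms by simp

lemma \<Phi>_constant:
  assumes "f \<in> carrier A0" "\<And>p. x p = Fil p +>\<^bsub>D\<^esub> pr f" "x \<in> carrier Y"
  shows "\<Phi> x = act f"
  by (rule fps_ext, rule \<Phi>_rep[OF assms(3,1,2) lessI])

lemma ring_map_\<Phi>: "ring_map Y \<Phi>"
proof (rule ring_mapI)
  have pr: "pr f \<in> carrier D" if "f \<in> carrier A0" for f using that unfolding D_carrier by blast
  have "\<one>\<^bsub>Y\<^esub> p = Fil p +>\<^bsub>D\<^esub> pr 1" for p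
    unfolding Y_eq by (simp add: D.F.quot_one I.quot_one[folded dual_yangian_def])
  then show "\<Phi> \<one>\<^bsub>Y\<^esub> = 1"
    using \<Phi>_constant[of 1 "\<one>\<^bsub>Y\<^esub>"] Y.one_closed act_one by simp
  fix x y assume xy: "x \<in> carrier Y" "y \<in> carrier Y"
  have ops: "\<Phi> (x \<oplus>\<^bsub>Y\<^esub> y) $ q = (\<Phi> x + \<Phi> y) $ q \<and> \<Phi> (x \<otimes>\<^bsub>Y\<^esub> y) $ q = (\<Phi> x * \<Phi> y) $ q" for q
  proof -
    obtain f where f: "f \<in> carrier A0" "\<And>r. r \<le> Suc q \<Longrightarrow> x r = Fil r +>\<^bsub>D\<^esub> pr f" using obtain_rep[OF xy(1)] by metis
    obtain g where g: "g \<in> carrier A0" "\<And>r. r \<le> Suc q \<Longrightarrow> y r = Fil r +>\<^bsub>D\<^esub> pr g" using obtain_rep[OF xy(2)] by metis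
    note fg = A0.a_closed[OF f(1) g(1)] A0.m_closed[OF f(1) g(1)]
    have "(x \<oplus>\<^bsub>Y\<^esub> y) (Suc q) = Fil (Suc q) +>\<^bsub>D\<^esub> pr (f \<oplus>\<^bsub>A0\<^esub> g)"
      using f(2)[of "Suc q"] g(2)[of "Suc q"] D.F.quot_add[OF pr[OF f(1)] pr[OF g(1)]] I.quot_add[OF f(1) g(1)]
      unfolding Y_eq by (simp flip: dual_yangian_def)
    then have 1: "\<Phi> (x \<oplus>\<^bsub>Y\<^esub> y) $ q = act (f \<oplus>\<^bsub>A0\<^esub> g) $ q"
      using \<Phi>_rep[OF Y.a_closed[OF xy] fg(1)] by blast
    have "(x \<otimes>\<^bsub>Y\<^esub> y) (Suc q) = Fil (Suc q) +>\<^bsub>D\<^esub> pr (f \<otimes>\<^bsub>A0\<^esub> g)"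
      using f(2)[of "Suc q"] g(2)[of "Suc q"] D.F.quot_mult[OF pr[OF f(1)] pr[OF g(1)]] I.quot_mult[OF f(1) g(1)]
      unfolding Y_eq by (simp flip: dual_yangian_def)
    then have 2: "\<Phi> (x \<otimes>\<^bsub>Y\<^esub> y) $ q = act (f \<otimes>\<^bsub>A0\<^esub> g) $ q"
      using \<Phi>_rep[OF Y.m_closed[OF xy] fg(2)] by blast
    have "\<Phi> x $ r = act f $ r" "\<Phi> y $ r = act g $ r" if "r \<le> q" for r
      using that \<Phi>_rep[OF xy(1) f(1) f(2)[of "Suc q"]] \<Phi>_rep[OF xy(2) g(1) g(2)[of "Suc q"]] by simp_all
    then show ?thesis unfolding 1 2 by (simp add: act_add act_mult fps_mult_nth)
  qed
  show "\<Phi> (x \<oplus>\<^bsub>Y\<^esub> y) = \<Phi> x + \<Phi> y" using ops by (auto simp: fps_eq_iff)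
  show "\<Phi> (x \<otimes>\<^bsub>Y\<^esub> y) = \<Phi> x * \<Phi> y" by (rule fps_ext) (use ops in blast)
qed

end

section \<open>The image of \<open>z\<^sup>+(u)\<close>\<close>

lemma sg_cancel: "(-1) ^ a * x = y \<Longrightarrow> x = (-1) ^ a * (y :: 'r::ring_1)"
  by (auto simp: minus_one_power_iff)

context yangian_rep begin

section \<open>The canonical map from the free superalgebra to the completion\<close>

abbreviation tc :: "free_alg \<Rightarrow> ext_yangian" where
  "tc f \<equiv> to_completion D Fil (pr f)"

lemma tc_closed: "f \<in> carrier A0 \<Longrightarrow> tc f \<in> carrier Y"
  unfolding Y_eq by (rule D.to_completion_closed) (use D_carrier in blast)

lemma \<Phi>_tc: "f \<in> carrier A0 \<Longrightarrow> \<Phi> (tc f) = act f"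
  by (rule \<Phi>_constant[OF _ _ tc_closed]) (simp_all add: to_completion_def)

lemma pr_ops:
  assumes "f \<in> carrier A0" "g \<in> carrier A0"
  shows "pr f \<in> carrier D" "pr f \<oplus>\<^bsub>D\<^esub> pr g = pr (f \<oplus>\<^bsub>A0\<^esub> g)" "invol D (pr f) = pr (invol A0 f)"
  using imageI[OF assms(1), of pr] I.quot_add[OF assms] I.quot_invol[OF assms(1)]
  unfolding D_carrier unfolding dual_yangian_def by simp_all

lemma tc_add:
  assumes "f \<in> carrier A0" "g \<in> carrier A0"
  shows "tc (f \<oplus>\<^bsub>A0\<^esub> g) = tc f \<oplus>\<^bsub>Y\<^esub> tc g"
  using D.F.quot_add[OF pr_ops(1)[OF assms] pr_ops(1)[OF assms(2,1)]] pr_ops(2)[OF assms]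
  unfolding Y_eq by (simp add: to_completion_def del: free_simps)

lemma tc_zero: "tc \<zero>\<^bsub>A0\<^esub> = \<zero>\<^bsub>Y\<^esub>"
proof -
  have "\<zero>\<^bsub>D\<^esub> = pr \<zero>\<^bsub>A0\<^esub>" unfolding dual_yangian_def by (rule I.quot_zero)
  then show ?thesis unfolding Y_eq by (simp add: to_completion_def D.F.quot_zero del: free_simps)
qed

lemma tc_uminus: "f \<in> carrier A0 \<Longrightarrow> tc (\<ominus>\<^bsub>A0\<^esub> f) = \<ominus>\<^bsub>Y\<^esub> tc f"
  using tc_add[of "\<ominus>\<^bsub>A0\<^esub> f" f] A0.l_neg[of f] tc_zero tc_closed A0.a_inv_closed[of f]
  by (intro Y.minus_equality[symmetric]) (simp_all del: free_simps)

lemma tc_signed: "f \<in> carrier A0 \<Longrightarrow> tc (signed A0 k f) = signed Y k (tc f)"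
  by (simp add: signed_def tc_uminus del: free_simps)

lemma tc_invol:
  assumes "f \<in> carrier A0"
  shows "invol Y (tc f) = tc (invol A0 f)"
  using D.F.quot_invol[OF pr_ops(1)[OF assms assms]] pr_ops(3)[OF assms assms]
  unfolding Y_eq by (simp add: to_completion_def del: free_simps)

lemma scalar_tc: "scalar Y c = tc (Poly_Mapping.single 0 c)"
  unfolding Y_eq by (simp add: super_quot_simps dual_yangian_def to_completion_def completion_def)

lemma single_closed: "Poly_Mapping.single 0 c \<in> carrier A0"
  by simp

lemma scalar_closed: "scalar Y c \<in> carrier Y"
  unfolding scalar_tc by (rule tc_closed[OF single_closed])

lemma \<Phi>_scalar: "\<Phi> (scalar Y c) = fps_const (scal c)"
  unfolding scalar_tc \<Phi>_tc[OF single_closed] by (rule act_scalar)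

lemma invol_scalar: "invol Y (scalar Y c) = scalar Y c"
proof -
  have "invol A0 (Poly_Mapping.single 0 c) = Poly_Mapping.single 0 c"
    by (rule poly_mapping_eqI) (simp add: lookup_free_invol lookup_single when_def word_parity_def)
  then show ?thesis unfolding scalar_tc tc_invol[OF single_closed] by simp
qed

abbreviation "gn \<equiv> ext_dual_yangian_gen m n"

lemma gen_tc: "gn i j r = tc (free_gen i j r)"
  by (simp add: ext_dual_yangian_gen_def dual_yangian_gen_def)

lemma gen_family_Y: "Y.gen_family m n gn"
  unfolding Y.gen_family_def gen_tc
proof (intro ballI allI conjI)
  fix i j r assume ij: "i \<in> idx m n" "j \<in> idx m n"
  note c = free_gen_closed[OF ij, of r]
  show "tc (free_gen i j (Suc r)) \<in> carrier Y" by (rule tc_closed[OF c])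
  have "invol A0 (free_gen i j (Suc r)) = signed A0 (par m i + par m j) (free_gen i j (Suc r))"
    using free_gen_family[of m n] ij unfolding A0.gen_family_def by blast
  then show "invol Y (tc (free_gen i j (Suc r))) = signed Y (par m i + par m j) (tc (free_gen i j (Suc r)))"
    unfolding tc_invol[OF c] using tc_signed[OF c] by simp
qed

lemma gen_level:
  assumes "i \<in> idx m n" "j \<in> idx m n" "p \<le> Suc r"
  shows "gn i j (Suc r) p = \<zero>\<^bsub>super_quot D (Fil p)\<^esub>"
proof -
  note c = free_gen_closed[OF assms(1,2), of r]
  have "free_gen i j (Suc r) \<in> free_degree_ge m n p"
    using c assms(3) unfolding free_degree_ge_def by (simp add: free_gen_def word_degree_def)
  then have "pr (free_gen i j (Suc r)) \<in> Fil p" unfolding filtration_eq by blast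
  then show ?thesis
    unfolding gen_tc to_completion_def using D.F.coset_zero_iff[OF pr_ops(1)[OF c c]] by blast
qed

lemma gen_closed: "i \<in> idx m n \<Longrightarrow> j \<in> idx m n \<Longrightarrow> gn i j (Suc r) \<in> carrier Y"
  unfolding gen_tc by (rule tc_closed[OF free_gen_closed])

section \<open>The generator matrix, its inverse and its shift\<close>

abbreviation "T \<equiv> T_plus m n Y gn"
abbreviation "PY \<equiv> power_series Y"

sublocale PY: superalg PY by (rule Y.superalg_power_series)

lemma T_hom: "PY.homogeneous m n T"
  by (rule Y.T_plus_homogeneous[OF gen_family_Y])

lemma T_apply:
  assumes "i \<in> idx m n" "j \<in> idx m n"
  shows "T i j k = signed Y (par m i * par m j + par m j)
     ((if i = j \<and> k = 0 then \<one>\<^bsub>Y\<^esub> else \<zero>\<^bsub>Y\<^esub>) \<ominus>\<^bsub>Y\<^esub> gn i j (Suc k))"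
  by (rule Y.T_plus_apply(1)[OF gen_family_Y assms])

lemma T_closed: "T i j k \<in> carrier Y"
proof -
  have "T \<in> carrier (End_tensor m n PY)" using PY.homogeneousD(1)[OF T_hom] .
  from Y.End_series_carrierD[OF this] show ?thesis .
qed

lemma zero_closed_delta: "(if b then \<one>\<^bsub>Y\<^esub> else \<zero>\<^bsub>Y\<^esub>) \<in> carrier Y"
  using Y.one_closed Y.zero_closed by simp

lemma \<Phi>_T:
  assumes "i \<in> idx m n" "j \<in> idx m n"
  shows "\<Phi> (T i j k) = (-1) ^ (par m i * par m j + par m j) * monodromy \<beta>s i j $ k"
proof -
  note c = gen_closed[OF assms, of k]
  have "\<Phi> (gn i j (Suc k)) = genval (i, j, Suc k)"
    unfolding gen_tc \<Phi>_tc[OF free_gen_closed[OF assms]] by (rule act_gen)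
  moreover have "\<Phi> (if i = j \<and> k = 0 then \<one>\<^bsub>Y\<^esub> else \<zero>\<^bsub>Y\<^esub>) = (if i = j \<and> k = 0 then 1 else 0)"
    using ring_map_\<Phi> Y.ring_map_zero[OF ring_map_\<Phi>] by (simp add: ring_map_def)
  ultimately show ?thesis
    unfolding T_apply[OF assms] Y.ring_map_signed[OF ring_map_\<Phi> Y.minus_closed[OF zero_closed_delta c]]
      Y.ring_map_minus[OF ring_map_\<Phi> zero_closed_delta c]
    by (simp add: genval_def)
qed

lemma level_zero_ops:
  assumes "x \<in> carrier Y" "y \<in> carrier Y" "x p = \<zero>\<^bsub>super_quot D (Fil p)\<^esub>"
  shows "signed Y k x p = \<zero>\<^bsub>super_quot D (Fil p)\<^esub>" "(y \<otimes>\<^bsub>Y\<^esub> x) p = \<zero>\<^bsub>super_quot D (Fil p)\<^esub>"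
  using D.signed_level[of x k p] D.completion_level[of y p] assms unfolding Y_eq by simp_all

lemma T_level:
  assumes "i \<in> idx m n" "j \<in> idx m n" "1 \<le> k" "p \<le> k"
  shows "T i j k p = \<zero>\<^bsub>super_quot D (Fil p)\<^esub>"
proof -
  note c = gen_closed[OF assms(1,2), of k]
  have e: "\<zero>\<^bsub>Y\<^esub> \<ominus>\<^bsub>Y\<^esub> gn i j (Suc k) = signed Y 1 (gn i j (Suc k))"
    using c by (simp add: signed_def Y.minus_eq)
  have z: "signed Y 1 (gn i j (Suc k)) p = \<zero>\<^bsub>super_quot D (Fil p)\<^esub>"
    by (rule level_zero_ops(1)[OF c Y.zero_closed gen_level[OF assms(1,2)]]) (use assms in simp)
  have d: "(if i = j \<and> k = 0 then \<one>\<^bsub>Y\<^esub> else \<zero>\<^bsub>Y\<^esub>) = \<zero>\<^bsub>Y\<^esub>" using assms(3) by auto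
  show ?thesis
    unfolding T_apply[OF assms(1,2)] d e
    by (rule level_zero_ops(1)[OF Y.signed_closed[OF c] Y.zero_closed z])
qed

lemma T_inverse:
  "\<exists>S\<in>carrier (End_tensor m n PY). T \<otimes>\<^bsub>End_tensor m n PY\<^esub> S = \<one>\<^bsub>End_tensor m n PY\<^esub> \<and>
     S \<otimes>\<^bsub>End_tensor m n PY\<^esub> T = \<one>\<^bsub>End_tensor m n PY\<^esub>"
proof -
  let ?M = "End_tensor m n PY"
  interpret M: superalg ?M by (rule PY.superalg_End_tensor)
  have T: "T \<in> carrier ?M" using PY.homogeneousD(1)[OF T_hom] .
  define X where "X = \<one>\<^bsub>?M\<^esub> \<ominus>\<^bsub>?M\<^esub> T"
  have X: "X \<in> carrier ?M" unfolding X_def by (rule M.minus_closed[OF M.one_closed T])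
  have v: "X i j c \<in> D.vanish 1" for i j c
  proof (cases "i \<in> idx m n \<and> j \<in> idx m n")
    case False
    then have "X i j = \<zero>\<^bsub>PY\<^esub>" using PY.End_carrierD(2,3)[OF X] by blast
    then have "X i j c = \<zero>\<^bsub>Y\<^esub>" by simp
    then show ?thesis using D.vanish_ops(2)[of 1] unfolding Y_eq by simp
  next
    case True
    then have ij: "i \<in> idx m n" "j \<in> idx m n" by auto
    note c = gen_closed[OF ij, of c]
    let ?d = "if i = j \<and> c = 0 then \<one>\<^bsub>Y\<^esub> else \<zero>\<^bsub>Y\<^esub>"
    have one: "\<one>\<^bsub>?M\<^esub> i j c = ?d" using ij by simp
    \<comment> \<open>Off the diagonal \<open>?d\<close> is zero, and on it the exponent
      \<open>p i * p i + p i\<close> is even, so the sign may be inserted.\<close>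
    have s: "?d = signed Y (par m i * par m j + par m j) ?d"
      using Y.signed_zero by (auto simp: signed_def par_def)
    have "X i j c = ?d \<ominus>\<^bsub>Y\<^esub> T i j c"
      unfolding X_def using Y.End_series_minus[OF M.one_closed T] one by simp
    also have "\<dots> = signed Y (par m i * par m j + par m j) (?d \<ominus>\<^bsub>Y\<^esub> (?d \<ominus>\<^bsub>Y\<^esub> gn i j (Suc c)))"
      unfolding T_apply[OF ij] using zero_closed_delta[of "i = j \<and> c = 0"] Y.minus_closed[OF _ c]
      by (subst s) (simp only: Y.signed_minus)
    also have "?d \<ominus>\<^bsub>Y\<^esub> (?d \<ominus>\<^bsub>Y\<^esub> gn i j (Suc c)) = gn i j (Suc c)"
    proof -
      have "a \<ominus>\<^bsub>Y\<^esub> (a \<ominus>\<^bsub>Y\<^esub> b) = b" if "a \<in> carrier Y" "b \<in> carrier Y" for a b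
        using that by (simp add: Y.minus_eq Y.minus_add Y.a_assoc[symmetric] Y.r_neg)
      then show ?thesis using zero_closed_delta c by blast
    qed
    finally have e: "X i j c = signed Y (par m i * par m j + par m j) (gn i j (Suc c))" .
    have "X i j c p = \<zero>\<^bsub>super_quot D (Fil p)\<^esub>" if "p \<le> 1" for p
      unfolding e by (rule level_zero_ops(1)[OF c Y.zero_closed gen_level[OF ij]]) (use that in simp)
    moreover have "X i j c \<in> carrier Y" unfolding e by (rule Y.signed_closed[OF c])
    ultimately show ?thesis unfolding D.vanish_def Y_eq by blast
  qed
  have "\<one>\<^bsub>?M\<^esub> \<ominus>\<^bsub>?M\<^esub> X = T"
    unfolding X_def using T M.one_closed
    by (simp add: M.minus_eq M.minus_add M.a_assoc[symmetric] M.r_neg del: End_tensor_simps)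
  then show ?thesis
    using D.one_minus_unit[of X m n] X v unfolding Y_eq by simp
qed

definition \<Phi>s :: "(nat \<Rightarrow> ext_yangian) \<Rightarrow> complex_op fps fps" where
  "\<Phi>s f = Abs_fps (\<lambda>k. \<Phi> (f k))"

lemma ring_map_\<Phi>s: "ring_map PY \<Phi>s"
  unfolding \<Phi>s_def by (rule Y.ring_map_power_series[OF ring_map_\<Phi>])

lemma \<Phi>s_T:
  assumes "i \<in> idx m n" "j \<in> idx m n"
  shows "\<Phi>s (T i j) = (-1) ^ (par m i * par m j + par m j) * monodromy \<beta>s i j"
  by (rule fps_ext) (simp add: \<Phi>s_def \<Phi>_T[OF assms] minus_one_power_iff)

text \<open>Up to signs, the image of \<open>S\<close> is a right inverse of the monodromy matrix
  and \<open>monodromy_inv\<close> is a left inverse, so the two coincide.\<close>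

lemma \<Phi>s_inverse:
  assumes S: "S \<in> carrier (End_tensor m n PY)" and TS: "T \<otimes>\<^bsub>End_tensor m n PY\<^esub> S = \<one>\<^bsub>End_tensor m n PY\<^esub>"
    and kl: "k \<in> idx m n" "l \<in> idx m n"
  shows "\<Phi>s (S k l) = (-1) ^ (par m k * par m l + par m l) * monodromy_inv \<beta>s k l"
proof -
  let ?p = "par m" and ?I = "idx m n"
  have Tc: "T \<in> carrier (End_tensor m n PY)" using PY.homogeneousD(1)[OF T_hom] .
  note DT = PY.End_carrierD(1)[OF Tc] and DS = PY.End_carrierD(1)[OF S]
  have mu: "\<Phi>s (a \<otimes>\<^bsub>PY\<^esub> b) = \<Phi>s a * \<Phi>s b" if "a \<in> carrier PY" "b \<in> carrier PY" for a b
    using ring_map_\<Phi>s that unfolding ring_map_def by blast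
  \<comment> \<open>Absorbing (-1)^(p j * p l) into the unknown turns the graded matrix product into
    the ordinary one over operators.\<close>
  have row: "(\<Sum>j\<in>?I. monodromy \<beta>s i j * ((-1) ^ (?p j * ?p l) * \<Phi>s (S j l))) = (if i = l then (-1) ^ ?p l else 0)"
    if i: "i \<in> ?I" for i
  proof -
    have "(\<Oplus>\<^bsub>PY\<^esub>j\<in>?I. PY.tw (?p j + ?p l) (T i j) \<otimes>\<^bsub>PY\<^esub> S j l) = (if i = l then \<one>\<^bsub>PY\<^esub> else \<zero>\<^bsub>PY\<^esub>)"
      using fun_cong[OF fun_cong[OF TS[unfolded PY.End_tensor_mult], of i], of l] i kl
      unfolding End_tensor_simps(3)[of m n PY] by (simp del: power_series_simps)
    then have "\<Phi>s (\<Oplus>\<^bsub>PY\<^esub>j\<in>?I. PY.tw (?p j + ?p l) (T i j) \<otimes>\<^bsub>PY\<^esub> S j l) = (if i = l then 1 else 0)"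
      using ring_map_\<Phi>s PY.ring_map_zero[OF ring_map_\<Phi>s] unfolding ring_map_def by simp
    moreover have "\<Phi>s (\<Oplus>\<^bsub>PY\<^esub>j\<in>?I. PY.tw (?p j + ?p l) (T i j) \<otimes>\<^bsub>PY\<^esub> S j l) =
       (\<Sum>j\<in>?I. \<Phi>s (PY.tw (?p j + ?p l) (T i j) \<otimes>\<^bsub>PY\<^esub> S j l))"
      by (rule PY.ring_map_finsum[OF ring_map_\<Phi>s]) (use PY.m_closed[OF PY.tw_closed[OF DT] DS] in auto)
    moreover have "\<Phi>s (PY.tw (?p j + ?p l) (T i j) \<otimes>\<^bsub>PY\<^esub> S j l) =
       (-1) ^ (?p i * ?p l) * (monodromy \<beta>s i j * ((-1) ^ (?p j * ?p l) * \<Phi>s (S j l)))" if j: "j \<in> ?I" for j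
    proof -
      have "\<Phi>s (PY.tw (?p j + ?p l) (T i j) \<otimes>\<^bsub>PY\<^esub> S j l) =
        ((-1) ^ ((?p j + ?p l) * (?p i + ?p j)) * ((-1) ^ (?p i * ?p j + ?p j) * monodromy \<beta>s i j)) * \<Phi>s (S j l)"
        unfolding mu[OF PY.tw_closed[OF DT] DS] PY.map_tw_homogeneous[OF ring_map_\<Phi>s T_hom i j] \<Phi>s_T[OF i j] by (rule refl)
      also have "\<dots> = (-1) ^ (?p i * ?p l) * (monodromy \<beta>s i j * ((-1) ^ (?p j * ?p l) * \<Phi>s (S j l)))"
        by (cases "even (?p i)"; cases "even (?p j)"; cases "even (?p l)"; simp add: minus_one_power_iff)
      finally show ?thesis .
    qed
    ultimately have "(-1) ^ (?p i * ?p l) * (\<Sum>j\<in>?I. monodromy \<beta>s i j * ((-1) ^ (?p j * ?p l) * \<Phi>s (S j l))) = (if i = l then 1 else 0)"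
      by (simp add: sum_distrib_left)
    from sg_cancel[OF this] show ?thesis by (auto simp: minus_one_power_iff)
  qed
  have "(-1) ^ (?p k * ?p l) * \<Phi>s (S k l) =
      (\<Sum>j\<in>?I. (if k = j then 1 else 0) * ((-1) ^ (?p j * ?p l) * \<Phi>s (S j l)))"
    using kl by (simp add: if_distrib[where f = "\<lambda>x. x * _"] cong: if_cong)
  also have "\<dots> = (\<Sum>j\<in>?I. (\<Sum>i\<in>?I. monodromy_inv \<beta>s k i * monodromy \<beta>s i j) * ((-1) ^ (?p j * ?p l) * \<Phi>s (S j l)))"
    by (intro sum.cong refl) (simp only: monodromy_inverse[OF kl(1)])
  also have "\<dots> = (\<Sum>i\<in>?I. monodromy_inv \<beta>s k i * (\<Sum>j\<in>?I. monodromy \<beta>s i j * ((-1) ^ (?p j * ?p l) * \<Phi>s (S j l))))"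
    unfolding sum_distrib_left sum_distrib_right mult.assoc by (rule sum.swap)
  also have "\<dots> = (\<Sum>i\<in>?I. if i = l then monodromy_inv \<beta>s k l * (-1) ^ ?p l else 0)"
    by (intro sum.cong refl) (simp add: row)
  also have "\<dots> = monodromy_inv \<beta>s k l * (-1) ^ ?p l" using kl by simp
  finally have "(-1) ^ (?p k * ?p l) * \<Phi>s (S k l) = monodromy_inv \<beta>s k l * (-1) ^ ?p l" .
  from sg_cancel[OF this] show ?thesis by (auto simp: minus_one_power_iff)
qed

abbreviation "kappa \<equiv> of_nat m - of_nat n :: complex"
abbreviation "Tsh \<equiv> \<lambda>i j. shift_series Y kappa (T i j)"

lemmas completed_sum_Y = D.completed_sum_eq[folded Y_eq] D.completed_sum_closed[folded Y_eq]
  D.completed_sum_signed[folded Y_eq]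

lemma shift_terms:
  assumes ij: "i \<in> idx m n" "j \<in> idx m n"
  defines "x \<equiv> \<lambda>k s. scalar Y (of_nat (s choose k) * kappa ^ (s - k)) \<otimes>\<^bsub>Y\<^esub> T i j s"
  shows "x k s \<in> carrier Y" "1 \<le> s \<Longrightarrow> p \<le> s \<Longrightarrow> x k s p = \<zero>\<^bsub>super_quot D (Fil p)\<^esub>"
    "invol Y (x k s) = signed Y (par m i + par m j) (x k s)"
    "Tsh i j k = completed_sum Y (x k)"
proof -
  show "x k s \<in> carrier Y" unfolding x_def by (rule Y.m_closed[OF scalar_closed T_closed])
  show "1 \<le> s \<Longrightarrow> p \<le> s \<Longrightarrow> x k s p = \<zero>\<^bsub>super_quot D (Fil p)\<^esub>"
    unfolding x_def by (rule level_zero_ops(2)[OF T_closed scalar_closed T_level[OF ij]])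
  have Tc: "T i j \<in> carrier PY" using T_closed by simp
  have "invol PY (T i j) = signed PY (par m i + par m j) (T i j)" by (rule PY.homogeneousD(2)[OF T_hom ij])
  then have "invol Y (T i j s) = signed Y (par m i + par m j) (T i j s)"
    unfolding Y.signed_power_series[OF Tc] by (auto simp: fun_eq_iff)
  then show "invol Y (x k s) = signed Y (par m i + par m j) (x k s)"
    unfolding x_def Y.invol_mult[OF scalar_closed T_closed] invol_scalar
    by (simp only: Y.signed_mult_right[OF scalar_closed T_closed])
  show "Tsh i j k = completed_sum Y (x k)" unfolding shift_series_def x_def by (rule refl)
qed

lemma T_outside: "\<not> (i \<in> idx m n \<and> j \<in> idx m n) \<Longrightarrow> T i j k = \<zero>\<^bsub>Y\<^esub>"
  by (auto simp: T_plus_def)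

lemma Tsh_homogeneous: "PY.homogeneous m n Tsh"
proof (rule PY.homogeneousI)
  fix i j assume ij: "i \<in> idx m n" "j \<in> idx m n"
  note t = shift_terms[OF ij]
  have c: "Tsh i j k \<in> carrier Y" for k
    unfolding t(4)[of k] by (rule completed_sum_Y(2)[OF t(1,2)])
  then show cc: "Tsh i j \<in> carrier PY" by simp
  have "invol Y (Tsh i j k) = signed Y (par m i + par m j) (Tsh i j k)" for k
    unfolding t(4)[of k] by (rule completed_sum_Y(3)[OF t(1,2,3)])
  then show "invol PY (Tsh i j) = signed PY (par m i + par m j) (Tsh i j)"
    unfolding Y.signed_power_series[OF cc] by simp
next
  fix i j assume "\<not> (i \<in> idx m n \<and> j \<in> idx m n)"
  note z = T_outside[OF this]
  \<comment> \<open>A shifted coefficient is a limit, so even a series of zeros has to be evaluated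
    through its partial sums.\<close>
  have "Tsh i j k = \<zero>\<^bsub>Y\<^esub>" for k
  proof
    fix p
    have e: "(\<lambda>s. scalar Y (of_nat (s choose k) * kappa ^ (s - k)) \<otimes>\<^bsub>Y\<^esub> T i j s) = (\<lambda>s. \<zero>\<^bsub>Y\<^esub>)"
      using scalar_closed by (simp add: z)
    have "completed_sum Y (\<lambda>s. \<zero>\<^bsub>Y\<^esub>) p = (\<Oplus>\<^bsub>Y\<^esub>s\<in>{..<Suc p}. \<zero>\<^bsub>Y\<^esub>) p"
      by (rule completed_sum_Y(1)) (use Y.zero_closed in \<open>simp_all\<close>, simp add: Y_eq)
    then show "Tsh i j k p = \<zero>\<^bsub>Y\<^esub> p" unfolding shift_series_def e by simp
  qed
  then show "Tsh i j = \<zero>\<^bsub>PY\<^esub>" by (simp add: fun_eq_iff)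
qed

text \<open>The coefficient of \<epsilon>^q depends on level q + 1 only, where the infinite sum
  reduces to its terms up to index q + 1. On the operator side the same truncation is exact because
  the monodromy satisfies \<open>conv\<close>.\<close>

lemma \<Phi>s_Tsh:
  assumes ij: "i \<in> idx m n" "j \<in> idx m n"
  shows "\<Phi>s (Tsh i j) = (-1) ^ (par m i * par m j + par m j) * shift (int m - int n) (monodromy \<beta>s i j)"
proof (intro fps_ext)
  fix k q
  note t = shift_terms[OF ij]
  define x where "x = (\<lambda>s. scalar Y (of_nat (s choose k) * kappa ^ (s - k)) \<otimes>\<^bsub>Y\<^esub> T i j s)"
  have xc: "x s \<in> carrier Y" for s using t(1) unfolding x_def .
  let ?e = "par m i * par m j + par m j" and ?c = "\<lambda>s. of_nat (s choose k) * (int m - int n) ^ (s - k)"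
  have kap: "of_nat (s choose k) * kappa ^ (s - k) = of_int (?c s)" for s by simp
  have sc: "scal (of_int i) = of_int i" for i by (rule rhomD(10)[OF rhom_scal])
  have "Tsh i j k (Suc q) = (\<Oplus>\<^bsub>Y\<^esub>s\<in>{..<Suc (Suc q)}. x s) (Suc q)"
    unfolding t(4)[of k] x_def by (rule completed_sum_Y(1)[OF t(1,2)]) simp_all
  then have "\<Phi> (Tsh i j k) $ q = \<Phi> (\<Oplus>\<^bsub>Y\<^esub>s\<in>{..<Suc (Suc q)}. x s) $ q" by (rule \<Phi>_level)
  also have "\<dots> = (\<Sum>s<Suc (Suc q). \<Phi> (x s) $ q)"
    using Y.ring_map_finsum[OF ring_map_\<Phi>, of "{..<Suc (Suc q)}" x] xc by (simp add: fps_sum_nth del: sum.lessThan_Suc)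
  also have "\<dots> = (\<Sum>s<Suc (Suc q). (-1) ^ ?e * (of_int (?c s) * monodromy \<beta>s i j $ s $ q))"
  proof (intro sum.cong refl)
    fix s
    have "\<Phi> (x s) = fps_const (scal (of_int (?c s))) * ((-1) ^ ?e * monodromy \<beta>s i j $ s)"
      unfolding x_def kap using ring_map_\<Phi> scalar_closed T_closed \<Phi>_scalar \<Phi>_T[OF ij]
      unfolding ring_map_def by simp
    then show "\<Phi> (x s) $ q = (-1) ^ ?e * (of_int (?c s) * monodromy \<beta>s i j $ s $ q)"
      unfolding sc by (auto simp: minus_one_power_iff)
  qed
  also have "\<dots> = (-1) ^ ?e * (\<Sum>s\<le>Suc q. of_int (?c s) * monodromy \<beta>s i j $ s $ q)"
    by (simp only: sum_distrib_left lessThan_Suc_atMost)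
  also have "\<dots> = (-1) ^ ?e * shift (int m - int n) (monodromy \<beta>s i j) $ k $ q"
    by (subst shift_nth_bound[OF conv_monodromy, of q "Suc q"]) simp_all
  finally show "\<Phi>s (Tsh i j) $ k $ q = ((-1) ^ ?e * shift (int m - int n) (monodromy \<beta>s i j)) $ k $ q"
    by (simp add: \<Phi>s_def minus_one_power_iff)
qed

text \<open>The entry \<open>1 1 1 1\<close> of the defining equation, available since m + n > 0,
  becomes the crossing sum of the monodromy matrix after all signs of \<open>T_plus\<close> and of
  its inverse are collected.\<close>

theorem \<Phi>s_z:
  assumes "is_z_plus m n Z"
  shows "\<Phi>s Z = emb (prod_list (map scalar_factor \<beta>s))"
proof -
  let ?E = "End2_tensor m n PY" and ?p = "par m" and ?I = "idx m n"
  let ?Q = "supertranspose2 m PY (perm_elt m n PY)"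
  obtain S where S: "S \<in> carrier (End_tensor m n PY)" "T \<otimes>\<^bsub>End_tensor m n PY\<^esub> S = \<one>\<^bsub>End_tensor m n PY\<^esub>"
    "S \<otimes>\<^bsub>End_tensor m n PY\<^esub> T = \<one>\<^bsub>End_tensor m n PY\<^esub>" using T_inverse by blast
  have Tc: "T \<in> carrier (End_tensor m n PY)" using PY.homogeneousD(1)[OF T_hom] .
  have Z: "Z \<in> carrier PY" and eq: "?Q \<otimes>\<^bsub>?E\<^esub> copy1 m n PY Tsh \<otimes>\<^bsub>?E\<^esub> supertranspose2 m PY (copy2 m n PY S) =
      ?Q \<otimes>\<^bsub>?E\<^esub> PY.scalar2 m n Z"
    using assms unfolding is_z_plus_def Let_def PY.inv_copy2[OF Tc S] PY.scalar2_def by blast+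
  have o: "1 \<in> ?I" unfolding idx_def atLeastAtMost_iff using dims by linarith
  have "\<Phi>s ((?Q \<otimes>\<^bsub>?E\<^esub> copy1 m n PY Tsh \<otimes>\<^bsub>?E\<^esub> supertranspose2 m PY (copy2 m n PY S)) 1 1 1 1) =
     (-1) ^ ?p 1 * (\<Sum>j\<in>?I. \<Phi>s (Tsh j 1) * \<Phi>s (S 1 j))"
    by (rule PY.map_z_left(1)[OF ring_map_\<Phi>s Tsh_homogeneous S(1) o])
  moreover have "\<Phi>s ((?Q \<otimes>\<^bsub>?E\<^esub> PY.scalar2 m n Z) 1 1 1 1) = (-1) ^ ?p 1 * \<Phi>s Z"
    by (rule PY.map_z_left(2)[OF ring_map_\<Phi>s Tsh_homogeneous S(1) o Z])
  ultimately have "(-1) ^ ?p 1 * \<Phi>s Z = (-1) ^ ?p 1 * (\<Sum>j\<in>?I. \<Phi>s (Tsh j 1) * \<Phi>s (S 1 j))"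
    unfolding eq by simp
  then have "\<Phi>s Z = (\<Sum>j\<in>?I. \<Phi>s (Tsh j 1) * \<Phi>s (S 1 j))"
    by (cases "even (?p 1)") (simp_all add: minus_one_power_iff)
  also have "\<dots> = (\<Sum>l\<in>?I. (-1) ^ (?p 1 + ?p l) * (shift (int m - int n) (monodromy \<beta>s l 1) * monodromy_inv \<beta>s 1 l))"
  proof (intro sum.cong refl)
    fix l assume l: "l \<in> ?I"
    show "\<Phi>s (Tsh l 1) * \<Phi>s (S 1 l) = (-1) ^ (?p 1 + ?p l) * (shift (int m - int n) (monodromy \<beta>s l 1) * monodromy_inv \<beta>s 1 l)"
      unfolding \<Phi>s_Tsh[OF l o] \<Phi>s_inverse[OF S(1,2) o l]
      by (cases "even (?p 1)"; cases "even (?p l)"; simp add: minus_one_power_iff)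
  qed
  also have "\<dots> = emb (prod_list (map scalar_factor \<beta>s))" by (rule monodromy_crossing[OF o])
  finally show ?thesis .
qed

end

section \<open>Algebraic independence\<close>

lemma exists_complex_root:
  assumes "0 < s"
  shows "\<exists>x :: complex. x ^ s = c"
proof
  show "rcis (root s (cmod c)) (Arg c / s) ^ s = c"
    using assms by (simp add: DeMoivre2 rcis_cmod_Arg)
qed

lemma exists_primitive_root:
  assumes s: "0 < s"
  shows "\<exists>w :: complex. w ^ s = 1 \<and> (\<forall>k. 0 < k \<longrightarrow> k < s \<longrightarrow> w ^ k \<noteq> 1)"
proof (intro exI conjI allI impI)
  let ?w = "cis (2 * pi * real 1 / real s)"
  have pow: "?w ^ k = cis (2 * pi * real k / real s)" for k
    by (simp add: DeMoivre mult_ac)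
  note bij = bij_betw_roots_unity[OF s]
  show "?w ^ s = 1" using s unfolding pow by simp
  fix k assume k: "0 < k" "k < s"
  have "inj_on (\<lambda>k. cis (2 * pi * real k / real s)) {..<s}" using bij by (rule bij_betw_imp_inj_on)
  from inj_onD[OF this, of k 0] k s show "?w ^ k \<noteq> 1" unfolding pow by auto
qed

text \<open>The nonzero power sums of \<open>x\<close> times the \<open>s\<close>-th roots of unity have index divisible by \<open>s\<close>.\<close>

lemma power_sums_surjective:
  "\<exists>\<beta>s :: complex list. \<forall>k. 1 \<le> k \<and> k \<le> R \<longrightarrow> (\<Sum>\<beta>\<leftarrow>\<beta>s. \<beta> ^ k) = y k"
proof (induction R)
  case 0
  then show ?case by simp
next
  case (Suc R)
  then obtain \<beta>s :: "complex list" where IH: "\<And>k. 1 \<le> k \<Longrightarrow> k \<le> R \<Longrightarrow> (\<Sum>\<beta>\<leftarrow>\<beta>s. \<beta> ^ k) = y k" by blast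
  let ?s = "Suc R"
  obtain w :: complex where w: "w ^ ?s = 1" "\<And>k. 0 < k \<Longrightarrow> k < ?s \<Longrightarrow> w ^ k \<noteq> 1"
    using exists_primitive_root[of ?s] by blast
  \<comment> \<open>The numbers \<open>x * w ^ j\<close> do not affect the power sums of index below
    \<open>?s\<close> and add s x^s to the one of index \<open>?s\<close>; \<open>x\<close> is
    chosen to correct that one.\<close>
  obtain x :: complex where x: "x ^ ?s = (y ?s - (\<Sum>\<beta>\<leftarrow>\<beta>s. \<beta> ^ ?s)) / of_nat ?s"
    using exists_complex_root[of ?s] by blast
  let ?us = "map (\<lambda>j. x * w ^ j) [0..<?s]"
  have us: "(\<Sum>\<beta>\<leftarrow>?us. \<beta> ^ k) = x ^ k * (\<Sum>j<?s. (w ^ k) ^ j)" for k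
  proof -
    have "(\<Sum>\<beta>\<leftarrow>?us. \<beta> ^ k) = (\<Sum>j<?s. (x * w ^ j) ^ k)"
      by (simp only: map_map comp_def interv_sum_list_conv_sum_set_nat set_upt atLeast0LessThan)
    also have "\<dots> = x ^ k * (\<Sum>j<?s. (w ^ k) ^ j)"
      unfolding sum_distrib_left by (intro sum.cong refl) (simp add: power_mult_distrib mult.commute flip: power_mult)
    finally show ?thesis .
  qed
  show ?case
  proof (intro exI allI impI)
    fix k assume k: "1 \<le> k \<and> k \<le> Suc R"
    show "(\<Sum>\<beta>\<leftarrow>\<beta>s @ ?us. \<beta> ^ k) = y k"
    proof (cases "k = ?s")
      case True
      have "(\<Sum>\<beta>\<leftarrow>?us. \<beta> ^ ?s) = x ^ ?s * of_nat ?s" unfolding us w(1) by simp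
      moreover have "of_nat ?s \<noteq> (0 :: complex)" by (rule of_nat_neq_0)
      ultimately show ?thesis
        unfolding True map_append sum_list.append x by (simp del: of_nat_Suc upt_Suc power_Suc)
    next
      case False
      then have k': "0 < k" "k < ?s" "k \<le> R" using k by auto
      have "(w ^ k) ^ ?s = (w ^ ?s) ^ k" by (simp only: power_mult[symmetric] mult.commute)
      then have "(\<Sum>j<?s. (w ^ k) ^ j) = 0"
        using w(2)[OF k'(1,2)] w(1) geometric_sum[of "w ^ k" ?s] by simp
      then have "(\<Sum>\<beta>\<leftarrow>?us. \<beta> ^ k) = 0" unfolding us by simp
      then show ?thesis unfolding map_append sum_list.append using IH[of k] k k'(3) by simp
    qed
  qed
qed

section \<open>Nonvanishing of polynomials in several variables\<close>

lemma digits_inj: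
  fixes a b :: "nat \<Rightarrow> nat"
  assumes "\<And>r. r < R \<Longrightarrow> a r < B" "\<And>r. r < R \<Longrightarrow> b r < B" "(\<Sum>r<R. a r * B ^ r) = (\<Sum>r<R. b r * B ^ r)" "r < R"
  shows "a r = b r"
  using assms
proof (induction R arbitrary: a b r)
  case (Suc R)
  have e: "(\<Sum>r<Suc R. a r * B ^ r) = a 0 + B * (\<Sum>r<R. a (Suc r) * B ^ r)" for a :: "nat \<Rightarrow> nat"
    by (simp add: sum.lessThan_Suc_shift sum_distrib_left mult_ac del: sum.lessThan_Suc)
  have eq: "a 0 + B * (\<Sum>r<R. a (Suc r) * B ^ r) = b 0 + B * (\<Sum>r<R. b (Suc r) * B ^ r)"
    using Suc.prems(3) unfolding e .
  have ab: "a 0 < B" "b 0 < B" using Suc.prems by auto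
  have "a 0 = b 0" using arg_cong[OF eq, of "\<lambda>x. x mod B"] ab by simp
  with eq ab have "(\<Sum>r<R. a (Suc r) * B ^ r) = (\<Sum>r<R. b (Suc r) * B ^ r)" by simp
  then have "a (Suc r) = b (Suc r)" if "r < R" for r
    using Suc.IH[of "\<lambda>r. a (Suc r)" "\<lambda>r. b (Suc r)" r] Suc.prems(1,2) that by simp
  then show ?case using \<open>a 0 = b 0\<close> Suc.prems(4) by (cases r) auto
qed simp

text \<open>By Kronecker's substitution of \<open>t^(B^r)\<close> for the \<open>r\<close>-th variable.\<close>

lemma multivariate_nonvanishing:
  fixes c :: "(nat \<Rightarrow>\<^sub>0 nat) \<Rightarrow> complex"
  assumes K: "finite K" "K \<noteq> {}" "\<And>e. e \<in> K \<Longrightarrow> c e \<noteq> 0"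
  shows "\<exists>y. (\<Sum>e\<in>K. c e * (\<Prod>r\<in>Poly_Mapping.keys e. y r ^ Poly_Mapping.lookup e r)) \<noteq> 0"
proof -
  let ?l = Poly_Mapping.lookup
  define V where "V = (\<Union>e\<in>K. Poly_Mapping.keys e)"
  have "finite V" using K by (simp add: V_def)
  then obtain R where R: "V \<subseteq> {..<R}" unfolding finite_nat_set_iff_bounded by (metis lessThan_iff subsetI)
  have "finite (\<Union>e\<in>K. ?l e ` V)" using K \<open>finite V\<close> by simp
  then obtain B where B: "(\<Union>e\<in>K. ?l e ` V) \<subseteq> {..<B}" unfolding finite_nat_set_iff_bounded by (metis lessThan_iff subsetI)
  \<comment> \<open>The exponent of t after the substitution. \<open>Suc B\<close> exceeds every
    exponent in \<open>K\<close>, so uniqueness of digits makes \<open>N\<close> injective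
    there.\<close>
  define N where "N e = (\<Sum>r<R. ?l e r * Suc B ^ r)" for e
  have lB: "?l e r < Suc B" if "e \<in> K" for e r
  proof (cases "r \<in> Poly_Mapping.keys e")
    case True
    then show ?thesis using that B by (fastforce simp: V_def)
  qed (simp add: in_keys_iff)
  have inj: "inj_on N K"
  proof (rule inj_onI)
    fix d e assume de: "d \<in> K" "e \<in> K" "N d = N e"
    have "?l d r = ?l e r" if "r < R" for r
      using digits_inj[of R "?l d" "Suc B" "?l e" r] lB de that by (simp add: N_def)
    moreover have "?l d r = ?l e r" if "\<not> r < R" for r
    proof -
      have "r \<notin> V" using that R by auto
      then show ?thesis using de by (auto simp: V_def in_keys_iff)
    qed
    ultimately show "d = e" by (intro poly_mapping_eqI) blast
  qed
  define P where "P = (\<Sum>e\<in>K. monom (c e) (N e))"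
  obtain e where e: "e \<in> K" using K by blast
  \<comment> \<open>No two monomials collide, so \<open>P\<close> inherits a nonzero
    coefficient.\<close>
  have "coeff P (N e) = (\<Sum>d\<in>K. if d = e then c e else 0)"
    unfolding P_def coeff_sum using inj e by (intro sum.cong) (auto simp: inj_on_eq_iff)
  then have "P \<noteq> 0" using K e by auto
  then have "finite {t. poly P t = 0}" by (rule poly_roots_finite)
  then obtain t where t: "poly P t \<noteq> 0"
    using infinite_UNIV_char_0[where 'a = complex] by (metis (mono_tags) UNIV_eq_I mem_Collect_eq)
  have mon: "(\<Prod>r\<in>Poly_Mapping.keys e. (t ^ (Suc B ^ r)) ^ ?l e r) = t ^ N e" if "e \<in> K" for e
  proof -
    have "(\<Prod>r\<in>Poly_Mapping.keys e. (t ^ (Suc B ^ r)) ^ ?l e r) = (\<Prod>r<R. (t ^ (Suc B ^ r)) ^ ?l e r)"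
      by (rule prod.mono_neutral_left) (use that R in \<open>auto simp: V_def in_keys_iff\<close>)
    also have "\<dots> = t ^ N e" by (simp add: N_def power_sum mult.commute flip: power_mult)
    finally show ?thesis .
  qed
  have "poly P t = (\<Sum>e\<in>K. c e * t ^ N e)" by (simp add: P_def poly_sum poly_monom)
  then have "(\<Sum>e\<in>K. c e * (\<Prod>r\<in>Poly_Mapping.keys e. (t ^ (Suc B ^ r)) ^ ?l e r)) \<noteq> 0"
    using t mon by simp
  then show ?thesis by (intro exI[of _ "\<lambda>r. t ^ (Suc B ^ r)"])
qed

text \<open>The coefficient \<open>a\<close> may be zero. This keeps the notion multiplicative, and
  the order of a monomial then depends on its weight alone and not on the values of the power
  sums.\<close>

definition lead :: "nat \<Rightarrow> complex fps \<Rightarrow> complex \<Rightarrow> bool" where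
  "lead w f a \<longleftrightarrow> (\<forall>q<w. f $ q = 0) \<and> f $ w = a"

lemma lead_mult:
  assumes "lead v f a" "lead w g b"
  shows "lead (v + w) (f * g) (a * b)"
proof -
  have "(f * g) $ q = 0" if "q < v + w" for q
    by (rule fps_order_mult[OF _ _ that]) (use assms in \<open>auto simp: lead_def\<close>)
  moreover have "(f * g) $ (v + w) = (\<Sum>i\<in>{0..v + w}. if i = v then a * b else 0)"
    unfolding fps_mult_nth
  proof (intro sum.cong refl)
    fix i assume "i \<in> {0..v + w}"
    then consider "i < v" | "i = v" | "v + w - i < w" by force
    then show "f $ i * g $ (v + w - i) = (if i = v then a * b else 0)"
      using assms by cases (auto simp: lead_def)
  qed
  ultimately show ?thesis by (simp add: lead_def)
qed

lemma lead_one: "lead 0 1 1"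
  by (simp add: lead_def)

lemma lead_power: "lead w f a \<Longrightarrow> lead (k * w) (f ^ k) (a ^ k)"
  by (induction k) (auto simp: lead_one intro: lead_mult)

lemma lead_prod:
  assumes "finite S" "\<And>i. i \<in> S \<Longrightarrow> lead (w i) (f i) (a i)"
  shows "lead (\<Sum>i\<in>S. w i) (\<Prod>i\<in>S. f i) (\<Prod>i\<in>S. a i)"
  using assms by (induction S rule: finite_induct) (auto simp: lead_one intro: lead_mult)

definition z_image :: "complex list \<Rightarrow> nat \<Rightarrow> complex fps" where
  "z_image \<beta>s r = (if r = 1 then 1 else 0) - prod_list (map scalar_factor \<beta>s) $ (r - 1)"

text \<open>In the coefficient of u^(r-1), \<open>conv\<close> excludes orders below r - 1, and the
  excesses 0, 1 and 2 settle the orders r - 1, r and r + 1. The part of excess 0 is nonzero only at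
  r = 1, where the 1 in \<open>z_image\<close> cancels it.\<close>

lemma lead_z_image:
  assumes "1 \<le> r"
  shows "lead (r + 1) (z_image \<beta>s r) (- (of_nat r * (\<Sum>\<beta>\<leftarrow>\<beta>s. \<beta> ^ (r + 1))))"
proof -
  let ?Z = "prod_list (map scalar_factor \<beta>s)"
  obtain k where k: "r = Suc k" using assms by (cases r) auto
  have c: "conv ?Z" by (intro conv_prod_list conv_scalar_factor)
  have "?Z $ k $ q = (if q = 0 \<and> k = 0 then 1 else 0)" if q: "q < k + 2" for q
  proof -
    consider "q < k" | "q = k" | "q = k + 1" using q by linarith
    then show ?thesis
    proof cases
      case 1
      then show ?thesis using convD[OF c 1] by simp
    next
      case 2
      then show ?thesis using arg_cong[OF gr_scalar_factors(1)[of \<beta>s], of "\<lambda>f. f $ k"] by simp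
    next
      case 3
      then show ?thesis using arg_cong[OF gr_scalar_factors(2)[of \<beta>s], of "\<lambda>f. f $ k"] by simp
    qed
  qed
  moreover have "?Z $ k $ (k + 2) = of_nat r * (\<Sum>\<beta>\<leftarrow>\<beta>s. \<beta> ^ (k + 2))"
    using gr_scalar_factors(3)[of \<beta>s k] k by simp
  ultimately show ?thesis unfolding lead_def z_image_def k by auto
qed

section \<open>Images of polynomials in the coefficients of the central series\<close>

context yangian_rep begin

lemma \<Phi>_z:
  assumes zc: "\<And>r. 1 \<le> r \<Longrightarrow> z r \<in> carrier Y" and zp: "is_z_plus m n (minus_series Y \<one>\<^bsub>Y\<^esub> z)" and r: "1 \<le> r"
  shows "\<Phi> (z r) = fps_map scal (z_image \<beta>s r)"
proof -
  obtain k where k: "r = Suc k" using r by (cases r) auto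
  note h = rhomD[OF rhom_fps_map[OF rhom_scal]]
  have "\<Phi> (ps_const Y \<one>\<^bsub>Y\<^esub> k) = (if k = 0 then 1 else 0)"
    using ring_map_\<Phi> Y.ring_map_zero[OF ring_map_\<Phi>] by (simp add: ps_const_def ring_map_def)
  moreover have "ps_const Y \<one>\<^bsub>Y\<^esub> k \<in> carrier Y" by (simp add: ps_const_def)
  ultimately have "\<Phi> (minus_series Y \<one>\<^bsub>Y\<^esub> z k) = (if k = 0 then 1 else 0) - \<Phi> (z r)"
    unfolding minus_series_def k using Y.ring_map_minus[OF ring_map_\<Phi> _ zc[of "Suc k"]] by simp
  moreover have "\<Phi> (minus_series Y \<one>\<^bsub>Y\<^esub> z k) = fps_map scal (prod_list (map scalar_factor \<beta>s) $ k)"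
    using arg_cong[OF \<Phi>s_z[OF zp], of "\<lambda>f. f $ k"] by (simp add: \<Phi>s_def emb_def)
  ultimately show ?thesis
    unfolding z_image_def k h(6) by (cases "k = 0") (simp_all add: h(1,4) algebra_simps)
qed

text \<open>All values are embedded scalars, so the ordered product in \<open>eval_monomial\<close>
  becomes an unordered product over the variables.\<close>

lemma \<Phi>_eval_polynomial:
  assumes zc: "\<And>r. 1 \<le> r \<Longrightarrow> z r \<in> carrier Y" and zp: "is_z_plus m n (minus_series Y \<one>\<^bsub>Y\<^esub> z)"
    and f: "\<forall>e\<in>Poly_Mapping.keys f. Poly_Mapping.keys e \<subseteq> {1..}"
  shows "\<Phi> (eval_polynomial Y z f) = fps_map scal (\<Sum>e\<in>Poly_Mapping.keys f. fps_const (Poly_Mapping.lookup f e) *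
     (\<Prod>r\<in>Poly_Mapping.keys e. z_image \<beta>s r ^ Poly_Mapping.lookup e r))"
proof -
  note h = rhomD[OF rhom_fps_map[OF rhom_scal]]
  have mu: "\<Phi> (a \<otimes>\<^bsub>Y\<^esub> b) = \<Phi> a * \<Phi> b" if "a \<in> carrier Y" "b \<in> carrier Y" for a b
    using ring_map_\<Phi> that unfolding ring_map_def by blast
  have on: "\<Phi> \<one>\<^bsub>Y\<^esub> = 1" using ring_map_\<Phi> unfolding ring_map_def by blast
  have pow: "\<Phi> (a [^]\<^bsub>Y\<^esub> (k::nat)) = \<Phi> a ^ k" if "a \<in> carrier Y" for a k
    by (induction k) (use that mu on Y.nat_pow_closed in \<open>simp_all add: power_Suc2 del: power_Suc\<close>)
  have mon: "eval_monomial Y z e \<in> carrier Y \<and> \<Phi> (eval_monomial Y z e) =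
     fps_map scal (\<Prod>r\<in>Poly_Mapping.keys e. z_image \<beta>s r ^ Poly_Mapping.lookup e r)"
    if e: "Poly_Mapping.keys e \<subseteq> {1..}" for e
  proof -
    let ?g = "\<lambda>r. z_image \<beta>s r ^ Poly_Mapping.lookup e r"
    let ?F = "\<lambda>xs. foldr (\<lambda>r y. z r [^]\<^bsub>Y\<^esub> Poly_Mapping.lookup e r \<otimes>\<^bsub>Y\<^esub> y) xs \<one>\<^bsub>Y\<^esub>"
    have "?F xs \<in> carrier Y \<and> \<Phi> (?F xs) = fps_map scal (prod_list (map ?g xs))" if "set xs \<subseteq> {1..}" for xs
      using that
    proof (induction xs)
      case Nil
      then show ?case by (simp add: on h(1))
    next
      case (Cons r xs)
      then have r: "1 \<le> r" and IH: "?F xs \<in> carrier Y" "\<Phi> (?F xs) = fps_map scal (prod_list (map ?g xs))" by auto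
      have p: "z r [^]\<^bsub>Y\<^esub> Poly_Mapping.lookup e r \<in> carrier Y" using zc[OF r] by (rule Y.nat_pow_closed)
      show ?case
        using Y.m_closed[OF p IH(1)] mu[OF p IH(1)] pow[OF zc[OF r]] \<Phi>_z[OF zc zp r]
        by (simp add: IH(2) h(3,9))
    qed
    from this[of "sorted_list_of_set (Poly_Mapping.keys e)"] show ?thesis
      using e by (simp add: eval_monomial_def prod.distinct_set_conv_list[symmetric])
  qed
  have t: "scalar Y c \<otimes>\<^bsub>Y\<^esub> eval_monomial Y z e \<in> carrier Y" if "e \<in> Poly_Mapping.keys f" for c e
    using that f mon scalar_closed Y.m_closed by blast
  have "\<Phi> (eval_polynomial Y z f) =
     (\<Sum>e\<in>Poly_Mapping.keys f. \<Phi> (scalar Y (Poly_Mapping.lookup f e) \<otimes>\<^bsub>Y\<^esub> eval_monomial Y z e))"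
    unfolding eval_polynomial_def by (rule Y.ring_map_finsum[OF ring_map_\<Phi>]) (use t in auto)
  also have "\<dots> = (\<Sum>e\<in>Poly_Mapping.keys f. fps_map scal (fps_const (Poly_Mapping.lookup f e) *
     (\<Prod>r\<in>Poly_Mapping.keys e. z_image \<beta>s r ^ Poly_Mapping.lookup e r)))"
    using f mon by (intro sum.cong refl) (simp add: mu scalar_closed \<Phi>_scalar h(3) fps_map_const[OF rhom_scal])
  finally show ?thesis unfolding h(8) .
qed

end

theorem mainTheorem5:
  fixes m n :: nat
    and z :: "nat \<Rightarrow> ext_yangian"
  assumes "\<not> (m = 0 \<and> n = 0)"
    and "\<And>r. 1 \<le> r \<Longrightarrow> z r \<in> carrier (ext_dual_yangian m n)"
    and "is_z_plus m n
           (minus_series (ext_dual_yangian m n) \<one>\<^bsub>ext_dual_yangian m n\<^esub> z)"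
  shows "algebraically_independent (ext_dual_yangian m n) {1..} z"
  unfolding algebraically_independent_def
proof (intro allI impI notI)
  fix f :: "(nat \<Rightarrow>\<^sub>0 nat) \<Rightarrow>\<^sub>0 complex"
  assume f: "\<forall>e\<in>Poly_Mapping.keys f. Poly_Mapping.keys e \<subseteq> {1..}" "f \<noteq> 0"
    and 0: "eval_polynomial (ext_dual_yangian m n) z f = \<zero>\<^bsub>ext_dual_yangian m n\<^esub>"
  let ?K = "Poly_Mapping.keys f" and ?l = Poly_Mapping.lookup
  \<comment> \<open>The image of the r-th variable has order at least r + 1, which dictates its
    weight.\<close>
  define wt where "wt e = (\<Sum>r\<in>Poly_Mapping.keys e. ?l e r * (r + 1))" for e :: "nat \<Rightarrow>\<^sub>0 nat"
  define W where "W = Min (wt ` ?K)"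
  let ?L = "{e \<in> ?K. wt e = W}"
  have K: "finite ?K" "?K \<noteq> {}" using f(2) by auto
  have W: "W \<le> wt e" if "e \<in> ?K" for e unfolding W_def using K that by simp
  have "W \<in> wt ` ?K" unfolding W_def using K by (intro Min_in) auto
  then have L: "finite ?L" "?L \<noteq> {}" "\<And>e. e \<in> ?L \<Longrightarrow> ?l f e \<noteq> 0" using K by (auto simp: in_keys_iff)
  \<comment> \<open>A point at which the part of lowest weight does not vanish; the power sums are
    adjusted to it.\<close>
  obtain y where y: "(\<Sum>e\<in>?L. ?l f e * (\<Prod>r\<in>Poly_Mapping.keys e. y r ^ ?l e r)) \<noteq> 0"
    using multivariate_nonvanishing[of ?L "?l f", OF L] by blast
  have "finite (\<Union>e\<in>?K. Poly_Mapping.keys e)" using K by simp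
  \<comment> \<open>The bound on the indices r is strict, so r + 1 is at most
    \<open>R\<close>.\<close>
  then obtain R where R: "(\<Union>e\<in>?K. Poly_Mapping.keys e) \<subseteq> {..<R}" unfolding finite_nat_set_iff_bounded by (metis lessThan_iff subsetI)
  \<comment> \<open>The index k = r + 1 belongs to the variable r, and the value cancels the factor
    -r of \<open>lead_z_image\<close>, so that the leading coefficient becomes \<open>y r\<close>.
    At k = 1 the quotient is 0 by the convention on division by zero; the variables have r >= 1 and
    thus concern k >= 2.\<close>
  obtain \<beta>s where \<beta>s: "\<And>k. 1 \<le> k \<Longrightarrow> k \<le> R \<Longrightarrow> (\<Sum>\<beta>\<leftarrow>\<beta>s. \<beta> ^ k) = - (y (k - 1) / of_nat (k - 1))"
    using power_sums_surjective[of R "\<lambda>k. - (y (k - 1) / of_nat (k - 1))"] by blast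
  interpret yangian_rep m n \<beta>s by unfold_locales (use assms(1) in auto)
  let ?m = "\<lambda>e. \<Prod>r\<in>Poly_Mapping.keys e. z_image \<beta>s r ^ ?l e r"
  have ld: "lead (wt e) (?m e) (\<Prod>r\<in>Poly_Mapping.keys e. y r ^ ?l e r)" if e: "e \<in> ?K" for e
    unfolding wt_def
  proof (intro lead_prod lead_power)
    fix r assume r: "r \<in> Poly_Mapping.keys e"
    then have "1 \<le> r" "r < R" using e f(1) R by auto
    then show "lead (r + 1) (z_image \<beta>s r) (y r)" using lead_z_image[of r \<beta>s] \<beta>s[of "r + 1"] by simp
  qed simp
  have "fps_map scal (\<Sum>e\<in>?K. fps_const (?l f e) * ?m e) = \<Phi> \<zero>\<^bsub>Y\<^esub>"
    using \<Phi>_eval_polynomial[OF assms(2,3) f(1)] 0 by simp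
  also have "\<dots> = 0" by (rule Y.ring_map_zero[OF ring_map_\<Phi>])
  finally have "fps_map scal (\<Sum>e\<in>?K. fps_const (?l f e) * ?m e) $ W = 0 $ W" by (rule arg_cong)
  then have "scal ((\<Sum>e\<in>?K. fps_const (?l f e) * ?m e) $ W) = scal 0"
    unfolding fps_map_nth fps_zero_nth rhomD(4)[OF rhom_scal] .
  then have "(\<Sum>e\<in>?K. ?l f e * ?m e $ W) = 0"
    unfolding scal_inj by (simp add: fps_sum_nth)
  \<comment> \<open>Monomials of weight above \<open>W\<close> have order above \<open>W\<close>, so
    only the part of lowest weight reaches the coefficient of \<epsilon>^W.\<close>
  moreover have "(\<Sum>e\<in>?K. ?l f e * ?m e $ W) = (\<Sum>e\<in>?L. ?l f e * ?m e $ W)"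
  proof (rule sum.mono_neutral_right)
    show "\<forall>e\<in>?K - ?L. ?l f e * ?m e $ W = 0"
    proof
      fix e assume e: "e \<in> ?K - ?L"
      then have "W < wt e" using W[of e] by auto
      then show "?l f e * ?m e $ W = 0" using ld[of e] e unfolding lead_def by simp
    qed
  qed (use K in auto)
  moreover have "\<dots> = (\<Sum>e\<in>?L. ?l f e * (\<Prod>r\<in>Poly_Mapping.keys e. y r ^ ?l e r))"
    by (intro sum.cong refl) (use ld in \<open>auto simp: lead_def\<close>)
  ultimately show False using y by simp
qed

end
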